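(* Let $\alpha \ge 1$, let $q = (x_0,y_0) \in \mathbb{G}_\alpha$, and let $\mathrm{Conj}_q(\mathbb{G}_\alpha)$ be the set of conjugate covectors $\lambda_0 \in T^*_q(\mathbb{G}_\alpha)$ with $H(q,\lambda_0)\neq 0$. Then there is a non-empty, open and dense subset $C^0$ of $\mathrm{Conj}_q(\mathbb{G}_\alpha)$ such that for every $\lambda_0 \in C^0$ the exponential map $\exp_q : T^*_q(\mathbb{G}_\alpha) \to \mathbb{G}_\alpha$ is equivalent, in a neighbourhood of $\lambda_0$, to the map $f : \mathbb{R}^2 \to \mathbb{R}^2 : (x,y) \mapsto (x^2, y)$.
   Context: For $\alpha \geq 1$, the $\alpha$-Grushin plane $\mathbb{G}_\alpha$ is the sub-Riemannian structure on $\mathbb{R}^2$ generated by the vector fields $X = \partial_x$ and $Y_\alpha = |x|^\alpha \partial_y$. Its Hamiltonian is $H(x,y,u\,dx+v\,dy) = \frac12(u^2 + v^2 x^{2\alpha})$ on $T^*(\mathbb{R}^2)$, where $x^{2\alpha}$ means $|x|^{2\alpha}$. For $q=(x_0,y_0)$ and $\lambda_0 = u_0\,dx|_q + v_0\,dy|_q$, the normal extremal with initial condition $(q,\lambda_0)$ is the solution of $\dot u = -\alpha v^2 |x|^{2(\alpha-1)} x$, $\dot v = 0$, $\dot x = u$, $\dot y = v|x|^{2\alpha}$ with initial values $(u_0,v_0,x_0,y_0)$; it exists for all times. The exponential map is $\exp_q(\lambda_0) = (x(1),y(1))$. A covector $\lambda_0\in T^*_q(\mathbb{G}_\alpha)$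 is conjugate to $q$ if $\mathrm{Ker}(d_{\lambda_0}\exp_q)\neq\{0\}$. "$\exp_q$ is equivalent to $f$ in a neighbourhood of $\lambda_0$" means that there are coordinate charts centered at $\lambda_0$ (in the source) and at $\exp_q(\lambda_0)$ (in the target) in which $\exp_q$ is represented by $f$. The set $\mathrm{Conj}_q(\mathbb{G}_\alpha)$ carries the subspace topology from $T^*_q(\mathbb{G}_\alpha)$. *)

theory Defs
  imports "HOL-Analysis.Analysis"
begin

text \<open>A point of the plane is \<open>(x, y)\<close>; the covector \<open>u dx + v dy\<close> is written \<open>(u, v)\<close>,
  so every cotangent fibre is identified with \<open>real \<times> real\<close>, including its topology.\<close>

definition grushin_hamiltonian :: "real \<Rightarrow> real \<times> real \<Rightarrow> real \<times> real \<Rightarrow> real" where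
  "grushin_hamiltonian \<alpha> = (\<lambda>(x, y) (u, v). (u\<^sup>2 + v\<^sup>2 * \<bar>x\<bar> powr (2 * \<alpha>)) / 2)"

text \<open>For \<open>\<alpha> = 1\<close> and \<open>x = 0\<close> the factor \<open>\<bar>x\<bar> powr (2 * (\<alpha> - 1))\<close> is \<open>0 powr 0 = 0\<close> rather than 1,
  which is harmless because it is multiplied by \<open>x\<close>.\<close>

definition grushin_extremal ::
  "real \<Rightarrow> real \<times> real \<Rightarrow> real \<times> real
    \<Rightarrow> (real \<Rightarrow> real) \<Rightarrow> (real \<Rightarrow> real) \<Rightarrow> (real \<Rightarrow> real) \<Rightarrow> (real \<Rightarrow> real) \<Rightarrow> bool" where
  "grushin_extremal \<alpha> q \<xi> u v x y \<longleftrightarrow>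
     (u 0, v 0) = \<xi> \<and> (x 0, y 0) = q \<and>
     (\<forall>t. (u has_real_derivative - \<alpha> * (v t)\<^sup>2 * \<bar>x t\<bar> powr (2 * (\<alpha> - 1)) * x t) (at t)) \<and>
     (\<forall>t. (v has_real_derivative 0) (at t)) \<and>
     (\<forall>t. (x has_real_derivative u t) (at t)) \<and>
     (\<forall>t. (y has_real_derivative v t * \<bar>x t\<bar> powr (2 * \<alpha>)) (at t))"

text \<open>For \<open>\<alpha> \<ge> 1\<close> the right-hand side of the system is continuously differentiable and its solutions
  are defined for all times, so the description below determines a unique point.\<close>

definition grushin_exp :: "real \<Rightarrow> real \<times> real \<Rightarrow> real \<times> real \<Rightarrow> real \<times> real" where
  "grushin_exp \<alpha> q \<xi> = (THE p. \<exists>u v x y. grushin_extremal \<alpha> q \<xi> u v x y \<and> p = (x 1, y 1))"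

definition grushin_conjugate :: "real \<Rightarrow> real \<times> real \<Rightarrow> real \<times> real \<Rightarrow> bool" where
  "grushin_conjugate \<alpha> q \<xi> \<longleftrightarrow>
     (\<exists>D. (grushin_exp \<alpha> q has_derivative D) (at \<xi>) \<and> {w. D w = 0} \<noteq> {0})"

definition Conj :: "real \<Rightarrow> real \<times> real \<Rightarrow> (real \<times> real) set" where
  "Conj \<alpha> q = {\<xi>. grushin_conjugate \<alpha> q \<xi> \<and> grushin_hamiltonian \<alpha> q \<xi> \<noteq> 0}"

text \<open>\<open>Ck_on k S f\<close> is meant for open \<open>S\<close> in a finite-dimensional space, where control of all iterated
  directional derivatives amounts to \<open>f\<close> being of class \<open>C\<^sup>k\<close>.\<close>

primrec Ck_on ::
  "nat \<Rightarrow> 'a::euclidean_space set \<Rightarrow> ('a \<Rightarrow> 'b::euclidean_space) \<Rightarrow> bool" where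
  "Ck_on 0 S f \<longleftrightarrow> continuous_on S f"
| "Ck_on (Suc k) S f \<longleftrightarrow>
     (\<forall>p\<in>S. f differentiable (at p)) \<and>
     (\<forall>w. Ck_on k S (\<lambda>p. frechet_derivative f (at p) w))"

definition smooth_on :: "'a::euclidean_space set \<Rightarrow> ('a \<Rightarrow> 'b::euclidean_space) \<Rightarrow> bool" where
  "smooth_on S f \<longleftrightarrow> (\<forall>k. Ck_on k S f)"

definition centered_chart ::
  "'a::euclidean_space \<Rightarrow> 'a set \<Rightarrow> ('a \<Rightarrow> 'b::euclidean_space) \<Rightarrow> bool" where
  "centered_chart p U \<phi> \<longleftrightarrow>
     open U \<and> p \<in> U \<and> \<phi> p = 0 \<and> inj_on \<phi> U \<and> open (\<phi> ` U) \<and>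
     smooth_on U \<phi> \<and> smooth_on (\<phi> ` U) (inv_into U \<phi>)"

definition equivalent_near ::
  "('a::euclidean_space \<Rightarrow> 'b::euclidean_space) \<Rightarrow> 'a
    \<Rightarrow> ('c::euclidean_space \<Rightarrow> 'd::euclidean_space) \<Rightarrow> bool" where
  "equivalent_near F p f \<longleftrightarrow>
     (\<exists>U \<phi> V \<psi>. centered_chart p U \<phi> \<and> centered_chart (F p) V \<psi> \<and>
        F ` U \<subseteq> V \<and> (\<forall>a\<in>U. \<psi> (F a) = f (\<phi> a)))"

end

theory Submission
  imports Defs
begin

text \<open>For \<open>v \<noteq> 0\<close> every extremal is \<open>x t = A * S (\<omega> * t + \<phi>)\<close>, where the generalized sine \<open>S\<close> solves
  \<open>S'' = - \<alpha> * \<bar>S\<bar> powr (2 * \<alpha> - 2) * S\<close> and satisfies \<open>S'\<^sup>2 + \<bar>S\<bar> powr (2 * \<alpha>) = 1\<close>. If \<open>x\<^sub>0 \<noteq> 0\<close>, then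
  \<open>A = x\<^sub>0 / S \<phi>\<close>, and the phases \<open>\<phi>\<close>, \<open>\<psi> = \<phi> + \<omega>\<close> at the times 0 and 1 are coordinates for the covectors
  in which the exponential map is explicit. With \<open>C = S'\<close> its Jacobian is a nonvanishing factor times
  \<open>K = S \<phi> * C \<psi> - S \<psi> * C \<phi> + (\<psi> - \<phi>) * C \<phi> * C \<psi>\<close>, and at a zero of \<open>K\<close> with
  \<open>C \<phi> \<noteq> 0\<close> and \<open>S \<psi> \<noteq> 0\<close>, where everything is smooth, the derivative of \<open>K\<close> along the kernel never
  vanishes, which makes the point a fold. At the remaining zeros one partial derivative of \<open>K\<close> is nonzero,
  so they are limits of such folds. If \<open>x\<^sub>0 = 0\<close>, then \<open>A\<close>, \<open>\<omega>\<close> are the coordinates and every conjugate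
  covector is a fold.\<close>

section \<open>Maps of class Ck\<close>

text \<open>For general \<alpha> the powers of |x| are not smooth at 0, so the flow cannot be
  differentiated arbitrarily often across the line x = 0. In phase coordinates an intermediate
  crossing leaves no trace: the endpoint involves \<open>S\<close> and \<open>C\<close> only at the
  two end phases and is smooth where \<open>S\<close> vanishes at neither. An endpoint on the
  singular line costs higher smoothness but not the formulas for the first derivatives. Since a
  conjugate covector comes with a derivative by definition, this is enough to deduce
  \<open>K = 0\<close> at every conjugate covector, including those where no smoothness is
  available. The open dense set consists of the conjugate covectors with u \<noteq> 0 and x(1)
  \<noteq> 0. Off the singular line this says \<open>C \<phi> \<noteq> 0\<close> and
  \<open>S \<psi> \<noteq> 0\<close>, and \<open>K = 0\<close> then excludes
  \<open>C \<psi> = 0\<close>. Covectors with v = 0 and u \<noteq> 0 are not reached by the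
  coordinates and need a separate estimate.\<close>

lemma Ck_on_cong:
  assumes "open S" "\<And>x. x \<in> S \<Longrightarrow> f x = g x"
  shows "Ck_on k S f \<longleftrightarrow> Ck_on k S g"
  using assms(2)
proof (induction k arbitrary: f g)
  case 0
  then show ?case by (simp cong: continuous_on_cong)
next
  case (Suc k)
  have tr: "(f has_derivative D) (at p) \<longleftrightarrow> (g has_derivative D) (at p)" if "p \<in> S" for p D
    using has_derivative_transform_within_open[OF _ assms(1) that] Suc.prems by metis
  have "frechet_derivative f (at p) = frechet_derivative g (at p)" if "p \<in> S" for p
    unfolding frechet_derivative_def using tr[OF that] by simp
  then have "Ck_on k S (\<lambda>p. frechet_derivative f (at p) w)
      \<longleftrightarrow> Ck_on k S (\<lambda>p. frechet_derivative g (at p) w)" for w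
    by (intro Suc.IH) simp
  moreover have "f differentiable (at p) \<longleftrightarrow> g differentiable (at p)" if "p \<in> S" for p
    unfolding differentiable_def using tr[OF that] by simp
  ultimately show ?case by simp
qed

lemma Ck_on_subset: "Ck_on k S f \<Longrightarrow> T \<subseteq> S \<Longrightarrow> Ck_on k T f"
  by (induction k arbitrary: f) (auto intro: continuous_on_subset)

text \<open>\<open>Ck_on\<close> speaks of the chosen \<open>frechet_derivative\<close>; on an open
  set derivatives are unique, so any explicit family \<open>f'\<close> may take its place.\<close>

lemma Ck_on_SucI:
  assumes "open S" "\<And>p. p \<in> S \<Longrightarrow> (f has_derivative f' p) (at p)"
    and "\<And>w. Ck_on k S (\<lambda>p. f' p w)"
  shows "Ck_on (Suc k) S f"
proof -
  have "frechet_derivative f (at p) = f' p" if "p \<in> S" for p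
    using frechet_derivative_at[OF assms(2)[OF that]] by simp
  then have "Ck_on k S (\<lambda>p. frechet_derivative f (at p) w)" for w
    using assms(3)[of w] Ck_on_cong[OF assms(1), of "\<lambda>p. frechet_derivative f (at p) w" "\<lambda>p. f' p w" k]
    by simp
  moreover have "f differentiable (at p)" if "p \<in> S" for p
    using assms(2)[OF that] by (rule differentiableI)
  ultimately show ?thesis by simp
qed

lemma Ck_on_SucD:
  assumes "open S" "Ck_on (Suc k) S f" "p \<in> S"
  shows "(f has_derivative frechet_derivative f (at p)) (at p)"
  using assms by (simp add: frechet_derivative_works)

lemma Ck_on_Suc_imp: "open S \<Longrightarrow> Ck_on (Suc k) S f \<Longrightarrow> Ck_on k S f"
proof (induction k arbitrary: f)
  case 0
  then show ?case
    by (auto intro!: continuous_at_imp_continuous_on differentiable_imp_continuous_within)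
next
  case (Suc k)
  then have "\<forall>p\<in>S. f differentiable (at p)"
    and "\<And>w. Ck_on (Suc k) S (\<lambda>p. frechet_derivative f (at p) w)"
    unfolding Ck_on.simps(2)[of "Suc k"] by blast+
  then show ?case using Suc.IH[OF \<open>open S\<close>] by simp
qed

lemma Ck_on_imp_continuous_on: "open S \<Longrightarrow> Ck_on k S f \<Longrightarrow> continuous_on S f"
  using Ck_on_Suc_imp[of S _ f] by (induction k) auto

lemma Ck_on_const: "open S \<Longrightarrow> Ck_on k S (\<lambda>_. c)"
proof (induction k arbitrary: c)
  case (Suc k)
  show ?case by (rule Ck_on_SucI[OF \<open>open S\<close>, where f' = "\<lambda>_ _. 0"]) (auto intro: Suc)
qed simp

lemma Ck_on_linear:
  assumes "open S" "bounded_linear f" shows "Ck_on k S f"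
proof (cases k)
  case 0
  then show ?thesis using assms(2) by (simp add: linear_continuous_on)
next
  case (Suc n)
  show ?thesis unfolding Suc
    by (rule Ck_on_SucI[OF assms(1), where f' = "\<lambda>_. f"])
      (auto intro: bounded_linear_imp_has_derivative assms Ck_on_const)
qed

lemma Ck_on_frechet: "Ck_on (Suc k) S f \<Longrightarrow> Ck_on k S (\<lambda>p. frechet_derivative f (at p) w)"
  by simp

lemma Ck_on_add:
  "open S \<Longrightarrow> Ck_on k S f \<Longrightarrow> Ck_on k S g \<Longrightarrow> Ck_on k S (\<lambda>x. f x + g x)"
proof (induction k arbitrary: f g)
  case 0
  then show ?case by (auto intro: continuous_on_add)
next
  case (Suc k)
  show ?case
    by (rule Ck_on_SucI[OF \<open>open S\<close> has_derivative_add[OF Ck_on_SucD[OF \<open>open S\<close> Suc.prems(2)]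
            Ck_on_SucD[OF \<open>open S\<close> Suc.prems(3)]]])
      (intro Suc.IH Ck_on_frechet Suc.prems | assumption)+
qed

lemma Ck_on_sum:
  "open S \<Longrightarrow> (\<And>i. i \<in> I \<Longrightarrow> Ck_on k S (f i)) \<Longrightarrow> Ck_on k S (\<lambda>x. \<Sum>i\<in>I. f i x)"
  by (induction I rule: infinite_finite_induct) (auto intro: Ck_on_const Ck_on_add)

lemma Ck_on_scaleR:
  "open S \<Longrightarrow> Ck_on k S f \<Longrightarrow> Ck_on k S g \<Longrightarrow> Ck_on k S (\<lambda>x. f x *\<^sub>R g x)"
proof (induction k arbitrary: f g)
  case 0
  then show ?case by (auto intro: continuous_on_scaleR)
next
  case (Suc k)
  note IH = Suc.IH[OF \<open>open S\<close>]
  show ?case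
  proof (rule Ck_on_SucI[OF \<open>open S\<close> has_derivative_scaleR[OF Ck_on_SucD[OF \<open>open S\<close> Suc.prems(2)]
            Ck_on_SucD[OF \<open>open S\<close> Suc.prems(3)]]])
    fix w
    show "Ck_on k S (\<lambda>p. f p *\<^sub>R frechet_derivative g (at p) w + frechet_derivative f (at p) w *\<^sub>R g p)"
      by (intro Ck_on_add IH Ck_on_frechet Ck_on_Suc_imp[OF \<open>open S\<close> Suc.prems(2)]
          Ck_on_Suc_imp[OF \<open>open S\<close> Suc.prems(3)] Suc.prems)
  qed
qed

lemma Ck_on_linear_compose:
  assumes "open S" "bounded_linear l"
  shows "Ck_on k S f \<Longrightarrow> Ck_on k S (\<lambda>x. l (f x))"
proof (induction k arbitrary: f)
  case 0
  then show ?case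
    using linear_continuous_on[OF assms(2), of UNIV] by (auto intro: continuous_on_compose2)
next
  case (Suc k)
  show ?case
    by (rule Ck_on_SucI[OF assms(1) bounded_linear.has_derivative[OF assms(2) Ck_on_SucD[OF assms(1) Suc.prems]]])
      (assumption | rule Suc.IH[OF Ck_on_frechet[OF Suc.prems]])+
qed

lemma Ck_on_compose:
  "open S \<Longrightarrow> open T \<Longrightarrow> f ` S \<subseteq> T \<Longrightarrow> Ck_on k S f \<Longrightarrow> Ck_on k T g \<Longrightarrow> Ck_on k S (\<lambda>x. g (f x))"
proof (induction k arbitrary: g)
  case 0
  then show ?case by (auto intro: continuous_on_compose2)
next
  case (Suc k)
  note f' = Ck_on_SucD[OF \<open>open S\<close> Suc.prems(4)]
  note g' = Ck_on_SucD[OF \<open>open T\<close> Suc.prems(5)]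
  \<comment> \<open>\<open>Ck_on\<close> controls derivatives in fixed directions, while the chain
    rule applies the derivative of \<open>g\<close> to a moving vector. Expanding that vector along
    \<open>Basis\<close> leaves smooth coefficients times fixed-direction derivatives.\<close>
  have *: "((\<lambda>x. g (f x)) has_derivative
      (\<lambda>w. \<Sum>e\<in>Basis. (frechet_derivative f (at p) w \<bullet> e) *\<^sub>R frechet_derivative g (at (f p)) e)) (at p)"
    if "p \<in> S" for p
  proof -
    have fp: "f p \<in> T" using that Suc.prems by auto
    have lin: "linear (frechet_derivative g (at (f p)))"
      using g'[OF fp] has_derivative_linear by blast
    have eq: "frechet_derivative g (at (f p)) v
        = (\<Sum>e\<in>Basis. (v \<bullet> e) *\<^sub>R frechet_derivative g (at (f p)) e)" for v
    proof -
      have "frechet_derivative g (at (f p)) v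
          = frechet_derivative g (at (f p)) (\<Sum>e\<in>Basis. (v \<bullet> e) *\<^sub>R e)"
        by (simp add: euclidean_representation)
      also have "\<dots> = (\<Sum>e\<in>Basis. (v \<bullet> e) *\<^sub>R frechet_derivative g (at (f p)) e)"
        by (simp add: linear_sum[OF lin] linear_scale[OF lin])
      finally show ?thesis .
    qed
    show ?thesis
      by (rule has_derivative_eq_rhs[OF has_derivative_compose[OF f'[OF that] g'[OF fp]]])
        (rule ext, rule eq)
  qed
  show ?case
  proof (rule Ck_on_SucI[OF \<open>open S\<close> *])
    fix w
    have "Ck_on k S (\<lambda>p. frechet_derivative f (at p) w \<bullet> e)" for e
      by (intro Ck_on_linear_compose[OF \<open>open S\<close> bounded_linear_inner_left] Ck_on_frechet Suc.prems)
    moreover have "Ck_on k S (\<lambda>p. frechet_derivative g (at (f p)) e)" for e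
      by (rule Suc.IH[OF Suc.prems(1-3) Ck_on_Suc_imp[OF \<open>open S\<close> Suc.prems(4)]
            Ck_on_frechet[OF Suc.prems(5)]])
    ultimately show "Ck_on k S (\<lambda>p. \<Sum>e\<in>Basis. (frechet_derivative f (at p) w \<bullet> e) *\<^sub>R frechet_derivative g (at (f p)) e)"
      using \<open>open S\<close> by (intro Ck_on_sum Ck_on_scaleR) simp_all
  qed
qed


lemma Ck_on_mult:
  fixes f g :: "'a::euclidean_space \<Rightarrow> real"
  shows "open S \<Longrightarrow> Ck_on k S f \<Longrightarrow> Ck_on k S g \<Longrightarrow> Ck_on k S (\<lambda>x. f x * g x)"
  using Ck_on_scaleR[of S k f g] by simp

lemma Ck_on_Pair:
  assumes "open S" "Ck_on k S f" "Ck_on k S g"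
  shows "Ck_on k S (\<lambda>x. (f x, g x))"
proof -
  have "Ck_on k S (\<lambda>x. (f x, 0) + (0, g x))"
    by (intro Ck_on_add assms(1) Ck_on_linear_compose[OF assms(1) _ assms(2)]
        Ck_on_linear_compose[OF assms(1) _ assms(3)] bounded_linear_Pair bounded_linear_ident bounded_linear_zero)
  then show ?thesis by simp
qed

lemma smooth_on_subset: "smooth_on S f \<Longrightarrow> T \<subseteq> S \<Longrightarrow> smooth_on T f"
  unfolding smooth_on_def using Ck_on_subset by blast

lemma smooth_on_cong:
  "open S \<Longrightarrow> (\<And>x. x \<in> S \<Longrightarrow> f x = g x) \<Longrightarrow> smooth_on S f \<longleftrightarrow> smooth_on S g"
  unfolding smooth_on_def using Ck_on_cong by blast

lemma smooth_on_imp_continuous_on: "open S \<Longrightarrow> smooth_on S f \<Longrightarrow> continuous_on S f"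
  unfolding smooth_on_def using Ck_on_imp_continuous_on by blast

lemma smooth_on_frechet: "smooth_on S f \<Longrightarrow> smooth_on S (\<lambda>p. frechet_derivative f (at p) w)"
  unfolding smooth_on_def using Ck_on_frechet by blast

lemma smooth_on_has_derivative:
  "smooth_on S f \<Longrightarrow> p \<in> S \<Longrightarrow> (f has_derivative frechet_derivative f (at p)) (at p)"
  unfolding smooth_on_def frechet_derivative_works[symmetric]
  by (metis Ck_on.simps(2))

lemma smooth_on_const: "open S \<Longrightarrow> smooth_on S (\<lambda>_. c)"
  and smooth_on_linear: "open S \<Longrightarrow> bounded_linear l \<Longrightarrow> smooth_on S l"
  and smooth_on_add: "open S \<Longrightarrow> smooth_on S f \<Longrightarrow> smooth_on S g \<Longrightarrow> smooth_on S (\<lambda>x. f x + g x)"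
  and smooth_on_mult: "open S \<Longrightarrow> smooth_on S F \<Longrightarrow> smooth_on S G \<Longrightarrow> smooth_on S (\<lambda>x. F x * G x :: real)"
  and smooth_on_Pair: "open S \<Longrightarrow> smooth_on S f \<Longrightarrow> smooth_on S h \<Longrightarrow> smooth_on S (\<lambda>x. (f x, h x))"
  unfolding smooth_on_def
  by (blast intro: Ck_on_const Ck_on_linear Ck_on_add Ck_on_mult Ck_on_Pair)+

lemma smooth_on_compose:
  "open S \<Longrightarrow> open T \<Longrightarrow> f ` S \<subseteq> T \<Longrightarrow> smooth_on S f \<Longrightarrow> smooth_on T g \<Longrightarrow> smooth_on S (\<lambda>x. g (f x))"
  unfolding smooth_on_def using Ck_on_compose by blast

lemma smooth_on_fst: "open T \<Longrightarrow> smooth_on T fst"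
  and smooth_on_snd: "open T \<Longrightarrow> smooth_on T snd"
  by (auto intro: smooth_on_linear bounded_linear_fst bounded_linear_snd)

lemma smooth_on_minus:
  fixes f :: "'a::euclidean_space \<Rightarrow> real"
  shows "open S \<Longrightarrow> smooth_on S f \<Longrightarrow> smooth_on S (\<lambda>x. - f x)"
  using smooth_on_mult[OF _ smooth_on_const[of S "-1"], of f] by simp

lemma smooth_on_diff:
  fixes f g :: "'a::euclidean_space \<Rightarrow> real"
  shows "open S \<Longrightarrow> smooth_on S f \<Longrightarrow> smooth_on S g \<Longrightarrow> smooth_on S (\<lambda>x. f x - g x)"
  using smooth_on_add[of S f "\<lambda>x. - g x"] smooth_on_minus[of S g] by simp

section \<open>Inverses and real powers away from zero\<close>

lemma open_nonzero: "open {x::real. x \<noteq> 0}"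
  using open_Compl[of "{0::real}"] by (simp add: Collect_neg_eq[symmetric] Compl_eq)

lemma Ck_on_inverse: "Ck_on k {x. x \<noteq> 0} (inverse :: real \<Rightarrow> real)"
proof (induction k)
  case 0
  show ?case by (auto intro!: continuous_intros)
next
  case (Suc k)
  show ?case
  proof (rule Ck_on_SucI[OF open_nonzero])
    show "(inverse has_derivative (\<lambda>w. (- w) * (inverse p * inverse p))) (at p)" if "p \<in> {x. x \<noteq> 0}" for p :: real
      using that by (auto intro!: derivative_eq_intros)
    show "Ck_on k {x. x \<noteq> 0} (\<lambda>p. (- w) * (inverse p * inverse p))" for w :: real
      by (intro Ck_on_mult Ck_on_const open_nonzero Suc.IH)
  qed
qed

text \<open>The form \<open>\<bar>x\<bar> powr c * inverse x\<close> serves both signs of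
  \<open>x\<close> and brings back the same exponent, so that \<open>Ck_on_abs_powr\<close> follows
  by induction with \<open>c\<close> fixed.\<close>

lemma has_real_derivative_abs_powr:
  "x \<noteq> 0 \<Longrightarrow> ((\<lambda>x. \<bar>x\<bar> powr c) has_real_derivative c * (\<bar>x\<bar> powr c * inverse x)) (at x)"
proof (cases "x > 0")
  case True
  have "((\<lambda>x. x powr c) has_real_derivative c * (\<bar>x\<bar> powr c * inverse x)) (at x)"
    using True by (auto intro!: derivative_eq_intros simp: powr_diff field_simps)
  then show ?thesis
    by (rule has_field_derivative_transform_within_open[where S = "{0<..}"]) (use True in auto)
next
  case False
  assume "x \<noteq> 0"
  with False have x: "x < 0" by simp
  have "((\<lambda>x. (- x) powr c) has_real_derivative c * (\<bar>x\<bar> powr c * inverse x)) (at x)"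
    using x by (auto intro!: derivative_eq_intros simp: powr_diff field_simps)
  then show ?thesis
    by (rule has_field_derivative_transform_within_open[where S = "{..<0}"]) (use x in auto)
qed

lemma Ck_on_abs_powr: "Ck_on k {x. x \<noteq> 0} (\<lambda>x::real. \<bar>x\<bar> powr c)"
proof (induction k)
  case 0
  show ?case by (auto intro!: continuous_intros)
next
  case (Suc k)
  show ?case
  proof (rule Ck_on_SucI[OF open_nonzero])
    show "((\<lambda>x. \<bar>x\<bar> powr c) has_derivative (\<lambda>w. c * (\<bar>p\<bar> powr c * inverse p) * w)) (at p)"
      if "p \<in> {x. x \<noteq> 0}" for p :: real
      using has_real_derivative_abs_powr[of p c] that by (simp add: has_field_derivative_def)
    show "Ck_on k {x. x \<noteq> 0} (\<lambda>p. c * (\<bar>p\<bar> powr c * inverse p) * w)" for w :: real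
      by (intro Ck_on_mult Ck_on_const open_nonzero Suc.IH Ck_on_inverse)
  qed
qed

lemma smooth_on_inverse:
  fixes f :: "'a::euclidean_space \<Rightarrow> real"
  assumes "open S" "smooth_on S f" "\<And>x. x \<in> S \<Longrightarrow> f x \<noteq> 0"
  shows "smooth_on S (\<lambda>x. inverse (f x))"
  by (rule smooth_on_compose[OF assms(1) open_nonzero _ assms(2)])
    (use assms(3) Ck_on_inverse in \<open>auto simp: smooth_on_def\<close>)

lemma smooth_on_divide:
  fixes f g :: "'a::euclidean_space \<Rightarrow> real"
  assumes "open S" "smooth_on S f" "smooth_on S g" "\<And>x. x \<in> S \<Longrightarrow> g x \<noteq> 0"
  shows "smooth_on S (\<lambda>x. f x / g x)"
  unfolding divide_inverse using assms by (intro smooth_on_mult smooth_on_inverse)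

lemma smooth_on_abs_powr:
  fixes f :: "'a::euclidean_space \<Rightarrow> real"
  assumes "open S" "smooth_on S f" "\<And>x. x \<in> S \<Longrightarrow> f x \<noteq> 0"
  shows "smooth_on S (\<lambda>x. \<bar>f x\<bar> powr c)"
  by (rule smooth_on_compose[OF assms(1) open_nonzero _ assms(2)])
    (use assms(3) Ck_on_abs_powr in \<open>auto simp: smooth_on_def\<close>)

section \<open>Local diffeomorphisms of the plane\<close>

text \<open>A chart in the sense of \<open>centered_chart\<close> without its base point. Unlike
  centered charts these maps can be restricted, composed and inverted freely.\<close>

definition diffeo_on :: "(real \<times> real) set \<Rightarrow> (real \<times> real \<Rightarrow> real \<times> real) \<Rightarrow> bool" where
  "diffeo_on U \<phi> \<longleftrightarrow> open U \<and> inj_on \<phi> U \<and> open (\<phi> ` U) \<and>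
     smooth_on U \<phi> \<and> smooth_on (\<phi> ` U) (inv_into U \<phi>)"

lemma centered_chart_iff: "centered_chart p U \<phi> \<longleftrightarrow> diffeo_on U \<phi> \<and> p \<in> U \<and> \<phi> p = 0"
  unfolding centered_chart_def diffeo_on_def by auto

lemma diffeo_onI:
  assumes "open U" "smooth_on U \<phi>" "open V" "smooth_on V \<theta>" "\<phi> ` U = V"
    and "\<And>x. x \<in> U \<Longrightarrow> \<theta> (\<phi> x) = x"
  shows "diffeo_on U \<phi>"
proof -
  have inj: "inj_on \<phi> U" using assms(6) by (rule inj_on_inverseI)
  have "inv_into U \<phi> y = \<theta> y" if y: "y \<in> V" for y
    using assms(5,6) inj y inv_into_f_f by force
  then show ?thesis
    unfolding diffeo_on_def assms(5) using assms inj smooth_on_cong[OF assms(3), of "inv_into U \<phi>" \<theta>] by auto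
qed

lemma diffeo_on_subset:
  assumes "diffeo_on U \<phi>" "open V" "V \<subseteq> U"
  shows "diffeo_on V \<phi>"
proof (rule diffeo_onI[OF assms(2) _ _ _ refl, where \<theta> = "inv_into U \<phi>"])
  note d = assms(1)[unfolded diffeo_on_def]
  show s: "smooth_on V \<phi>" using d assms(3) smooth_on_subset by blast
  show "open (\<phi> ` V)"
    by (rule invariance_of_domain[OF smooth_on_imp_continuous_on[OF assms(2) s] assms(2)])
      (use d assms(3) inj_on_subset in blast)
  show "smooth_on (\<phi> ` V) (inv_into U \<phi>)" using d assms(3) smooth_on_subset by (meson image_mono)
  show "inv_into U \<phi> (\<phi> x) = x" if "x \<in> V" for x
    using d assms(3) that by (meson inv_into_f_f subsetD)
qed

lemma diffeo_on_compose:
  assumes "diffeo_on U \<phi>" "diffeo_on V \<psi>" "\<phi> ` U \<subseteq> V"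
  shows "diffeo_on U (\<lambda>x. \<psi> (\<phi> x))"
proof (rule diffeo_onI[OF _ _ _ _ refl, where \<theta> = "\<lambda>y. inv_into U \<phi> (inv_into V \<psi> y)"])
  note d = assms(1)[unfolded diffeo_on_def]
  have U: "open (\<phi> ` U)" using d by blast
  note e = diffeo_on_subset[OF assms(2) U assms(3), unfolded diffeo_on_def]
  note dV = assms(2)[unfolded diffeo_on_def]
  show "open U" using d by blast
  show "smooth_on U (\<lambda>x. \<psi> (\<phi> x))"
    using d dV assms(3) by (blast intro: smooth_on_compose)
  have im: "(\<lambda>x. \<psi> (\<phi> x)) ` U = \<psi> ` (\<phi> ` U)" by (simp add: image_image)
  show "open ((\<lambda>x. \<psi> (\<phi> x)) ` U)" using e im by simp
  have *: "inv_into V \<psi> (\<psi> (\<phi> x)) = \<phi> x" if "x \<in> U" for x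
    using dV assms(3) that by (meson image_subset_iff inv_into_f_f)
  show "inv_into U \<phi> (inv_into V \<psi> (\<psi> (\<phi> x))) = x" if "x \<in> U" for x
    using that *[OF that] d by simp
  show "smooth_on ((\<lambda>x. \<psi> (\<phi> x)) ` U) (\<lambda>y. inv_into U \<phi> (inv_into V \<psi> y))"
  proof (rule smooth_on_compose[where T = "\<phi> ` U" and f = "inv_into V \<psi>" and g = "inv_into U \<phi>"])
    show "smooth_on ((\<lambda>x. \<psi> (\<phi> x)) ` U) (inv_into V \<psi>)"
      using dV assms(3) im by (metis image_mono smooth_on_subset)
  qed (use d e im * in auto)
qed

lemma diffeo_on_inv_into:
  assumes "diffeo_on U \<phi>" shows "diffeo_on (\<phi> ` U) (inv_into U \<phi>)"
proof (rule diffeo_onI[where V = U and \<theta> = \<phi>])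
  note d = assms[unfolded diffeo_on_def]
  show "inv_into U \<phi> ` \<phi> ` U = U" using d by (simp add: inj_on_def)
qed (use assms in \<open>auto simp: diffeo_on_def f_inv_into_f\<close>)

section \<open>Partial derivatives and Jacobians in the plane\<close>

definition pd1 :: "(real \<times> real \<Rightarrow> real) \<Rightarrow> real \<times> real \<Rightarrow> real" where
  "pd1 f p = frechet_derivative f (at p) (1, 0)"

definition pd2 :: "(real \<times> real \<Rightarrow> real) \<Rightarrow> real \<times> real \<Rightarrow> real" where
  "pd2 f p = frechet_derivative f (at p) (0, 1)"

definition jac :: "(real \<times> real \<Rightarrow> real) \<Rightarrow> (real \<times> real \<Rightarrow> real) \<Rightarrow> real \<times> real \<Rightarrow> real" where
  "jac f g p = pd1 f p * pd2 g p - pd2 f p * pd1 g p"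

lemma has_derivative_pd:
  assumes "f differentiable (at p)"
  shows "(f has_derivative (\<lambda>h. pd1 f p * fst h + pd2 f p * snd h)) (at p)"
proof -
  have d: "(f has_derivative frechet_derivative f (at p)) (at p)"
    using assms by (simp add: frechet_derivative_works)
  then have lin: "linear (frechet_derivative f (at p))" by (rule has_derivative_linear)
  have "frechet_derivative f (at p) = (\<lambda>h. pd1 f p * fst h + pd2 f p * snd h)"
  proof
    fix h :: "real \<times> real"
    have "h = fst h *\<^sub>R (1, 0) + snd h *\<^sub>R (0, 1)" by (simp add: prod_eq_iff)
    then have "frechet_derivative f (at p) h
        = frechet_derivative f (at p) (fst h *\<^sub>R (1, 0) + snd h *\<^sub>R (0, 1))" by simp
    then show "frechet_derivative f (at p) h = pd1 f p * fst h + pd2 f p * snd h"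
      unfolding pd1_def pd2_def linear_add[OF lin] linear_scale[OF lin] by simp
  qed
  with d show ?thesis by simp
qed

lemma pd_eqI:
  assumes "(f has_derivative (\<lambda>h. a * fst h + b * snd h)) (at p)"
  shows "pd1 f p = a" "pd2 f p = b"
  unfolding pd1_def pd2_def frechet_derivative_at[OF assms, symmetric] by simp_all

lemma smooth_on_differentiable: "smooth_on S f \<Longrightarrow> p \<in> S \<Longrightarrow> f differentiable (at p)"
  using smooth_on_has_derivative differentiableI by blast

lemma smooth_on_pd: "smooth_on S f \<Longrightarrow> smooth_on S (pd1 f)" "smooth_on S f \<Longrightarrow> smooth_on S (pd2 f)"
  unfolding pd1_def[abs_def] pd2_def[abs_def] by (rule smooth_on_frechet, assumption)+

lemma smooth_on_jac: "open S \<Longrightarrow> smooth_on S f \<Longrightarrow> smooth_on S g \<Longrightarrow> smooth_on S (jac f g)"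
  unfolding jac_def[abs_def] by (intro smooth_on_diff smooth_on_mult smooth_on_pd)

text \<open>The powers \<open>t ^ n\<close> make this class of integrals closed under differentiation.\<close>

lemma Ck_on_integral:
  fixes G :: "real \<times> real \<Rightarrow> real"
  assumes U: "open U" and star: "\<And>c d t. (c, d) \<in> U \<Longrightarrow> 0 \<le> t \<Longrightarrow> t \<le> 1 \<Longrightarrow> (t * c, d) \<in> U"
  shows "Ck_on k U G \<Longrightarrow> Ck_on k U (\<lambda>z. integral {0..1} (\<lambda>t. t ^ n * G (t * fst z, snd z)))"
proof (induction k arbitrary: G n)
  case 0
  have "continuous_on (U \<times> cbox 0 1) (\<lambda>(z, t). t ^ n * G (t * fst z, snd z))"
    unfolding split_beta
    by (intro continuous_intros continuous_on_compose2[OF 0[simplified]]) (auto simp: star)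
  then show ?case
    using integral_continuous_on_param[of U 0 1 "\<lambda>z t. t ^ n * G (t * fst z, snd z)"] by simp
next
  case (Suc k)
  have G': "G differentiable (at z)" if "z \<in> U" for z using Suc.prems that by simp
  have pdk: "Ck_on k U (pd1 G)" "Ck_on k U (pd2 G)"
    unfolding pd1_def[abs_def] pd2_def[abs_def] using Suc.prems by simp_all
  have cont: "continuous_on U G" "continuous_on U (pd1 G)" "continuous_on U (pd2 G)"
    using Ck_on_imp_continuous_on[OF U] pdk Suc.prems by blast+
  \<comment> \<open>\<open>leibniz_rule\<close> takes the derivative as a continuous family of
    bounded operators. Differentiating \<open>t * fst z\<close> produces one more factor
    \<open>t\<close>, hence the exponent \<open>Suc n\<close>.\<close>
  define D where "D z t = (t ^ Suc n * pd1 G (t * fst z, snd z)) *\<^sub>R Blinfun fst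
      + (t ^ n * pd2 G (t * fst z, snd z)) *\<^sub>R (Blinfun snd :: (real \<times> real) \<Rightarrow>\<^sub>L real)" for z :: "real \<times> real" and t
  have D_apply: "blinfun_apply (D z t) w = t ^ Suc n * pd1 G (t * fst z, snd z) * fst w
      + t ^ n * pd2 G (t * fst z, snd z) * snd w" for z t w
    unfolding D_def blinfun.add_left blinfun.scaleR_left
    by (simp add: bounded_linear_Blinfun_apply bounded_linear_fst bounded_linear_snd)
  have contD: "continuous_on (U \<times> cbox 0 1) (\<lambda>(z, t). D z t)"
    unfolding D_def split_beta
    by (intro continuous_intros continuous_on_compose2[OF cont(2)] continuous_on_compose2[OF cont(3)]) (auto simp: star)
  have cont1: "continuous_on {0..1} (\<lambda>t. H (t * fst z, snd z))" if "z \<in> U" "continuous_on U H" for z and H :: "real \<times> real \<Rightarrow> real"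
    by (intro continuous_on_compose2[OF that(2)] continuous_intros) (auto simp: star that)
  show ?case
  proof (rule Ck_on_SucI[OF U])
    fix z assume z: "z \<in> U"
    then obtain r where r: "r > 0" "ball z r \<subseteq> U" using U open_contains_ball by blast
    have "((\<lambda>z. integral (cbox 0 1) (\<lambda>t. t ^ n * G (t * fst z, snd z)))
        has_derivative integral (cbox 0 1) (D z)) (at z within ball z r)"
    proof (rule leibniz_rule)
      fix x t assume xt: "x \<in> ball z r" "t \<in> cbox (0::real) 1"
      have tx: "(t * fst x, snd x) \<in> U" using xt r star[of "fst x" "snd x" t] by auto
      have "((\<lambda>x. t ^ n * G (t * fst x, snd x)) has_derivative blinfun_apply (D x t)) (at x)"
      proof (rule has_derivative_eq_rhs)
        have m: "((\<lambda>x. (t * fst x, snd x)) has_derivative (\<lambda>w. (t * fst w, snd w))) (at x)"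
          by (intro derivative_intros)
        show "((\<lambda>x. t ^ n * G (t * fst x, snd x)) has_derivative
            (\<lambda>w. t ^ n * (pd1 G (t * fst x, snd x) * (t * fst w) + pd2 G (t * fst x, snd x) * snd w))) (at x)"
          using has_derivative_compose[OF m, of G, OF has_derivative_pd[OF G'[OF tx]]]
          by (intro has_derivative_mult_right) simp
      qed (simp add: D_apply fun_eq_iff algebra_simps)
      then show "((\<lambda>x. t ^ n * G (t * fst x, snd x)) has_derivative blinfun_apply (D x t)) (at x within ball z r)"
        by (rule has_derivative_at_withinI)
    next
      fix x assume "x \<in> ball z r"
      then have "x \<in> U" using r by auto
      then show "(\<lambda>t. t ^ n * G (t * fst x, snd x)) integrable_on cbox 0 1"
        using cont1[OF _ cont(1)] by (auto intro!: integrable_continuous_interval continuous_intros)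
    next
      show "continuous_on (ball z r \<times> cbox 0 1) (\<lambda>(x, t). D x t)"
        using contD r by (elim continuous_on_subset) auto
    qed (use r in auto)
    then have "((\<lambda>z. integral {0..1} (\<lambda>t. t ^ n * G (t * fst z, snd z)))
        has_derivative integral {0..1} (D z)) (at z)"
      using r at_within_open[of z "ball z r"] by simp
    moreover have "blinfun_apply (integral {0..1} (D z)) w
        = integral {0..1} (\<lambda>t. t ^ Suc n * pd1 G (t * fst z, snd z)) * fst w
        + integral {0..1} (\<lambda>t. t ^ n * pd2 G (t * fst z, snd z)) * snd w" for w
    proof -
      have "D z integrable_on {0..1}"
        unfolding D_def
        by (intro integrable_continuous_interval continuous_intros cont1[OF z] cont)
      then have "blinfun_apply (integral {0..1} (D z)) w = integral {0..1} (\<lambda>t. blinfun_apply (D z t) w)"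
        by (rule blinfun_apply_integral)
      also have "\<dots> = integral {0..1} (\<lambda>t. t ^ Suc n * pd1 G (t * fst z, snd z) * fst w)
          + integral {0..1} (\<lambda>t. t ^ n * pd2 G (t * fst z, snd z) * snd w)"
        unfolding D_apply
        by (intro integral_add integrable_continuous_interval continuous_intros cont1[OF z] cont)
      finally show ?thesis by simp
    qed
    ultimately show "((\<lambda>z. integral {0..1} (\<lambda>t. t ^ n * G (t * fst z, snd z))) has_derivative
        (\<lambda>w. integral {0..1} (\<lambda>t. t ^ Suc n * pd1 G (t * fst z, snd z)) * fst w
        + integral {0..1} (\<lambda>t. t ^ n * pd2 G (t * fst z, snd z)) * snd w)) (at z)"
      by (auto elim!: has_derivative_eq_rhs)
  next
    fix w :: "real \<times> real"
    show "Ck_on k U (\<lambda>z. integral {0..1} (\<lambda>t. t ^ Suc n * pd1 G (t * fst z, snd z)) * fst w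
        + integral {0..1} (\<lambda>t. t ^ n * pd2 G (t * fst z, snd z)) * snd w)"
      by (rule Ck_on_add[OF U Ck_on_mult[OF U Suc.IH[OF pdk(1)] Ck_on_const[OF U]]
            Ck_on_mult[OF U Suc.IH[OF pdk(2)] Ck_on_const[OF U]]])
  qed
qed

text \<open>The inverse function theorem with a smooth inverse. Continuity of the partial
  derivatives at \<open>p\<close> gives injectivity on a ball, which is then cut down to the points
  with nonzero Jacobian; invariance of domain makes the image open.\<close>

lemma local_diffeo:
  assumes S: "open S" "p \<in> S" and sm: "smooth_on S f" "smooth_on S g" and "jac f g p \<noteq> 0"
  obtains U where "p \<in> U" "U \<subseteq> S" "diffeo_on U (\<lambda>x. (f x, g x))" "\<And>x. x \<in> U \<Longrightarrow> jac f g x \<noteq> 0"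
proof -
  define F where "F = (\<lambda>x. (f x, g x))"
  define F' where "F' x h = (pd1 f x * fst h + pd2 f x * snd h, pd1 g x * fst h + pd2 g x * snd h)"
    for x h :: "real \<times> real"
  \<comment> \<open>The inverse matrix by Cramer's rule, whose entries are smooth wherever the
    Jacobian does not vanish.\<close>
  define G' where "G' x w = ((pd2 g x * fst w - pd2 f x * snd w) / jac f g x,
      (pd1 f x * snd w - pd1 g x * fst w) / jac f g x)" for x w :: "real \<times> real"
  have F': "(F has_derivative F' x) (at x)" if "x \<in> S" for x
    unfolding F_def F'_def
    using has_derivative_pd[OF smooth_on_differentiable[OF sm(1) that]]
      has_derivative_pd[OF smooth_on_differentiable[OF sm(2) that]] by (rule has_derivative_Pair)
  have smF: "smooth_on S F" unfolding F_def using S sm by (intro smooth_on_Pair)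
  have GF: "G' x \<circ> F' x = id" "F' x \<circ> G' x = id" if "jac f g x \<noteq> 0" for x
  proof -
    let ?j = "jac f g x"
    have "G' x (F' x h) = h" for h
    proof -
      have "pd2 g x * (pd1 f x * fst h + pd2 f x * snd h) - pd2 f x * (pd1 g x * fst h + pd2 g x * snd h) = ?j * fst h"
        "pd1 f x * (pd1 g x * fst h + pd2 g x * snd h) - pd1 g x * (pd1 f x * fst h + pd2 f x * snd h) = ?j * snd h"
        by (simp_all add: jac_def algebra_simps)
      then show ?thesis using that by (simp add: G'_def F'_def prod_eq_iff)
    qed
    moreover have "F' x (G' x w) = w" for w
    proof -
      have "pd1 f x * (pd2 g x * fst w - pd2 f x * snd w) + pd2 f x * (pd1 f x * snd w - pd1 g x * fst w) = ?j * fst w"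
        "pd1 g x * (pd2 g x * fst w - pd2 f x * snd w) + pd2 g x * (pd1 f x * snd w - pd1 g x * fst w) = ?j * snd w"
        by (simp_all add: jac_def algebra_simps)
      then show ?thesis using that
        by (simp add: G'_def F'_def prod_eq_iff add_divide_distrib[symmetric])
    qed
    ultimately show "G' x \<circ> F' x = id" "F' x \<circ> G' x = id" by (auto simp: fun_eq_iff)
  qed
  have blG: "bounded_linear (G' x)" for x
    unfolding G'_def divide_inverse
    by (intro bounded_linear_Pair bounded_linear_mult_const bounded_linear_sub
        bounded_linear_const_mult bounded_linear_fst bounded_linear_snd)
  have cpd: "isCont (pd1 f) p" "isCont (pd2 f) p" "isCont (pd1 g) p" "isCont (pd2 g) p"
    using smooth_on_imp_continuous_on[OF S(1)] smooth_on_pd sm S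
    by (meson continuous_on_eq_continuous_at)+
  obtain r where r: "r > 0" "ball p r \<subseteq> S" "inj_on F (ball p r)"
  proof (rule has_derivative_locally_injective[OF S(2,1) blG GF(1)[OF assms(5)] F'])
    fix e :: real assume e: "e > 0"
    have "\<forall>\<^sub>F x in nhds p. \<bar>pd1 f x - pd1 f p\<bar> + \<bar>pd2 f x - pd2 f p\<bar>
        + \<bar>pd1 g x - pd1 g p\<bar> + \<bar>pd2 g x - pd2 g p\<bar> < e"
    proof (rule order_tendstoD(2))
      show "((\<lambda>x. \<bar>pd1 f x - pd1 f p\<bar> + \<bar>pd2 f x - pd2 f p\<bar>
        + \<bar>pd1 g x - pd1 g p\<bar> + \<bar>pd2 g x - pd2 g p\<bar>) \<longlongrightarrow> 0) (nhds p)"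
        using cpd unfolding isCont_def[abs_def] continuous_at tendsto_at_iff_tendsto_nhds
        by (auto intro!: tendsto_eq_intros)
    qed (use e in auto)
    then obtain d where d: "d > 0" "\<And>x. dist x p < d \<Longrightarrow> \<bar>pd1 f x - pd1 f p\<bar> + \<bar>pd2 f x - pd2 f p\<bar>
        + \<bar>pd1 g x - pd1 g p\<bar> + \<bar>pd2 g x - pd2 g p\<bar> < e"
      unfolding eventually_nhds_metric by blast
    have "onorm (\<lambda>v. F' x v - F' p v) < e" if "dist p x < d" for x
    proof -
      let ?s = "\<bar>pd1 f x - pd1 f p\<bar> + \<bar>pd2 f x - pd2 f p\<bar> + \<bar>pd1 g x - pd1 g p\<bar> + \<bar>pd2 g x - pd2 g p\<bar>"
      have "norm (F' x v - F' p v) \<le> ?s * norm v" for v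
      proof -
        have v: "\<bar>fst v\<bar> \<le> norm v" "\<bar>snd v\<bar> \<le> norm v"
          by (simp_all add: norm_prod_def real_sqrt_ge_abs1 real_sqrt_ge_abs2)
        have "F' x v - F' p v = ((pd1 f x - pd1 f p) * fst v + (pd2 f x - pd2 f p) * snd v,
            (pd1 g x - pd1 g p) * fst v + (pd2 g x - pd2 g p) * snd v)"
          by (simp add: F'_def algebra_simps)
        then have "norm (F' x v - F' p v) \<le> \<bar>(pd1 f x - pd1 f p) * fst v + (pd2 f x - pd2 f p) * snd v\<bar>
            + \<bar>(pd1 g x - pd1 g p) * fst v + (pd2 g x - pd2 g p) * snd v\<bar>"
          using norm_Pair_le[of "fst (F' x v - F' p v)" "snd (F' x v - F' p v)"] by simp
        also have "\<dots> \<le> \<bar>pd1 f x - pd1 f p\<bar> * \<bar>fst v\<bar> + \<bar>pd2 f x - pd2 f p\<bar> * \<bar>snd v\<bar>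
            + (\<bar>pd1 g x - pd1 g p\<bar> * \<bar>fst v\<bar> + \<bar>pd2 g x - pd2 g p\<bar> * \<bar>snd v\<bar>)"
          unfolding abs_mult[symmetric] by (intro add_mono abs_triangle_ineq)
        also have "\<dots> \<le> \<bar>pd1 f x - pd1 f p\<bar> * norm v + \<bar>pd2 f x - pd2 f p\<bar> * norm v
            + (\<bar>pd1 g x - pd1 g p\<bar> * norm v + \<bar>pd2 g x - pd2 g p\<bar> * norm v)"
          using v by (intro add_mono mult_left_mono) auto
        finally show ?thesis by (simp add: algebra_simps)
      qed
      then have "onorm (\<lambda>v. F' x v - F' p v) \<le> ?s" by (rule onorm_le)
      also have "\<dots> < e" using d(2)[of x] that by (simp add: dist_commute)
      finally show ?thesis .
    qed
    then show "\<exists>d>0. \<forall>x. dist p x < d \<longrightarrow> onorm (\<lambda>v. F' x v - F' p v) < e" using d(1) by blast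
  qed
  define U where "U = {x \<in> ball p r. jac f g x \<noteq> 0}"
  have cj: "continuous_on (ball p r) (jac f g)"
    using smooth_on_imp_continuous_on[OF S(1) smooth_on_jac[OF S(1) sm]] r continuous_on_subset by blast
  have oU: "open U"
    unfolding U_def
    using continuous_open_preimage[OF cj open_ball open_nonzero]
    by (simp add: vimage_def Int_def)
  have US: "U \<subseteq> S" using r unfolding U_def by auto
  have injU: "inj_on F U" by (rule inj_on_subset[OF r(3)]) (auto simp: U_def)
  have smU: "smooth_on U F" using smF US smooth_on_subset by blast
  have oF: "open (F ` U)"
    by (rule invariance_of_domain[OF smooth_on_imp_continuous_on[OF oU smU] oU injU])
  let ?g = "inv_into U F"
  have gF: "?g (F x) = x" if "x \<in> U" for x using that injU by simp
  have g': "(?g has_derivative G' (?g y)) (at y)" if y: "y \<in> F ` U" for y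
  proof -
    obtain x where x: "x \<in> U" "y = F x" using y by auto
    have "(?g has_derivative G' x) (at (F x))"
      by (rule has_derivative_inverse_strong[OF oU x(1) smooth_on_imp_continuous_on[OF oU smU] gF F'])
        (use x US GF U_def in auto)
    then show ?thesis using x gF by simp
  qed
  \<comment> \<open>Bootstrapping: the derivative of \<open>?g\<close> at \<open>y\<close> is
    \<open>G' (?g y)\<close>, with \<open>G'\<close> smooth, so each order of regularity of
    \<open>?g\<close> yields the next.\<close>
  have "Ck_on k (F ` U) ?g" for k
  proof (induction k)
    case 0
    show ?case using g'
      by (auto intro!: continuous_at_imp_continuous_on has_derivative_continuous)
  next
    case (Suc k)
    show ?case
    proof (rule Ck_on_SucI[OF oF g'])
      fix w
      have sm': "smooth_on U f" "smooth_on U g" using sm US smooth_on_subset by blast+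
      have "smooth_on U (\<lambda>x. G' x w)"
        unfolding G'_def
        by (intro smooth_on_Pair smooth_on_divide smooth_on_diff smooth_on_mult smooth_on_pd smooth_on_jac
            smooth_on_const oU sm') (auto simp: U_def)
      then have G'w: "Ck_on k U (\<lambda>x. G' x w)" by (simp add: smooth_on_def)
      show "Ck_on k (F ` U) (\<lambda>y. G' (?g y) w)"
        by (rule Ck_on_compose[where g = "\<lambda>x. G' x w", OF oF oU _ Suc.IH G'w]) (auto simp: gF)
    qed
  qed
  then have "diffeo_on U F" unfolding diffeo_on_def smooth_on_def[of "F ` U"]
    using oU injU oF smU by blast
  then show ?thesis
    by (intro that[of U, folded F_def]) (use US r(1) assms(5) in \<open>auto simp: U_def\<close>)
qed

section \<open>The fold normal form\<close>

text \<open>The source chart is carried along the inverse of \<open>\<Lambda>\<close> and the target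
  chart is kept. This moves a normal form found in phase coordinates to the covectors
  themselves.\<close>

lemma equivalent_near_compose_diffeo:
  fixes E \<Lambda> F :: "real \<times> real \<Rightarrow> real \<times> real" and f :: "real \<times> real \<Rightarrow> real \<times> real"
  assumes eq: "equivalent_near F p f" and \<Lambda>: "diffeo_on W \<Lambda>" "p \<in> W"
    and EF: "\<And>x. x \<in> W \<Longrightarrow> E (\<Lambda> x) = F x"
  shows "equivalent_near E (\<Lambda> p) f"
proof -
  obtain U \<phi> V \<psi> where c: "centered_chart p U \<phi>" "centered_chart (F p) V \<psi>"
    and UV: "F ` U \<subseteq> V" "\<forall>a\<in>U. \<psi> (F a) = f (\<phi> a)"
    using eq[unfolded equivalent_near_def] by (elim exE conjE) (rule that)
  let ?i = "inv_into W \<Lambda>"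
  note dW = \<Lambda>(1)[unfolded diffeo_on_def]
  note c1 = c(1)[unfolded centered_chart_iff]
  define M where "M = \<Lambda> ` (U \<inter> W)"
  have oUW: "open (U \<inter> W)" using c1 dW unfolding diffeo_on_def by blast
  have oM: "open M"
    using diffeo_on_subset[OF \<Lambda>(1) oUW] unfolding M_def diffeo_on_def by blast
  have i\<Lambda>: "?i (\<Lambda> x) = x" if "x \<in> W" for x using that dW by simp
  have "diffeo_on M ?i"
    by (rule diffeo_on_subset[OF diffeo_on_inv_into[OF \<Lambda>(1)] oM]) (auto simp: M_def)
  then have "diffeo_on M (\<lambda>y. \<phi> (?i y))"
    by (rule diffeo_on_compose[OF _ conjunct1[OF c1]]) (auto simp: M_def i\<Lambda>)
  then have "centered_chart (\<Lambda> p) M (\<lambda>y. \<phi> (?i y))"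
    unfolding centered_chart_iff using c1 \<Lambda>(2) i\<Lambda>[OF \<Lambda>(2)] by (auto simp: M_def)
  moreover have "centered_chart (E (\<Lambda> p)) V \<psi>" using c(2) EF[OF \<Lambda>(2)] by simp
  moreover have "E ` M \<subseteq> V" using UV EF by (auto simp: M_def)
  moreover have "\<forall>a\<in>M. \<psi> (E a) = f (\<phi> (?i a))" using UV EF i\<Lambda> by (auto simp: M_def)
  ultimately show ?thesis unfolding equivalent_near_def by blast
qed

text \<open>In the coordinates \<open>c = K\<close>, \<open>d = X\<close> the hypothesis on the Jacobian says \<open>\<partial>Y/\<partial>c = c * m\<close>, hence
  \<open>Y = Y (0, d) + c\<^sup>2 * h\<close> with \<open>h (c, d)\<close> the integral of \<open>t * m (t * c, d)\<close> over \<open>t \<in> {0..1}\<close>.\<close>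

lemma fold_normal_form:
  assumes P: "open P" "p \<in> P"
    and sm: "smooth_on P X" "smooth_on P Y" "smooth_on P K" "smooth_on P e"
    and jac: "\<And>z. z \<in> P \<Longrightarrow> jac X Y z = K z * e z"
    and K: "K p = 0" "e p \<noteq> 0" "jac K X p \<noteq> 0"
  shows "equivalent_near (\<lambda>z. (X z, Y z)) p (\<lambda>(x::real, y::real). (x\<^sup>2, y))"
proof -
  obtain U0 where U0: "p \<in> U0" "U0 \<subseteq> P" "diffeo_on U0 (\<lambda>z. (K z, X z))"
    and j0: "\<And>z. z \<in> U0 \<Longrightarrow> jac K X z \<noteq> 0"
    using local_diffeo[OF P sm(3) sm(1) K(3)] by blast
  define \<Phi> where "\<Phi> = (\<lambda>z. (K z, X z))"
  define d0 where "d0 = X p"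
  note d\<Phi> = U0(3)[folded \<Phi>_def, unfolded diffeo_on_def]
  let ?i = "inv_into U0 \<Phi>"
  have i\<Phi>: "?i (\<Phi> z) = z" if "z \<in> U0" for z using that d\<Phi> by simp
  have \<Phi>i: "\<Phi> (?i y) = y" "?i y \<in> U0" if "y \<in> \<Phi> ` U0" for y
    using that by (simp_all add: f_inv_into_f inv_into_into)
  have "(0, d0) \<in> \<Phi> ` U0" using U0(1) K(1) by (force simp: \<Phi>_def d0_def)
  moreover have o\<Phi>: "open (\<Phi> ` U0)" using d\<Phi> by blast
  ultimately obtain A B where AB': "open A" "open B" "(0, d0) \<in> A \<times> B" "A \<times> B \<subseteq> \<Phi> ` U0"
    using open_prod_elim by metis
  then have AB: "0 \<in> A" "d0 \<in> B" by simp_all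
  obtain r1 where r1: "r1 > 0" "ball 0 r1 \<subseteq> A" using AB AB'(1) open_contains_ball by blast
  obtain r where r: "r > 0" "ball d0 r \<subseteq> B" using AB AB'(2) open_contains_ball by blast
  \<comment> \<open>A product of balls contains, with \<open>(c, d)\<close>, the whole segment to
    \<open>(0, d)\<close>, as the integral for \<open>h\<close> and the Taylor step require.\<close>
  define C where "C = ball (0::real) r1 \<times> ball d0 r"
  have oC: "open C" unfolding C_def by (intro open_Times open_ball)
  have C: "C \<subseteq> \<Phi> ` U0" unfolding C_def by (rule subset_trans[OF Sigma_mono AB'(4)]) (use r1 r in auto)
  have starC: "(t * c, d) \<in> C" if "(c, d) \<in> C" "0 \<le> t" "t \<le> 1" for c d t
  proof -
    have "\<bar>t * c\<bar> \<le> 1 * \<bar>c\<bar>" unfolding abs_mult using that by (intro mult_right_mono) auto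
    then show ?thesis using that unfolding C_def by auto
  qed
  have inC: "(0, d) \<in> C" if "d \<in> ball d0 r" for d using that r1 unfolding C_def by auto
  have smi: "smooth_on C (\<lambda>y. H (?i y))" if "smooth_on P H" for H :: "real \<times> real \<Rightarrow> real"
    by (rule smooth_on_compose[OF oC _ _ smooth_on_subset[OF _ C] smooth_on_subset[OF that U0(2)]])
      (use d\<Phi> C \<Phi>i in auto)
  define G where "G = (\<lambda>y. Y (?i y))"
  \<comment> \<open>\<open>m\<close> is forced by the two Jacobians: with \<open>Y\<close> expressed
    as \<open>G\<close> of \<open>(K, X)\<close>, \<open>jac X Y\<close> equals
    \<open>- pd1 G * jac K X\<close>, so the hypothesis on \<open>jac X Y\<close> turns into
    \<open>pd1 G = c * m\<close>.\<close>
  define m where "m = (\<lambda>y. - e (?i y) / jac K X (?i y))"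
  have smG: "smooth_on C G" unfolding G_def using sm by (intro smi)
  have smm: "smooth_on C m"
    unfolding m_def
  proof (intro smooth_on_divide smooth_on_minus smi smooth_on_jac oC P sm)
    show "jac K X (?i y) \<noteq> 0" if "y \<in> C" for y
      using j0[OF \<Phi>i(2)] C that by blast
  qed
  have pdG: "pd1 G y = fst y * m y" if y: "y \<in> C" for y
  proof -
    let ?z = "?i y"
    have z: "?z \<in> U0" "?z \<in> P" "\<Phi> ?z = y" using subsetD[OF C y] \<Phi>i[of y] U0(2) by blast+
    have dG: "(G has_derivative (\<lambda>h. pd1 G y * fst h + pd2 G y * snd h)) (at (\<Phi> ?z))"
      using has_derivative_pd[OF smooth_on_differentiable[OF smG y]] z by simp
    have dH: "(H has_derivative (\<lambda>h. pd1 H ?z * fst h + pd2 H ?z * snd h)) (at ?z)" if "smooth_on P H" for H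
      using has_derivative_pd[OF smooth_on_differentiable[OF that z(2)]] .
    have "((\<lambda>z. G (\<Phi> z)) has_derivative (\<lambda>h. pd1 G y * (pd1 K ?z * fst h + pd2 K ?z * snd h)
        + pd2 G y * (pd1 X ?z * fst h + pd2 X ?z * snd h))) (at ?z)"
      using has_derivative_compose[OF has_derivative_Pair[OF dH[OF sm(3)] dH[OF sm(1)], folded \<Phi>_def] dG] by simp
    then have "(Y has_derivative (\<lambda>h. pd1 G y * (pd1 K ?z * fst h + pd2 K ?z * snd h)
        + pd2 G y * (pd1 X ?z * fst h + pd2 X ?z * snd h))) (at ?z)"
      by (rule has_derivative_transform_within_open[of _ _ _ _ U0]) (use d\<Phi> z in \<open>auto simp: G_def i\<Phi>\<close>)
    then have "(Y has_derivative (\<lambda>h. (pd1 G y * pd1 K ?z + pd2 G y * pd1 X ?z) * fst h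
        + (pd1 G y * pd2 K ?z + pd2 G y * pd2 X ?z) * snd h)) (at ?z)"
      by (simp add: algebra_simps)
    note Yz = pd_eqI[OF this]
    have "jac X Y ?z = - pd1 G y * jac K X ?z"
      unfolding jac_def Yz by (simp add: algebra_simps)
    moreover have "K ?z = fst y" using z(3) unfolding \<Phi>_def by (metis fst_conv)
    ultimately show ?thesis
      using jac[OF z(2)] j0[OF z(1)] unfolding m_def by (simp add: field_simps)
  qed
  define h where "h = (\<lambda>y. integral {0..1} (\<lambda>t. t ^ 1 * m (t * fst y, snd y)))"
  have smh: "smooth_on C h"
    unfolding h_def smooth_on_def using smm[unfolded smooth_on_def] Ck_on_integral[OF oC starC] by blast
  have taylor: "G (c, d) = G (0, d) + c\<^sup>2 * h (c, d)" if cd: "(c, d) \<in> C" for c d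
  proof -
    have "((\<lambda>t. G (t * c, d)) has_vector_derivative c * (t * c * m (t * c, d))) (at t within {0..1})"
      if t: "t \<in> {0..1}" for t
    proof -
      have tc: "(t * c, d) \<in> C" using starC cd t by auto
      have "((\<lambda>t. (t * c, d)) has_derivative (\<lambda>w. (w * c, 0))) (at t)"
        by (intro derivative_intros)
      from has_derivative_compose[OF this has_derivative_pd[OF smooth_on_differentiable[OF smG tc]]]
      show ?thesis
        unfolding has_vector_derivative_def using pdG[OF tc]
        by (auto intro: has_derivative_at_withinI simp: mult_ac)
    qed
    from fundamental_theorem_of_calculus[OF _ this]
    have "((\<lambda>t. c * (t * c * m (t * c, d))) has_integral G (c, d) - G (0, d)) {0..1}" by simp
    then have "G (c, d) - G (0, d) = integral {0..1} (\<lambda>t. c * (t * c * m (t * c, d)))"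
      by (rule integral_unique[symmetric])
    also have "\<dots> = integral {0..1} (\<lambda>t. c\<^sup>2 * (t * m (t * c, d)))"
      by (simp add: power2_eq_square mult_ac)
    finally show ?thesis unfolding h_def by simp
  qed
  have h0: "h (0, d0) = m (0, d0) / 2"
  proof -
    have "((\<lambda>t. t * m (0, d0)) has_integral 1 / 2 * m (0, d0)) {0..1::real}"
      using ident_has_integral[of 0 1] by (intro has_integral_mult_left) simp
    then show ?thesis unfolding h_def by (simp add: integral_unique)
  qed
  have "?i (0, d0) = p" using i\<Phi>[OF U0(1)] K(1) by (simp add: \<Phi>_def d0_def)
  then have h0: "h (0, d0) \<noteq> 0" unfolding h0 m_def using K by simp
  \<comment> \<open>Since \<open>h\<close> is nonzero at the base point, \<open>\<sigma> * h\<close>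
    is positive nearby and has a smooth square root. The root goes into the first source coordinate
    \<open>s\<close>, the sign into the target chart.\<close>
  define \<sigma> where "\<sigma> = sgn (h (0, d0))"
  have \<sigma>: "\<sigma> * \<sigma> = 1" using h0 by (simp add: \<sigma>_def sgn_if)
  define C' where "C' = {y \<in> C. \<sigma> * h y > 0}"
  have C'C: "C' \<subseteq> C" unfolding C'_def by auto
  have "continuous_on C (\<lambda>y. \<sigma> * h y)"
    by (intro continuous_intros smooth_on_imp_continuous_on[OF oC smh])
  from continuous_open_preimage[OF this oC open_greaterThan[of 0]]
  have oC': "open C'" unfolding C'_def by (simp add: vimage_def Int_def)
  have c0: "(0, d0) \<in> C'" unfolding C'_def using h0 inC[of d0] r by (auto simp: \<sigma>_def sgn_if)
  have hne: "h y \<noteq> 0" "\<sigma> * h y = \<bar>h y\<bar>" if "y \<in> C'" for y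
    using that h0 unfolding C'_def \<sigma>_def by (auto simp: sgn_if split: if_splits)
  define s where "s = (\<lambda>y. fst y * \<bar>h y\<bar> powr (1/2))"
  have smpw: "smooth_on C' (\<lambda>y. \<bar>h y\<bar> powr (1/2))"
    using hne by (intro smooth_on_abs_powr oC' smooth_on_subset[OF smh C'C])
  have sms: "smooth_on C' s"
    unfolding s_def by (intro smooth_on_mult smooth_on_fst smpw oC')
  have smd: "smooth_on C' (\<lambda>y. snd y - d0)"
    by (intro smooth_on_diff smooth_on_snd smooth_on_const oC')
  have s2: "(s y)\<^sup>2 = (fst y)\<^sup>2 * \<bar>h y\<bar>" for y
    by (simp add: s_def power_mult_distrib powr_half_sqrt)
  have jacs: "jac s (\<lambda>y. snd y - d0) (0, d0) \<noteq> 0"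
  proof -
    let ?q = "\<lambda>y. \<bar>h y\<bar> powr (1/2)"
    have "(?q has_derivative (\<lambda>h. pd1 ?q (0, d0) * fst h + pd2 ?q (0, d0) * snd h)) (at (0, d0))"
      using has_derivative_pd[OF smooth_on_differentiable[OF smpw c0]] .
    from has_derivative_mult[OF has_derivative_fst[OF has_derivative_ident] this]
    have "(s has_derivative (\<lambda>w. ?q (0, d0) * fst w + 0 * snd w)) (at (0, d0))"
      unfolding s_def by (auto elim!: has_derivative_eq_rhs)
    note 1 = pd_eqI[OF this]
    have "((\<lambda>y. snd y - d0) has_derivative (\<lambda>w. 0 * fst w + 1 * snd w)) (at (0, d0))"
      by (auto intro!: derivative_eq_intros)
    note 2 = pd_eqI[OF this]
    show ?thesis unfolding jac_def 1 2 using h0 by simp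
  qed
  obtain U1 where U1: "(0, d0) \<in> U1" "U1 \<subseteq> C'" "diffeo_on U1 (\<lambda>y. (s y, snd y - d0))"
    by (rule local_diffeo[OF oC' c0 sms smd jacs]) (rule that)
  have oU1: "open U1" using U1 unfolding diffeo_on_def by blast
  define U where "U = U0 \<inter> \<Phi> -` U1"
  define \<phi> where "\<phi> = (\<lambda>z. (s (\<Phi> z), snd (\<Phi> z) - d0))"
  have "open U" unfolding U_def
    using d\<Phi> oU1 smooth_on_imp_continuous_on[of U0 \<Phi>] by (intro continuous_open_preimage) auto
  then have "diffeo_on U \<Phi>" using diffeo_on_subset[OF U0(3)[folded \<Phi>_def]] by (auto simp: U_def)
  from diffeo_on_compose[OF this U1(3)] have "diffeo_on U \<phi>" unfolding \<phi>_def by (auto simp: U_def)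
  moreover have \<Phi>p: "\<Phi> p = (0, d0)" by (simp add: \<Phi>_def d0_def K(1))
  moreover have pU: "p \<in> U" unfolding U_def using U0 U1 \<Phi>p by auto
  ultimately have c1: "centered_chart p U \<phi>"
    unfolding centered_chart_iff by (simp add: \<phi>_def s_def zero_prod_def)
  define V where "V = ball d0 r \<times> (UNIV :: real set)"
  define W where "W = (UNIV :: real set) \<times> ball (0::real) r"
  \<comment> \<open>A shear that straightens the fold curve, the image of \<open>K = 0\<close>, onto
    an axis. Only the first coordinate enters \<open>G (0, _)\<close>, so the second one can range
    over all reals in \<open>V\<close>.\<close>
  define \<psi> where "\<psi> = (\<lambda>y. (\<sigma> * (snd y - G (0, fst y)), fst y - d0))"
  define \<theta> where "\<theta> = (\<lambda>y. (snd y + d0, \<sigma> * fst y + G (0, snd y + d0)))"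
  have oV: "open V" "open W" unfolding V_def W_def by (intro open_Times open_ball open_UNIV)+
  have smG0: "smooth_on Q (\<lambda>y. G (0, l y))" if "open Q" "smooth_on Q l" "l ` Q \<subseteq> ball d0 r"
    for Q :: "(real \<times> real) set" and l
    by (rule smooth_on_compose[OF that(1) oC _ _ smG])
      (use that inC in \<open>auto intro!: smooth_on_Pair smooth_on_const\<close>)
  have "diffeo_on V \<psi>"
  proof (rule diffeo_onI[OF oV(1) _ oV(2), of _ \<theta>])
    show "smooth_on V \<psi>" unfolding \<psi>_def
      by (intro smooth_on_Pair smooth_on_mult smooth_on_diff smooth_on_const smooth_on_fst smooth_on_snd smG0 oV)
        (auto simp: V_def)
    show "smooth_on W \<theta>" unfolding \<theta>_def
      by (intro smooth_on_Pair smooth_on_mult smooth_on_add smooth_on_const smooth_on_fst smooth_on_snd smG0 oV)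
        (auto simp: W_def dist_real_def)
    show \<theta>\<psi>: "\<theta> (\<psi> x) = x" if "x \<in> V" for x
      unfolding \<theta>_def \<psi>_def using \<sigma> by (simp add: mult.assoc[symmetric])
    have "\<psi> (\<theta> x) = x" "\<theta> x \<in> V" if "x \<in> W" for x
      using that \<sigma> unfolding \<theta>_def \<psi>_def V_def W_def by (auto simp: mult.assoc[symmetric] dist_real_def)
    then have "W \<subseteq> \<psi> ` V" by (metis image_eqI subsetI)
    moreover have "\<psi> ` V \<subseteq> W" by (auto simp: \<psi>_def V_def W_def dist_real_def)
    ultimately show "\<psi> ` V = W" by blast
  qed
  moreover have "\<psi> (X p, Y p) = 0"
    using i\<Phi>[OF U0(1)] \<Phi>p by (simp add: \<psi>_def G_def d0_def zero_prod_def)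
  ultimately have c2: "centered_chart (X p, Y p) V \<psi>"
    unfolding centered_chart_iff using r by (simp add: V_def d0_def)
  have fin: "(X z, Y z) \<in> V \<and> \<psi> (X z, Y z) = (case \<phi> z of (x, y) \<Rightarrow> (x\<^sup>2, y))" if z: "z \<in> U" for z
  proof -
    have z0: "z \<in> U0" and zC': "\<Phi> z \<in> C'" using z U1 unfolding U_def by auto
    then have zC: "(K z, X z) \<in> C" using C'C by (auto simp: \<Phi>_def)
    have "Y z = G (K z, X z)" using i\<Phi>[OF z0] by (simp add: G_def \<Phi>_def)
    also have "\<dots> = G (0, X z) + (K z)\<^sup>2 * h (K z, X z)" using taylor[OF zC] .
    finally have "\<sigma> * (Y z - G (0, X z)) = (K z)\<^sup>2 * (\<sigma> * h (K z, X z))" by simp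
    also have "\<dots> = (s (\<Phi> z))\<^sup>2" using hne(2)[OF zC'] s2[of "\<Phi> z"] by (simp add: \<Phi>_def)
    finally show ?thesis using zC by (simp add: \<psi>_def \<phi>_def \<Phi>_def V_def C_def)
  qed
  show ?thesis
    unfolding equivalent_near_def using c1 c2 fin by blast
qed

section \<open>The oscillator equation\<close>

text \<open>For \<open>c > 1\<close> the formula persists at 0, where the difference quotient is
  bounded by \<open>\<bar>h\<bar> powr (c - 1)\<close> and tends to 0. This allows energies to be
  differentiated across zeros of x.\<close>

lemma has_real_derivative_abs_powr_gt1:
  assumes "c > 1"
  shows "((\<lambda>x. \<bar>x\<bar> powr c) has_real_derivative c * (\<bar>x\<bar> powr (c - 2) * x)) (at x)"
proof (cases "x = 0")
  case False
  have "\<bar>x\<bar> powr c * inverse x = \<bar>x\<bar> powr (c - 2) * x"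
    using False by (simp add: powr_diff field_simps power2_eq_square)
  then show ?thesis using has_real_derivative_abs_powr[OF False, of c] by simp
next
  case True
  have "((\<lambda>h::real. \<bar>h\<bar> powr (c - 1)) \<longlongrightarrow> \<bar>0\<bar> powr (c - 1)) (at 0)"
    using assms by (intro tendsto_intros) auto
  then have "((\<lambda>h::real. \<bar>h\<bar> powr (c - 1)) \<longlongrightarrow> 0) (at 0)" by simp
  moreover have "norm (\<bar>h\<bar> powr c / h) \<le> norm (\<bar>h\<bar> powr (c - 1))" for h :: real
    by (cases "h = 0") (simp_all add: powr_diff)
  ultimately have "((\<lambda>h::real. \<bar>h\<bar> powr c / h) \<longlongrightarrow> 0) (at 0)"
    by (rule Lim_null_comparison[OF always_eventually[OF allI] tendsto_norm_zero, rotated])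
  then show ?thesis using True unfolding DERIV_def by simp
qed

lemma powr_diff_le:
  fixes a b R p :: real
  assumes "p \<ge> 1" "0 \<le> a" "a \<le> b" "b \<le> R"
  shows "b powr p - a powr p \<le> p * R powr (p - 1) * (b - a)"
proof (cases "a = b")
  case False
  then have ab: "a < b" using assms by simp
  have "\<exists>l z. a < z \<and> z < b \<and> ((\<lambda>x. x powr p) has_real_derivative l) (at z) \<and> b powr p - a powr p = (b - a) * l"
  proof (rule MVT[OF ab])
    show "continuous_on {a..b} (\<lambda>x. x powr p)" using assms
      by (intro continuous_on_powr' continuous_on_id continuous_on_const) auto
    show "(\<lambda>x. x powr p) differentiable (at x)" if "a < x" "x < b" for x
      using has_real_derivative_powr[of x p] that assms by (auto simp: real_differentiable_def)
  qed
  then obtain l z where z: "a < z" "z < b" "((\<lambda>x. x powr p) has_real_derivative l) (at z)"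
    "b powr p - a powr p = (b - a) * l" by blast
  have "l = p * z powr (p - 1)"
    using z assms by (intro DERIV_unique[OF z(3)] has_real_derivative_powr) auto
  moreover have "z powr (p - 1) \<le> R powr (p - 1)" using z assms by (intro powr_mono2) auto
  ultimately have "l \<le> p * R powr (p - 1)" using assms by (simp add: mult_left_mono)
  then have "(b - a) * l \<le> (b - a) * (p * R powr (p - 1))" using ab by (intro mult_left_mono) auto
  then show ?thesis using z(4) by (simp add: mult_ac)
qed simp

text \<open>Times \<alpha>, this is the derivative of the potential
  \<open>\<bar>x\<bar> powr (2 * \<alpha>) / 2\<close>.\<close>

definition oscillator_force :: "real \<Rightarrow> real \<Rightarrow> real" where
  "oscillator_force \<alpha> x = \<bar>x\<bar> powr (2 * (\<alpha> - 1)) * x"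

lemma oscillator_force_eq: "oscillator_force \<alpha> x = sgn x * \<bar>x\<bar> powr (2 * \<alpha> - 1)"
proof (cases "x = 0")
  case False
  have e: "2 * \<alpha> - 1 = 2 * (\<alpha> - 1) + 1" by simp
  have "\<bar>x\<bar> powr (2 * \<alpha> - 1) = \<bar>x\<bar> powr (2 * (\<alpha> - 1)) * \<bar>x\<bar> powr 1"
    by (simp only: e powr_add)
  then show ?thesis using False by (simp add: oscillator_force_def sgn_if)
qed (simp add: oscillator_force_def)

lemma oscillator_force_minus: "oscillator_force \<alpha> (- x) = - oscillator_force \<alpha> x"
  by (simp add: oscillator_force_def)

text \<open>The force is an odd power of exponent at least 1. For arguments of equal sign the mean
  value theorem applies; for opposite signs each is compared with 0, and the two distances to 0 add
  up to \<open>\<bar>a - b\<bar>\<close>. The radius \<open>R\<close> enters because for \<alpha> >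
  1 the force grows faster than linearly.\<close>

lemma oscillator_force_lipschitz:
  assumes \<alpha>: "\<alpha> \<ge> 1" and "\<bar>a\<bar> \<le> R" "\<bar>b\<bar> \<le> R"
  shows "\<bar>oscillator_force \<alpha> a - oscillator_force \<alpha> b\<bar> \<le> (2 * \<alpha> - 1) * R powr (2 * \<alpha> - 2) * \<bar>a - b\<bar>"
proof -
  let ?p = "2 * \<alpha> - 1" and ?L = "(2 * \<alpha> - 1) * R powr (2 * \<alpha> - 2)"
  have *: "\<bar>x powr ?p - y powr ?p\<bar> \<le> ?L * \<bar>x - y\<bar>" if "0 \<le> x" "0 \<le> y" "x \<le> R" "y \<le> R" for x y
  proof (cases "x \<le> y")
    case True
    then show ?thesis
      using powr_diff_le[of ?p x y R] powr_mono2[of ?p x y] that \<alpha> by (simp add: abs_if)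
  next
    case False
    then show ?thesis
      using powr_diff_le[of ?p y x R] powr_mono2[of ?p y x] that \<alpha> by (simp add: abs_if)
  qed
  have "0 \<le> R" using assms by linarith
  then have L0: "\<bar>x powr ?p\<bar> \<le> ?L * \<bar>x\<bar>" if "0 \<le> x" "x \<le> R" for x
    using *[of x 0] that by simp
  have pos: "oscillator_force \<alpha> x = x powr ?p" if "x \<ge> 0" for x
    using that by (cases "x = 0") (simp_all add: oscillator_force_eq)
  have neg: "oscillator_force \<alpha> x = - ((- x) powr ?p)" if "x \<le> 0" for x
    using pos[of "- x"] that by (simp add: oscillator_force_minus)
  consider "a \<ge> 0" "b \<ge> 0" | "a \<le> 0" "b \<le> 0" | "a > 0" "b < 0" | "a < 0" "b > 0" by linarith
  then show ?thesis
  proof cases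
    case 1
    then show ?thesis using *[of a b] assms by (simp add: pos)
  next
    case 2
    then show ?thesis
      using *[of "- b" "- a"] assms by (simp add: neg)
  next
    case 3
    then show ?thesis
      using L0[of a] L0[of "- b"] assms by (simp add: pos neg algebra_simps)
  next
    case 4
    then have "\<bar>oscillator_force \<alpha> a - oscillator_force \<alpha> b\<bar> = (- a) powr ?p + b powr ?p"
      using neg[of a] pos[of b] powr_ge_zero[of "- a" ?p] powr_ge_zero[of b ?p] by linarith
    then show ?thesis
      using 4 L0[of "- a"] L0[of b] assms by (simp add: algebra_simps)
  qed
qed

text \<open>Gronwall's argument for the squared distance \<open>D\<close> of two solutions in the
  phase plane: on \<open>{0..T}\<close> both are bounded, the force is Lipschitz on their range,
  hence \<open>D' \<le> M * D\<close>, and \<open>exp (- M * t) * D t\<close> does not grow beyond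
  its initial value 0.\<close>

lemma oscillator_unique_forward:
  fixes x u X U :: "real \<Rightarrow> real"
  assumes \<alpha>: "\<alpha> \<ge> 1" and k: "k \<ge> 0" and T: "T \<ge> 0"
    and x: "\<And>t. (x has_real_derivative u t) (at t)"
    and u: "\<And>t. (u has_real_derivative - k * oscillator_force \<alpha> (x t)) (at t)"
    and X: "\<And>t. (X has_real_derivative U t) (at t)"
    and U: "\<And>t. (U has_real_derivative - k * oscillator_force \<alpha> (X t)) (at t)"
    and eq: "x 0 = X 0" "u 0 = U 0"
  shows "x T = X T \<and> u T = U T"
proof -
  have "continuous_on {0..T} x" "continuous_on {0..T} X"
    by (rule DERIV_continuous_on[OF has_field_derivative_at_within[OF x]]
        DERIV_continuous_on[OF has_field_derivative_at_within[OF X]])+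
  then have "bounded (x ` {0..T})" "bounded (X ` {0..T})"
    by (auto intro!: compact_imp_bounded compact_continuous_image)
  then obtain B1 B2 where "\<forall>t\<in>{0..T}. \<bar>x t\<bar> \<le> B1" "\<forall>t\<in>{0..T}. \<bar>X t\<bar> \<le> B2"
    unfolding bounded_iff by auto
  then obtain R where R: "\<And>t. t \<in> {0..T} \<Longrightarrow> \<bar>x t\<bar> \<le> R \<and> \<bar>X t\<bar> \<le> R"
    by (metis max.coboundedI1 max.coboundedI2)
  define L where "L = (2 * \<alpha> - 1) * R powr (2 * \<alpha> - 2)"
  define M where "M = 1 + k * L"
  define D where "D t = (x t - X t)\<^sup>2 + (u t - U t)\<^sup>2" for t
  define D' where "D' t = 2 * (x t - X t) * (u t - U t)
    + 2 * (u t - U t) * (- k * oscillator_force \<alpha> (x t) - (- k * oscillator_force \<alpha> (X t)))" for t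
  have dD: "(D has_real_derivative D' t) (at t)" for t
    unfolding D_def D'_def by (auto intro!: derivative_eq_intros x u X U simp: algebra_simps)
  have le: "D' t \<le> M * D t" if t: "t \<in> {0..T}" for t
  proof -
    let ?a = "x t - X t" and ?b = "u t - U t"
    let ?f = "oscillator_force \<alpha> (x t) - oscillator_force \<alpha> (X t)"
    have f: "\<bar>?f\<bar> \<le> L * \<bar>?a\<bar>" unfolding L_def using oscillator_force_lipschitz[OF \<alpha>] R[OF t] by blast
    have L: "L \<ge> 0" using \<alpha> by (simp add: L_def)
    have ab: "2 * \<bar>?a\<bar> * \<bar>?b\<bar> \<le> ?a\<^sup>2 + ?b\<^sup>2"
      using sum_squares_bound[of "\<bar>?a\<bar>" "\<bar>?b\<bar>"] by simp
    have "D' t = 2 * ?a * ?b - k * (2 * ?b * ?f)" unfolding D'_def by (simp add: algebra_simps)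
    also have "\<dots> \<le> 2 * \<bar>?a\<bar> * \<bar>?b\<bar> + k * (2 * \<bar>?b\<bar> * (L * \<bar>?a\<bar>))"
    proof -
      have "?a * ?b \<le> \<bar>?a\<bar> * \<bar>?b\<bar>" unfolding abs_mult[symmetric] by simp
      moreover have "- (?b * ?f) \<le> \<bar>?b\<bar> * (L * \<bar>?a\<bar>)"
      proof -
        have "- (?b * ?f) \<le> \<bar>?b\<bar> * \<bar>?f\<bar>" unfolding abs_mult[symmetric] by simp
        also have "\<dots> \<le> \<bar>?b\<bar> * (L * \<bar>?a\<bar>)" using f by (rule mult_left_mono) simp
        finally show ?thesis .
      qed
      then have "k * (- (?b * ?f)) \<le> k * (\<bar>?b\<bar> * (L * \<bar>?a\<bar>))" using k by (rule mult_left_mono)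
      ultimately show ?thesis by (simp add: algebra_simps)
    qed
    also have "\<dots> = M * (2 * \<bar>?a\<bar> * \<bar>?b\<bar>)" unfolding M_def by (simp add: algebra_simps)
    also have "\<dots> \<le> M * D t" unfolding D_def using ab k L by (intro mult_left_mono) (auto simp: M_def)
    finally show ?thesis .
  qed
  have "exp (- M * T) * D T \<le> exp (- M * 0) * D 0"
  proof (rule DERIV_nonpos_imp_nonincreasing[OF T])
    fix t assume t: "0 \<le> t" "t \<le> T"
    have "((\<lambda>t. exp (- M * t) * D t) has_real_derivative exp (- M * t) * (D' t - M * D t)) (at t)"
      by (auto intro!: derivative_eq_intros dD simp: algebra_simps)
    moreover have "exp (- M * t) * (D' t - M * D t) \<le> 0"
      using le t by (intro mult_nonneg_nonpos) auto
    ultimately show "\<exists>y. ((\<lambda>t. exp (- M * t) * D t) has_real_derivative y) (at t) \<and> y \<le> 0" by blast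
  qed
  then have "D T \<le> 0" by (simp add: D_def eq mult_le_0_iff)
  then show ?thesis unfolding D_def by (metis add_nonneg_eq_0_iff antisym eq_iff_diff_eq_0 power2_eq_iff_nonneg
      sum_power2_ge_zero sum_power2_eq_zero_iff)
qed

lemma oscillator_unique:
  fixes x u X U :: "real \<Rightarrow> real"
  assumes \<alpha>: "\<alpha> \<ge> 1" and k: "k \<ge> 0"
    and x: "\<And>t. (x has_real_derivative u t) (at t)"
    and u: "\<And>t. (u has_real_derivative - k * oscillator_force \<alpha> (x t)) (at t)"
    and X: "\<And>t. (X has_real_derivative U t) (at t)"
    and U: "\<And>t. (U has_real_derivative - k * oscillator_force \<alpha> (X t)) (at t)"
    and eq: "x 0 = X 0" "u 0 = U 0"
  shows "x t = X t \<and> u t = U t"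
proof (cases "t \<ge> 0")
  case True
  then show ?thesis by (rule oscillator_unique_forward[OF \<alpha> k _ x u X U eq])
next
  case False
  have r: "((\<lambda>t. f (- t)) has_real_derivative - d) (at t)" if "(f has_real_derivative d) (at (- t))" for f d and t :: real
    using that DERIV_mirror by blast
  have "x (- (- t)) = X (- (- t)) \<and> - u (- (- t)) = - U (- (- t))"
  proof (rule oscillator_unique_forward[OF \<alpha> k, where x = "\<lambda>t. x (- t)" and X = "\<lambda>t. X (- t)"
        and u = "\<lambda>t. - u (- t)" and U = "\<lambda>t. - U (- t)"])
    show "((\<lambda>t. - u (- t)) has_real_derivative - k * oscillator_force \<alpha> (x (- t))) (at t)"
      "((\<lambda>t. - U (- t)) has_real_derivative - k * oscillator_force \<alpha> (X (- t))) (at t)" for t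
      using DERIV_minus[OF r[OF u]] DERIV_minus[OF r[OF U]] by auto
  qed (use False eq in \<open>auto intro: r x X\<close>)
  then show ?thesis by simp
qed

section \<open>Global existence by Picard iteration\<close>

lemma antiderivative_exists:
  fixes h :: "real \<Rightarrow> real"
  assumes "continuous_on UNIV h"
  shows "\<exists>H. H 0 = 0 \<and> (\<forall>t. (H has_real_derivative h t) (at t))"
proof -
  obtain F where F: "\<And>t. (F has_vector_derivative h t) (at t)"
    using einterval_antiderivative[of "-\<infinity>" "\<infinity>" h] assms by (auto simp: continuous_on_eq_continuous_at)
  show ?thesis
    by (rule exI[of _ "\<lambda>t. F t - F 0"])
      (use F in \<open>auto intro!: derivative_eq_intros simp: has_real_derivative_iff_has_vector_derivative\<close>)
qed

definition antideriv :: "(real \<Rightarrow> real) \<Rightarrow> real \<Rightarrow> real" where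
  "antideriv h = (SOME H. H 0 = 0 \<and> (\<forall>t. (H has_real_derivative h t) (at t)))"

lemma antideriv:
  assumes "continuous_on UNIV h"
  shows "antideriv h 0 = 0" "(antideriv h has_real_derivative h t) (at t)"
  using someI_ex[OF antiderivative_exists[OF assms]] unfolding antideriv_def by blast+

text \<open>Each integration gains a factor \<open>1 / K\<close> in the weighted supremum norm,
  because the integral of \<open>B * exp (K * s)\<close> from 0 to \<open>t\<close> is at most
  \<open>B / K * exp (K * t)\<close>. This gain is the source of the contraction.\<close>

lemma antideriv_exp_bound:
  fixes H h :: "real \<Rightarrow> real"
  assumes K: "K > 0" and H: "H 0 = 0" "\<And>t. (H has_real_derivative h t) (at t)"
    and h: "\<And>t. \<bar>h t\<bar> \<le> B * exp (K * \<bar>t\<bar>)"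
  shows "\<bar>H t\<bar> \<le> B / K * exp (K * \<bar>t\<bar>)"
proof -
  have B: "B \<ge> 0" using h[of 0] by simp
  have main: "H t \<le> B / K * exp (K * t)"
    if "t \<ge> 0" "H 0 = 0" "\<And>t. (H has_real_derivative h t) (at t)" "\<And>t. \<bar>h t\<bar> \<le> B * exp (K * \<bar>t\<bar>)" for H h and t :: real
  proof -
    have "B / K * exp (K * 0) - H 0 \<le> B / K * exp (K * t) - H t"
    proof (rule DERIV_nonneg_imp_nondecreasing[OF that(1)])
      fix s assume s: "0 \<le> s" "s \<le> t"
      have "((\<lambda>t. B / K * exp (K * t) - H t) has_real_derivative B * exp (K * s) - h s) (at s)"
        using K by (auto intro!: derivative_eq_intros that(3))
      moreover have "B * exp (K * s) - h s \<ge> 0" using that(4)[of s] s by simp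
      ultimately show "\<exists>y. ((\<lambda>t. B / K * exp (K * t) - H t) has_real_derivative y) (at s) \<and> 0 \<le> y" by blast
    qed
    moreover have "0 \<le> B / K" using B K by simp
    ultimately show ?thesis using that(2) by simp
  qed
  have neg: "\<bar>H t\<bar> \<le> B / K * exp (K * t)"
    if "t \<ge> 0" "H 0 = 0" "\<And>t. (H has_real_derivative h t) (at t)" "\<And>t. \<bar>h t\<bar> \<le> B * exp (K * \<bar>t\<bar>)" for H h and t :: real
  proof -
    have "- H t \<le> B / K * exp (K * t)"
      by (rule main[OF that(1), of "\<lambda>t. - H t" "\<lambda>t. - h t"]) (use that DERIV_minus[OF that(3)] in auto)
    then show ?thesis using main[OF that] by (simp only: abs_le_iff)
  qed
  show ?thesis
  proof (cases "t \<ge> 0")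
    case True
    then show ?thesis using neg[OF True H h] by simp
  next
    case False
    have "\<bar>H (- (- t))\<bar> \<le> B / K * exp (K * (- t))"
    proof (rule neg[where H = "\<lambda>t. H (- t)" and h = "\<lambda>t. - h (- t)"])
      show "((\<lambda>t. H (- t)) has_real_derivative - h (- t)) (at t)" for t
        using H(2) DERIV_mirror by blast
      show "\<bar>- h (- t)\<bar> \<le> B * exp (K * \<bar>t\<bar>)" for t using h[of "- t"] by simp
    qed (use False H in auto)
    then show ?thesis using False by simp
  qed
qed

text \<open>The weight \<open>exp (K * \<bar>t\<bar>)\<close> turns Picard iteration on the whole line into a contraction.\<close>

lemma second_order_ode_exists:
  fixes f :: "real \<Rightarrow> real"
  assumes lip: "\<And>a b. \<bar>f a - f b\<bar> \<le> L * \<bar>a - b\<bar>" and bd: "\<And>a. \<bar>f a\<bar> \<le> M"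
  shows "\<exists>x u. x 0 = 0 \<and> u 0 = 1 \<and> (\<forall>t. (x has_real_derivative u t) (at t))
    \<and> (\<forall>t. (u has_real_derivative - f (x t)) (at t))"
proof -
  have L0: "L \<ge> 0" using lip[of 0 1] abs_ge_zero[of "f 0 - f 1"] by simp
  have M0: "M \<ge> 0" using bd[of 0] abs_ge_zero[of "f 0"] by linarith
  \<comment> \<open>Two integrations contract by \<open>L / (K * K)\<close>, which is less than 1
    for this \<open>K\<close>; moreover \<open>K \<ge> 1\<close> gives
    \<open>\<bar>t\<bar> \<le> exp (K * \<bar>t\<bar>)\<close>.\<close>
  define K where "K = L + 1"
  have K: "K > 0" "K \<ge> 1" using L0 by (simp_all add: K_def)
  have contf: "continuous_on UNIV f"
  proof (rule continuous_on_iff[THEN iffD2, rule_format])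
    fix a e :: real assume e: "e > 0"
    have "\<bar>f b - f a\<bar> < e" if "\<bar>b - a\<bar> < e / K" for b
    proof -
      have "\<bar>f b - f a\<bar> \<le> L * \<bar>b - a\<bar>" by (rule lip)
      also have "\<dots> \<le> K * \<bar>b - a\<bar>" by (intro mult_right_mono) (auto simp: K_def)
      also have "\<dots> < e" using that K by (simp add: field_simps)
      finally show ?thesis .
    qed
    then show "\<exists>d>0. \<forall>b\<in>UNIV. dist b a < d \<longrightarrow> dist (f b) (f a) < e"
      using e K by (auto simp: dist_real_def intro!: exI[of _ "e / K"])
  qed
  define x where "x g t = exp (K * \<bar>t\<bar>) * apply_bcontfun g t" for g :: "real \<Rightarrow>\<^sub>C real" and t
  have contx: "continuous_on UNIV (\<lambda>t. f (x g t))" for g :: "real \<Rightarrow>\<^sub>C real"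
    unfolding x_def by (intro continuous_on_compose2[OF contf] continuous_intros) auto
  define I1 where "I1 g = antideriv (\<lambda>t. f (x g t))" for g
  note I1 = antideriv[OF contx, folded I1_def]
  have contI1: "continuous_on UNIV (I1 g)" for g
    by (rule DERIV_continuous_on[OF I1(2)])
  define I2 where "I2 g = antideriv (I1 g)" for g
  note I2 = antideriv[OF contI1, folded I2_def]
  have contI2: "continuous_on UNIV (I2 g)" for g
    by (rule DERIV_continuous_on[OF I2(2)])
  \<comment> \<open>\<open>x t = t - I2 t\<close> is the problem with initial values 0 and 1,
    integrated twice; the factor \<open>exp (- K * \<bar>t\<bar>)\<close> undoes the weight in
    \<open>x g\<close>, so that the iteration acts on bounded functions.\<close>
  define T where "T g t = exp (- K * \<bar>t\<bar>) * (t - I2 g t)" for g t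
  have T_bc: "T g \<in> bcontfun" for g
  proof -
    have "\<bar>f (x g t)\<bar> \<le> M * exp (K * \<bar>t\<bar>)" for t
    proof -
      have "M * 1 \<le> M * exp (K * \<bar>t\<bar>)" using M0 K by (intro mult_left_mono) auto
      then show ?thesis using bd[of "x g t"] by linarith
    qed
    from antideriv_exp_bound[OF K(1) I2 antideriv_exp_bound[OF K(1) I1 this]]
    have b2: "\<bar>I2 g t\<bar> \<le> M / K / K * exp (K * \<bar>t\<bar>)" for t .
    have "\<bar>T g t\<bar> \<le> 1 + M / K / K" for t
    proof -
      have "\<bar>t\<bar> \<le> K * \<bar>t\<bar>" using K by (simp add: mult_le_cancel_right1)
      also have "\<dots> \<le> exp (K * \<bar>t\<bar>)" using exp_ge_add_one_self[of "K * \<bar>t\<bar>"] by linarith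
      finally have "\<bar>t - I2 g t\<bar> \<le> (1 + M / K / K) * exp (K * \<bar>t\<bar>)"
        using b2[of t] by (simp add: algebra_simps)
      then have "exp (- K * \<bar>t\<bar>) * \<bar>t - I2 g t\<bar> \<le> exp (- K * \<bar>t\<bar>) * ((1 + M / K / K) * exp (K * \<bar>t\<bar>))"
        by (intro mult_left_mono) auto
      also have "\<dots> = 1 + M / K / K" by (simp add: mult_exp_exp exp_minus field_simps)
      finally show ?thesis unfolding T_def by (simp add: abs_mult)
    qed
    then have "bounded (range (T g))" unfolding bounded_iff by auto
    moreover have "continuous_on UNIV (T g)"
      unfolding T_def by (intro continuous_intros contI2)
    ultimately show ?thesis by (simp add: bcontfun_def)
  qed
  have "\<exists>!g. Bcontfun (T g) = g"
  proof (rule banach_fix_type[of "L / (K * K)"])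
    show "0 \<le> L / (K * K)" using L0 K by simp
    have "K \<le> K * K" using mult_left_mono[of 1 K K] K by simp
    moreover have "L < K" by (simp add: K_def)
    ultimately have "L < K * K" by linarith
    then show "L / (K * K) < 1" using K by simp
    show "\<forall>g h. dist (Bcontfun (T g)) (Bcontfun (T h)) \<le> L / (K * K) * dist g h"
    proof (intro allI dist_bound)
      fix g h :: "real \<Rightarrow>\<^sub>C real" and t :: real
      define d where "d = dist g h"
      have "\<bar>f (x g t) - f (x h t)\<bar> \<le> (L * d) * exp (K * \<bar>t\<bar>)" for t
      proof -
        have "\<bar>f (x g t) - f (x h t)\<bar> \<le> L * \<bar>x g t - x h t\<bar>" by (rule lip)
        also have "\<bar>x g t - x h t\<bar> = exp (K * \<bar>t\<bar>) * \<bar>apply_bcontfun g t - apply_bcontfun h t\<bar>"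
          unfolding x_def by (simp add: right_diff_distrib[symmetric] abs_mult)
        also have "L * \<dots> \<le> L * (exp (K * \<bar>t\<bar>) * d)"
          using dist_bounded[of g t h] L0 by (intro mult_left_mono) (auto simp: d_def dist_real_def)
        finally show ?thesis by (simp add: mult_ac)
      qed
      from antideriv_exp_bound[OF K(1) _ DERIV_diff[OF I1(2) I1(2)] this]
      have "\<bar>I1 g t - I1 h t\<bar> \<le> L * d / K * exp (K * \<bar>t\<bar>)" for t by (simp add: I1(1))
      from antideriv_exp_bound[OF K(1) _ DERIV_diff[OF I2(2) I2(2)] this]
      have "\<bar>I2 g t - I2 h t\<bar> \<le> L * d / K / K * exp (K * \<bar>t\<bar>)" by (simp add: I2(1))
      then have "exp (- K * \<bar>t\<bar>) * \<bar>I2 g t - I2 h t\<bar> \<le> exp (- K * \<bar>t\<bar>) * (L * d / K / K * exp (K * \<bar>t\<bar>))"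
        by (intro mult_left_mono) auto
      also have "\<dots> = L / (K * K) * d" by (simp add: exp_minus field_simps)
      also have "exp (- K * \<bar>t\<bar>) * \<bar>I2 g t - I2 h t\<bar> = \<bar>T g t - T h t\<bar>"
        unfolding T_def right_diff_distrib[symmetric] abs_mult by simp
      finally show "dist (apply_bcontfun (Bcontfun (T g)) t) (apply_bcontfun (Bcontfun (T h)) t) \<le> L / (K * K) * dist g h"
        by (simp add: Bcontfun_inverse[OF T_bc] dist_real_def d_def)
    qed
  qed
  then obtain g where "Bcontfun (T g) = g" by blast
  then have g: "apply_bcontfun g = T g" by (metis Bcontfun_inverse T_bc)
  have xg: "x g t = t - I2 g t" for t
    unfolding x_def g T_def by (simp add: exp_minus field_simps)
  have "(x g has_real_derivative 1 - I1 g t) (at t)" for t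
    unfolding xg[abs_def] by (auto intro!: derivative_eq_intros I2)
  moreover have "((\<lambda>t. 1 - I1 g t) has_real_derivative - f (x g t)) (at t)" for t
    by (auto intro!: derivative_eq_intros I1)
  ultimately show ?thesis
    by (intro exI[of _ "x g"] exI[of _ "\<lambda>t. 1 - I1 g t"]) (auto simp: xg I1 I2)
qed

text \<open>The force need not be globally Lipschitz, so it is solved with its argument clamped to
  \<open>{-1..1}\<close>. The energy with the potential \<open>V\<close> of the clamped force equals
  1/2 along the solution, while \<open>V\<close> exceeds 1/2 outside that interval; the solution
  therefore stays inside, where the clamp is inactive.\<close>

lemma generalized_sine_exists:
  assumes \<alpha>: "\<alpha> \<ge> 1"
  shows "\<exists>S C. S 0 = 0 \<and> C 0 = (1::real) \<and> (\<forall>t. (S has_real_derivative C t) (at t))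
    \<and> (\<forall>t. (C has_real_derivative - \<alpha> * oscillator_force \<alpha> (S t)) (at t))"
proof -
  define cl where "cl s = max (-1) (min 1 s)" for s :: real
  define f where "f s = \<alpha> * oscillator_force \<alpha> (cl s)" for s
  have cl: "\<bar>cl s\<bar> \<le> 1" for s by (auto simp: cl_def)
  have lip: "\<bar>f a - f b\<bar> \<le> (\<alpha> * (2 * \<alpha> - 1)) * \<bar>a - b\<bar>" for a b
  proof -
    have "\<bar>f a - f b\<bar> = \<alpha> * \<bar>oscillator_force \<alpha> (cl a) - oscillator_force \<alpha> (cl b)\<bar>"
      using \<alpha> unfolding f_def right_diff_distrib[symmetric] abs_mult by simp
    also have "\<dots> \<le> \<alpha> * ((2 * \<alpha> - 1) * \<bar>cl a - cl b\<bar>)"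
      using oscillator_force_lipschitz[OF \<alpha> cl cl, of a b] \<alpha> by (intro mult_left_mono) auto
    also have "\<dots> \<le> \<alpha> * ((2 * \<alpha> - 1) * \<bar>a - b\<bar>)"
      using \<alpha> by (intro mult_left_mono) (auto simp: cl_def)
    finally show ?thesis by simp
  qed
  have bd: "\<bar>f a\<bar> \<le> \<alpha> * (2 * \<alpha> - 1)" for a
  proof -
    have "\<bar>oscillator_force \<alpha> (cl a)\<bar> \<le> (2 * \<alpha> - 1) * \<bar>cl a\<bar>"
      using oscillator_force_lipschitz[OF \<alpha>, of "cl a" 1 0] cl by (simp add: oscillator_force_def)
    also have "\<dots> \<le> (2 * \<alpha> - 1) * 1" using cl[of a] \<alpha> by (intro mult_left_mono) auto
    finally show ?thesis using \<alpha> by (simp add: f_def abs_mult)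
  qed
  obtain S C where SC: "S 0 = 0" "C 0 = 1" and S: "\<And>t. (S has_real_derivative C t) (at t)"
    and C: "\<And>t. (C has_real_derivative - f (S t)) (at t)"
    using second_order_ode_exists[OF lip bd] by auto
  have contf: "continuous_on UNIV f"
    by (rule lipschitz_on_continuous_on[of "\<alpha> * (2 * \<alpha> - 1)"])
      (use lip \<alpha> in \<open>auto simp: lipschitz_on_def dist_real_def\<close>)
  define V where "V = antideriv f"
  note V = antideriv[OF contf, folded V_def]
  have V1: "V s = \<bar>s\<bar> powr (2 * \<alpha>) / 2" if "\<bar>s\<bar> \<le> 1" for s
  proof -
    have d: "((\<lambda>s. V s - \<bar>s\<bar> powr (2 * \<alpha>) / 2) has_real_derivative 0) (at s within {-1..1})" if "s \<in> {-1..1}" for s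
    proof -
      have "cl s = s" using that by (auto simp: cl_def)
      then have "f s - 2 * \<alpha> * (\<bar>s\<bar> powr (2 * \<alpha> - 2) * s) / 2 = 0"
        by (simp add: f_def oscillator_force_def algebra_simps)
      moreover have "((\<lambda>s. V s - \<bar>s\<bar> powr (2 * \<alpha>) / 2) has_real_derivative
          f s - 2 * \<alpha> * (\<bar>s\<bar> powr (2 * \<alpha> - 2) * s) / 2) (at s)"
        using \<alpha> by (intro DERIV_diff DERIV_cdivide has_real_derivative_abs_powr_gt1 V) auto
      ultimately show ?thesis by (metis has_field_derivative_at_within)
    qed
    obtain c where c: "\<forall>s\<in>{-1..1}. V s - \<bar>s\<bar> powr (2 * \<alpha>) / 2 = c"
      using has_field_derivative_zero_constant[OF convex_real_interval(5) d] by blast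
    show ?thesis using bspec[OF c, of 0] bspec[OF c, of s] V(1) that by (simp add: abs_le_iff)
  qed
  have V2: "V s > 1 / 2" if s: "\<bar>s\<bar> > 1" for s
  proof (cases "s > 0")
    case True
    have "V 1 < V s"
    proof (rule DERIV_pos_imp_increasing[where f = V])
      show "1 < s" using s True by simp
      show "\<exists>y. (V has_real_derivative y) (at t) \<and> 0 < y" if "1 \<le> t" "t \<le> s" for t
        using V(2)[of t] that \<alpha> by (auto simp: f_def cl_def oscillator_force_def)
    qed
    then show ?thesis using V1[of 1] by simp
  next
    case False
    have "V s > V (-1)"
    proof (rule DERIV_neg_imp_decreasing[where f = V])
      show "s < -1" using s False by simp
      show "\<exists>y. (V has_real_derivative y) (at t) \<and> y < 0" if "s \<le> t" "t \<le> -1" for t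
        using V(2)[of t] that \<alpha> by (auto simp: f_def cl_def oscillator_force_def)
    qed
    then show ?thesis using V1[of "-1"] by simp
  qed
  have "(C t)\<^sup>2 / 2 + V (S t) = (C 0)\<^sup>2 / 2 + V (S 0)" for t
  proof (rule DERIV_isconst_all[rule_format, where f = "\<lambda>t. (C t)\<^sup>2 / 2 + V (S t)"])
    show "((\<lambda>t. (C t)\<^sup>2 / 2 + V (S t)) has_real_derivative 0) (at t)" for t
      by (auto intro!: derivative_eq_intros C DERIV_chain2[OF V(2) S])
  qed
  then have "\<bar>S t\<bar> \<le> 1" for t
    using V2[of "S t"] V(1) SC zero_le_power2[of "C t"] by (smt (verit) power_one field_sum_of_halves)
  then have "cl (S t) = S t" for t by (smt (verit) cl_def)
  then have "- f (S t) = - \<alpha> * oscillator_force \<alpha> (S t)" for t by (simp add: f_def)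
  then show ?thesis using SC S C by metis
qed

section \<open>The generalized sine\<close>

text \<open>For \<alpha> = 1 these are the sine and the cosine. In general \<open>(S, C)\<close>
  runs along the closed curve given by \<open>energy\<close>, which takes the place of the unit
  circle.\<close>

locale generalized_sine =
  fixes \<alpha> :: real and S C :: "real \<Rightarrow> real"
  assumes \<alpha>: "\<alpha> \<ge> 1" and S0: "S 0 = 0" and C0: "C 0 = 1"
    and S_derivative: "(S has_real_derivative C t) (at t)"
    and C_derivative: "(C has_real_derivative - \<alpha> * oscillator_force \<alpha> (S t)) (at t)"
begin

lemma energy: "(C t)\<^sup>2 + \<bar>S t\<bar> powr (2 * \<alpha>) = 1"
proof -
  have "(C t)\<^sup>2 + \<bar>S t\<bar> powr (2 * \<alpha>) = (C 0)\<^sup>2 + \<bar>S 0\<bar> powr (2 * \<alpha>)"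
  proof (rule DERIV_isconst_all[rule_format, where f = "\<lambda>t. (C t)\<^sup>2 + \<bar>S t\<bar> powr (2 * \<alpha>)"])
    fix t
    have "((\<lambda>t. \<bar>S t\<bar> powr (2 * \<alpha>)) has_real_derivative
        2 * \<alpha> * (\<bar>S t\<bar> powr (2 * \<alpha> - 2) * S t) * C t) (at t)"
      using \<alpha> by (intro DERIV_chain2[OF has_real_derivative_abs_powr_gt1 S_derivative]) auto
    from DERIV_add[OF DERIV_power[OF C_derivative, of 2] this]
    show "((\<lambda>t. (C t)\<^sup>2 + \<bar>S t\<bar> powr (2 * \<alpha>)) has_real_derivative 0) (at t)"
      by (simp add: oscillator_force_def algebra_simps)
  qed
  then show ?thesis by (simp add: S0 C0)
qed

lemma S_bound: "\<bar>S t\<bar> \<le> 1"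
proof (rule ccontr)
  assume "\<not> ?thesis"
  then have "1 powr (2 * \<alpha>) < \<bar>S t\<bar> powr (2 * \<alpha>)" using \<alpha> by (intro powr_less_mono2) auto
  then show False using energy[of t] zero_le_power2[of "C t"] by simp
qed

lemma isCont_S: "isCont S t" and isCont_C: "isCont C t"
  using S_derivative C_derivative by (blast intro: DERIV_isCont)+

lemma continuous_on_S: "continuous_on A S" and continuous_on_C: "continuous_on A C"
  by (auto intro!: continuous_at_imp_continuous_on isCont_S isCont_C)

lemma oscillation_unique:
  assumes "\<And>t. (x has_real_derivative u t) (at t)"
    and "\<And>t. (u has_real_derivative - \<alpha> * oscillator_force \<alpha> (x t)) (at t)"
    and "\<And>t. (X has_real_derivative U t) (at t)"
    and "\<And>t. (U has_real_derivative - \<alpha> * oscillator_force \<alpha> (X t)) (at t)"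
    and "x 0 = X 0" "u 0 = U 0"
  shows "x t = X t" "u t = U t"
  using oscillator_unique[OF \<alpha> _ assms, of t] \<alpha> by auto

lemma has_derivative_reflect:
  fixes f :: "real \<Rightarrow> real"
  assumes "(f has_real_derivative d) (at (a - t))"
  shows "((\<lambda>t. f (a - t)) has_real_derivative - d) (at t)"
proof -
  have "((\<lambda>t. a - t) has_real_derivative -1) (at t)" by (auto intro!: derivative_eq_intros)
  from DERIV_chain2[where g = "\<lambda>t. a - t", OF assms this] show ?thesis by simp
qed

lemma odd_S: "S (- t) = - S t" and even_C: "C (- t) = C t"
proof -
  have 1: "((\<lambda>t. - S (0 - t)) has_real_derivative C (0 - t)) (at t)" for t
    using DERIV_minus[OF has_derivative_reflect[OF S_derivative, of 0 t]] by simp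
  have 2: "((\<lambda>t. C (0 - t)) has_real_derivative - \<alpha> * oscillator_force \<alpha> (- S (0 - t))) (at t)" for t
    using has_derivative_reflect[OF C_derivative, of 0 t] by (simp add: oscillator_force_minus)
  have "- S (0 - t) = S t" "C (0 - t) = C t"
    by (rule oscillation_unique[OF 1 2 S_derivative C_derivative]; simp add: S0 C0)+
  then show "S (- t) = - S t" "C (- t) = C t" by simp_all
qed

text \<open>Without a positive zero \<open>C\<close> would stay positive and \<open>S\<close> would
  increase, so from time 1 on the force would lower \<open>C\<close> at rate at least
  \<open>m\<close>; then \<open>C\<close> could not be positive at time
  \<open>1 + C 1 / m\<close>.\<close>

lemma quarter_period_exists: "\<exists>p>0. C p = 0"
proof (rule ccontr)
  assume no: "\<not> ?thesis"
  have pos: "C t > 0" if "t \<ge> 0" for t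
  proof (rule ccontr)
    assume "\<not> C t > 0"
    then have "\<exists>s\<ge>0. s \<le> t \<and> C s = 0"
      using that C0 by (intro IVT2) (auto intro!: isCont_C)
    then show False using no C0 by (metis less_eq_real_def zero_neq_one)
  qed
  have mono: "S s \<le> S t" if "0 \<le> s" "s \<le> t" for s t
    using that pos by (intro DERIV_nonneg_imp_nondecreasing[OF that(2)]) (meson S_derivative less_imp_le order_trans)
  have "S 0 < S 1"
    by (rule DERIV_pos_imp_increasing[where f = S]) (use S_derivative pos in auto)
  then have S1: "S 1 > 0" by (simp add: S0)
  define m where "m = \<alpha> * S 1 powr (2 * \<alpha> - 1)"
  have m: "m > 0" using \<alpha> S1 by (simp add: m_def)
  have "C t + m * t \<le> C 1 + m * 1" if t: "t \<ge> 1" for t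
  proof (rule DERIV_nonpos_imp_nonincreasing[OF t])
    fix s assume s: "1 \<le> s" "s \<le> t"
    have Ss: "S s > 0" "S 1 \<le> S s" using mono[of 1 s] s S1 by auto
    have "((\<lambda>t. C t + m * t) has_real_derivative - \<alpha> * oscillator_force \<alpha> (S s) + m) (at s)"
      by (auto intro!: derivative_eq_intros C_derivative)
    moreover have "S 1 powr (2 * \<alpha> - 1) \<le> S s powr (2 * \<alpha> - 1)"
      using Ss S1 \<alpha> by (intro powr_mono2) auto
    then have "- \<alpha> * oscillator_force \<alpha> (S s) + m \<le> 0"
      using Ss \<alpha> by (simp add: oscillator_force_eq m_def)
    ultimately show "\<exists>y. ((\<lambda>t. C t + m * t) has_real_derivative y) (at s) \<and> y \<le> 0" by blast
  qed
  from this[of "1 + C 1 / m"] have "C (1 + C 1 / m) + m * (1 + C 1 / m) \<le> C 1 + m"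
    using m pos[of 1] by simp
  moreover have "m * (1 + C 1 / m) = m + C 1" using m by (simp add: distrib_left)
  ultimately have "C (1 + C 1 / m) \<le> 0" by linarith
  then show False using pos[of "1 + C 1 / m"] pos[of 1] m by simp
qed

text \<open>Some positive zero of \<open>C\<close>, not necessarily the first. Hence
  \<open>S quarter_period\<close> may be 1 or -1, and \<open>S_C_onto\<close> treats both.\<close>

definition quarter_period :: real where "quarter_period = (SOME p. p > 0 \<and> C p = 0)"

lemma quarter_period_pos: "quarter_period > 0" and C_quarter_period: "C quarter_period = 0"
  using someI_ex[of "\<lambda>p. p > 0 \<and> C p = 0"] quarter_period_exists unfolding quarter_period_def by auto

text \<open>The velocity vanishes at \<open>quarter_period\<close>, so the motions forward and
  backward from there solve the same initial value problem.\<close>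

lemma S_reflect: "S (2 * quarter_period - t) = S t" and C_reflect: "C (2 * quarter_period - t) = - C t"
proof -
  have 1: "((\<lambda>t. S (quarter_period + t)) has_real_derivative C (quarter_period + t)) (at t)" for t
    using S_derivative[of "quarter_period + t"] DERIV_shift[of S "C (quarter_period + t)" t quarter_period] by (simp add: add.commute)
  have 2: "((\<lambda>t. C (quarter_period + t)) has_real_derivative - \<alpha> * oscillator_force \<alpha> (S (quarter_period + t))) (at t)" for t
    using C_derivative[of "quarter_period + t"] DERIV_shift[of C _ t quarter_period] by (simp add: add.commute)
  have 3: "((\<lambda>t. S (quarter_period - t)) has_real_derivative - C (quarter_period - t)) (at t)" for t
    using has_derivative_reflect[OF S_derivative] .
  have 4: "((\<lambda>t. - C (quarter_period - t)) has_real_derivative - \<alpha> * oscillator_force \<alpha> (S (quarter_period - t))) (at t)" for t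
    using DERIV_minus[OF has_derivative_reflect[OF C_derivative]] by simp
  have "S (quarter_period + t) = S (quarter_period - t)" "C (quarter_period + t) = - C (quarter_period - t)" for t
    by (rule oscillation_unique[OF 1 2 3 4]; simp add: C_quarter_period)+
  from this[of "quarter_period - t"] show "S (2 * quarter_period - t) = S t" "C (2 * quarter_period - t) = - C t"
    by (simp_all add: algebra_simps)
qed

lemma S_half_period: "S (t + 2 * quarter_period) = - S t" and C_half_period: "C (t + 2 * quarter_period) = - C t"
  using S_reflect[of "- t"] C_reflect[of "- t"] by (simp_all add: odd_S even_C add.commute)

text \<open>By \<open>energy\<close> the values of \<open>S\<close> at plus and minus
  \<open>quarter_period\<close> are 1 and -1 in some order, so \<open>S\<close> attains
  \<open>a\<close> in between. The energy determines \<open>C\<close> there up to sign, and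
  reflection at \<open>quarter_period\<close> flips that sign without changing
  \<open>S\<close>.\<close>

lemma S_C_onto:
  assumes "c\<^sup>2 + \<bar>a\<bar> powr (2 * \<alpha>) = 1"
  shows "\<exists>\<phi>. S \<phi> = a \<and> C \<phi> = c"
proof -
  have "\<bar>S quarter_period\<bar> = 1"
  proof (rule ccontr)
    assume "\<not> ?thesis"
    then have "\<bar>S quarter_period\<bar> powr (2 * \<alpha>) < 1 powr (2 * \<alpha>)"
      using S_bound[of quarter_period] \<alpha> by (intro powr_less_mono2) auto
    then show False using energy[of quarter_period] C_quarter_period by simp
  qed
  moreover have "\<bar>a\<bar> \<le> 1"
  proof (rule ccontr)
    assume "\<not> ?thesis"
    then have "1 powr (2 * \<alpha>) < \<bar>a\<bar> powr (2 * \<alpha>)" using \<alpha> by (intro powr_less_mono2) auto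
    then show False using assms zero_le_power2[of c] by simp
  qed
  ultimately have "\<exists>s. S s = a"
  proof (cases "S quarter_period = 1")
    case True
    have "\<exists>s\<ge>- quarter_period. s \<le> quarter_period \<and> S s = a"
      by (rule IVT) (use True \<open>\<bar>a\<bar> \<le> 1\<close> quarter_period_pos in \<open>auto intro!: isCont_S simp: odd_S\<close>)
    then show ?thesis by blast
  next
    case False
    then have "S quarter_period = -1" using \<open>\<bar>S quarter_period\<bar> = 1\<close> by auto
    have "\<exists>s\<ge>- quarter_period. s \<le> quarter_period \<and> S s = a"
      by (rule IVT2) (use \<open>S quarter_period = -1\<close> \<open>\<bar>a\<bar> \<le> 1\<close> quarter_period_pos in \<open>auto intro!: isCont_S simp: odd_S\<close>)
    then show ?thesis by blast
  qed
  then obtain s where s: "S s = a" by blast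
  have "(C s)\<^sup>2 = c\<^sup>2" using energy[of s] assms s by simp
  then have "C s = c \<or> C s = - c" by (simp add: power2_eq_iff)
  then show ?thesis using s S_reflect[of s] C_reflect[of s] by (metis minus_minus)
qed

text \<open>The two differential equations raise the regularity of \<open>S\<close> and
  \<open>C\<close> jointly, one order at a time. Zeros of \<open>S\<close> are excluded because the
  force is a non-smooth power there for general \<alpha>.\<close>

lemma smooth_S_C: "smooth_on {t. S t \<noteq> 0} S" "smooth_on {t. S t \<noteq> 0} C"
proof -
  let ?N = "{t. S t \<noteq> 0}"
  have oN: "open ?N"
    using continuous_open_preimage[OF continuous_on_S[of UNIV] open_UNIV open_nonzero]
    by (simp add: vimage_def)
  have "Ck_on k ?N S \<and> Ck_on k ?N C" for k
  proof (induction k)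
    case 0
    then show ?case by (simp add: continuous_on_S continuous_on_C)
  next
    case (Suc k)
    have "Ck_on k ?N (\<lambda>t. \<bar>S t\<bar> powr (2 * (\<alpha> - 1)))"
      by (rule Ck_on_compose[OF oN open_nonzero _ _ Ck_on_abs_powr]) (use Suc in auto)
    then have F: "Ck_on k ?N (\<lambda>t. (- \<alpha> * oscillator_force \<alpha> (S t)) * w)" for w
      unfolding oscillator_force_def using Suc oN by (intro Ck_on_mult Ck_on_const) auto
    have "Ck_on (Suc k) ?N S"
      by (rule Ck_on_SucI[OF oN, of _ "\<lambda>t w. C t * w"])
        (use S_derivative Suc oN in \<open>auto simp: has_field_derivative_def intro!: Ck_on_mult Ck_on_const\<close>)
    moreover have "Ck_on (Suc k) ?N C"
      by (rule Ck_on_SucI[OF oN, of _ "\<lambda>t. (*) (- \<alpha> * oscillator_force \<alpha> (S t))"])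
        (use C_derivative[unfolded has_field_derivative_def] F in simp_all)
    ultimately show ?case by blast
  qed
  then show "smooth_on ?N S" "smooth_on ?N C" by (auto simp: smooth_on_def)
qed

lemma smooth_on_S_comp:
  assumes "open A" "smooth_on A l" "\<And>z. z \<in> A \<Longrightarrow> S (l z) \<noteq> 0"
  shows "smooth_on A (\<lambda>z. S (l z))" "smooth_on A (\<lambda>z. C (l z))"
proof -
  have oN: "open {t. S t \<noteq> 0}"
    using continuous_open_preimage[OF continuous_on_S[of UNIV] open_UNIV open_nonzero]
    by (simp add: vimage_def)
  show "smooth_on A (\<lambda>z. S (l z))" "smooth_on A (\<lambda>z. C (l z))"
    using assms by (auto intro!: smooth_on_compose[OF assms(1) oN _ assms(2)] smooth_S_C)
qed

end

section \<open>The exponential map in amplitude and phase\<close>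

lemma grushin_extremal_endpoint_unique:
  assumes \<alpha>: "\<alpha> \<ge> 1" and e1: "grushin_extremal \<alpha> q \<xi> u v x y"
    and e2: "grushin_extremal \<alpha> q \<xi> u' v' x' y'"
  shows "(x 1, y 1) = (x' 1, y' 1)"
proof -
  define w where "w = snd \<xi>"
  have v: "v t = w" "v' t = w" for t
    using DERIV_isconst_all[of v t 0] DERIV_isconst_all[of v' t 0] e1 e2
    by (auto simp: grushin_extremal_def w_def)
  have x: "(x has_real_derivative u t) (at t)" "(x' has_real_derivative u' t) (at t)" for t
    using e1 e2 by (auto simp: grushin_extremal_def)
  have u: "(u has_real_derivative - (\<alpha> * w\<^sup>2) * oscillator_force \<alpha> (x t)) (at t)"
    "(u' has_real_derivative - (\<alpha> * w\<^sup>2) * oscillator_force \<alpha> (x' t)) (at t)" for t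
    using e1 e2 by (auto simp: grushin_extremal_def v oscillator_force_def mult.assoc)
  have i: "x 0 = x' 0" "u 0 = u' 0" "y 0 = y' 0" using e1 e2 by (auto simp: grushin_extremal_def)
  have xx: "x t = x' t" for t
    using oscillator_unique[OF \<alpha> _ x(1) u(1) x(2) u(2) i(1,2)] \<alpha> by simp
  have "((\<lambda>t. y t - y' t) has_real_derivative 0) (at t)" for t
  proof -
    have "(y has_real_derivative w * \<bar>x' t\<bar> powr (2 * \<alpha>)) (at t)"
      "(y' has_real_derivative w * \<bar>x' t\<bar> powr (2 * \<alpha>)) (at t)"
      using e1 e2 by (auto simp: grushin_extremal_def v xx)
    from DERIV_diff[OF this] show ?thesis by simp
  qed
  then have "y 1 - y' 1 = y 0 - y' 0" by (intro DERIV_isconst_all[where f = "\<lambda>t. y t - y' t"]) blast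
  then show ?thesis using i xx by simp
qed

lemma grushin_exp_eq:
  assumes "\<alpha> \<ge> 1" "grushin_extremal \<alpha> q \<xi> u v x y"
  shows "grushin_exp \<alpha> q \<xi> = (x 1, y 1)"
  unfolding grushin_exp_def
proof (rule the_equality)
  show "\<exists>u v x' y'. grushin_extremal \<alpha> q \<xi> u v x' y' \<and> (x 1, y 1) = (x' 1, y' 1)"
    using assms(2) by blast
next
  fix p assume "\<exists>u v x y. grushin_extremal \<alpha> q \<xi> u v x y \<and> p = (x 1, y 1)"
  then obtain u' v' x' y' where e: "grushin_extremal \<alpha> q \<xi> u' v' x' y'" and p: "p = (x' 1, y' 1)"
    by (elim exE conjE)
  show "p = (x 1, y 1)" unfolding p by (rule grushin_extremal_endpoint_unique[OF assms e, symmetric])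
qed

text \<open>By the chain rule \<open>D\<close> composed with the invertible \<open>L'\<close> is
  \<open>F'\<close>, so the kernels correspond. \<open>D\<close> is given in advance and the
  component maps are differentiated only at \<open>z\<close>, so the criterion also applies where
  the final phase is a zero of \<open>S\<close>.\<close>

lemma has_derivative_2d_kernel:
  assumes p: "open P" "z \<in> P"
    and dL: "L1 differentiable (at z)" "L2 differentiable (at z)" "jac L1 L2 z \<noteq> 0"
    and dF: "X differentiable (at z)" "Y differentiable (at z)"
    and E: "\<And>z. z \<in> P \<Longrightarrow> E (L1 z, L2 z) = (X z, Y z)"
    and D: "(E has_derivative D) (at (L1 z, L2 z))"
  shows "{w. D w = 0} \<noteq> {0} \<longleftrightarrow> jac X Y z = 0"
proof -
  define L' where "L' h = (pd1 L1 z * fst h + pd2 L1 z * snd h, pd1 L2 z * fst h + pd2 L2 z * snd h)" for h :: "real \<times> real"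
  define F' where "F' h = (pd1 X z * fst h + pd2 X z * snd h, pd1 Y z * fst h + pd2 Y z * snd h)" for h :: "real \<times> real"
  have "((\<lambda>z. (L1 z, L2 z)) has_derivative L') (at z)"
    unfolding L'_def using dL by (intro has_derivative_Pair has_derivative_pd)
  from has_derivative_compose[OF this D]
  have "((\<lambda>z. (X z, Y z)) has_derivative (\<lambda>h. D (L' h))) (at z)"
    by (rule has_derivative_transform_within_open[OF _ p]) (simp add: E)
  moreover have "((\<lambda>z. (X z, Y z)) has_derivative F') (at z)"
    unfolding F'_def using dF by (intro has_derivative_Pair has_derivative_pd)
  ultimately have "(\<lambda>h. D (L' h)) = F'" by (rule has_derivative_unique)
  then have DL: "D (L' h) = F' h" for h by (rule fun_cong)
  let ?j = "jac L1 L2 z"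
  have L'_eq: "pd2 L2 z * fst (L' h) - pd2 L1 z * snd (L' h) = ?j * fst h"
    "pd1 L1 z * snd (L' h) - pd1 L2 z * fst (L' h) = ?j * snd h" for h
    by (simp_all add: L'_def jac_def algebra_simps)
  have L'_inj: "h = 0" if "L' h = 0" for h
    using L'_eq[of h] dL(3) that by (simp add: prod_eq_iff)
  have L'_surj: "\<exists>h. L' h = w" for w
  proof
    have "pd1 L1 z * (pd2 L2 z * fst w - pd2 L1 z * snd w) + pd2 L1 z * (pd1 L1 z * snd w - pd1 L2 z * fst w) = ?j * fst w"
      "pd1 L2 z * (pd2 L2 z * fst w - pd2 L1 z * snd w) + pd2 L2 z * (pd1 L1 z * snd w - pd1 L2 z * fst w) = ?j * snd w"
      by (simp_all add: jac_def algebra_simps)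
    then show "L' ((pd2 L2 z * fst w - pd2 L1 z * snd w) / ?j, (pd1 L1 z * snd w - pd1 L2 z * fst w) / ?j) = w"
      using dL(3) by (simp add: L'_def prod_eq_iff add_divide_distrib[symmetric])
  qed
  have F'_eq: "pd2 Y z * fst (F' h) - pd2 X z * snd (F' h) = jac X Y z * fst h"
    "pd1 X z * snd (F' h) - pd1 Y z * fst (F' h) = jac X Y z * snd h" for h
    by (simp_all add: F'_def jac_def algebra_simps)
  have L'0: "L' 0 = 0" and D0: "D 0 = 0"
    using linear_0[OF has_derivative_linear[OF D]] by (simp_all add: L'_def zero_prod_def)
  show ?thesis
  proof
    assume "{w. D w = 0} \<noteq> {0}"
    then obtain w where w: "D w = 0" "w \<noteq> 0" using D0 by blast
    obtain h where h: "L' h = w" using L'_surj by blast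
    have "h \<noteq> 0" using h w L'0 by auto
    moreover have "F' h = 0" using DL[of h] h w by simp
    ultimately show "jac X Y z = 0" using F'_eq[of h] by (auto simp: prod_eq_iff)
  next
    assume j: "jac X Y z = 0"
    \<comment> \<open>A nonzero row of the singular matrix, turned by a right angle, lies in the
      kernel; if both rows vanish any vector does.\<close>
    have "\<exists>h. h \<noteq> 0 \<and> F' h = 0"
    proof (cases "pd1 X z = 0 \<and> pd2 X z = 0")
      case True
      show ?thesis
      proof (cases "pd1 Y z = 0 \<and> pd2 Y z = 0")
        case True
        with \<open>pd1 X z = 0 \<and> pd2 X z = 0\<close> show ?thesis
          by (intro exI[of _ "(1, 0)"]) (simp add: F'_def zero_prod_def)
      next
        case False
        with True show ?thesis
          by (intro exI[of _ "(pd2 Y z, - pd1 Y z)"]) (auto simp: F'_def zero_prod_def)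
      qed
    next
      case False
      with j show ?thesis
        by (intro exI[of _ "(pd2 X z, - pd1 X z)"]) (auto simp: F'_def zero_prod_def jac_def algebra_simps)
    qed
    then obtain h where "h \<noteq> 0" "F' h = 0" by blast
    then have "L' h \<noteq> 0" "D (L' h) = 0" using L'_inj[of h] DL[of h] by metis+
    then show "{w. D w = 0} \<noteq> {0}" by blast
  qed
qed

text \<open>Near the point \<open>E\<close> is \<open>(X, Y)\<close> after the local inverse of
  \<open>(L1, L2)\<close>. In this way regularity and the fold form reach \<open>E\<close>, which
  has no closed formula in its own variables.\<close>

lemma differentiable_via_diffeo:
  fixes X Y :: "real \<times> real \<Rightarrow> real"
  assumes p: "open P" "z \<in> P" and sm: "smooth_on P L1" "smooth_on P L2" "smooth_on P X" "smooth_on P Y"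
    and jL: "jac L1 L2 z \<noteq> 0" and E: "\<And>z. z \<in> P \<Longrightarrow> E (L1 z, L2 z) = (X z, Y z)"
  shows "E differentiable (at (L1 z, L2 z))"
    and "equivalent_near (\<lambda>z. (X z, Y z)) z f \<Longrightarrow> equivalent_near E (L1 z, L2 z) (f :: real \<times> real \<Rightarrow> real \<times> real)"
proof -
  obtain U where U: "z \<in> U" "U \<subseteq> P" "diffeo_on U (\<lambda>z. (L1 z, L2 z))"
    by (rule local_diffeo[OF p sm(1,2) jL]) (rule that)
  define L where "L = (\<lambda>z. (L1 z, L2 z))"
  note d = U(3)[folded L_def, unfolded diffeo_on_def]
  have oL: "open (L ` U)" using d by blast
  let ?i = "inv_into U L"
  have i: "?i y \<in> U" "L (?i y) = y" if "y \<in> L ` U" for y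
    using that by (simp_all add: inv_into_into f_inv_into_f)
  have F: "smooth_on P (\<lambda>z. (X z, Y z))" using p sm by (intro smooth_on_Pair)
  have "smooth_on (L ` U) (\<lambda>y. (X (?i y), Y (?i y)))"
    by (rule smooth_on_compose[OF oL p(1) _ _ F]) (use i U d in auto)
  moreover have "(X (?i y), Y (?i y)) = E y" if "y \<in> L ` U" for y
    using E[of "?i y"] i[OF that] U(2) by (auto simp: L_def)
  ultimately have "smooth_on (L ` U) E" using smooth_on_cong[OF oL, of "\<lambda>y. (X (?i y), Y (?i y))" E] by blast
  then have "E differentiable (at (L z))"
    using smooth_on_has_derivative[of "L ` U" E "L z"] U(1) differentiableI by blast
  then show "E differentiable (at (L1 z, L2 z))" by (simp add: L_def)
  show "equivalent_near E (L1 z, L2 z) f" if "equivalent_near (\<lambda>z. (X z, Y z)) z f"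
    using equivalent_near_compose_diffeo[OF that U(3,1), of E] E U(2) by blast
qed

lemma has_derivative_separable:
  assumes "(f has_real_derivative f') (at (fst z))" "(g has_real_derivative g') (at (snd z))"
    and "(k has_real_derivative k') (at (fst z))"
  shows "((\<lambda>z. f (fst z) * g (snd z) + k (fst z)) has_derivative
    (\<lambda>h. (f' * g (snd z) + k') * fst h + f (fst z) * g' * snd h)) (at z)"
proof -
  have fst: "(fst has_derivative fst) (at z)" and snd: "(snd has_derivative snd) (at z)"
    by (auto intro: has_derivative_fst has_derivative_snd)
  have 1: "((\<lambda>z. f (fst z)) has_derivative (\<lambda>h. fst h * f')) (at z)"
    "((\<lambda>z. g (snd z)) has_derivative (\<lambda>h. snd h * g')) (at z)"
    "((\<lambda>z. k (fst z)) has_derivative (\<lambda>h. fst h * k')) (at z)"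
    by (rule DERIV_compose_FDERIV assms fst snd)+
  show ?thesis
    by (rule has_derivative_eq_rhs[OF has_derivative_add[OF has_derivative_mult[OF 1(1,2)] 1(3)]])
      (simp add: fun_eq_iff algebra_simps)
qed

text \<open>The map is \<open>f (fst z) * (g (snd z) - g (fst z)) + c\<close> multiplied out: an
  amplitude factor set by the initial phase, times an increment between the two phases, plus an
  initial value. The cases needed are \<open>g\<close> the identity and
  \<open>g = Q\<close>.\<close>

lemma has_derivative_increment:
  assumes "(f has_real_derivative f') (at (fst z))" "(g has_real_derivative g1) (at (fst z))"
    and "(g has_real_derivative g2) (at (snd z))"
  shows "((\<lambda>z. f (fst z) * g (snd z) + (c - f (fst z) * g (fst z))) has_derivative
    (\<lambda>h. (f' * (g (snd z) - g (fst z)) - f (fst z) * g1) * fst h + f (fst z) * g2 * snd h)) (at z)"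
  by (rule has_derivative_eq_rhs[OF has_derivative_separable[OF assms(1,3)
          DERIV_diff[OF DERIV_const DERIV_mult[OF assms(1,2)]]]])
    (simp add: fun_eq_iff algebra_simps)

text \<open>A zero of nonzero slope separates values of opposite sign. Both signs survive a small
  change of \<open>s\<close>, and the intermediate value theorem returns a zero between them.
  Uniqueness of that zero is not claimed.\<close>

lemma implicit_zero:
  fixes f :: "real \<Rightarrow> real \<Rightarrow> real"
  assumes c1: "\<And>t. isCont (\<lambda>s. f s t) a" and c2: "\<And>s t. isCont (f s) t"
    and "f a b = 0" and d: "(f a has_real_derivative d) (at b)" "d \<noteq> 0" and e: "e > 0"
  shows "\<exists>\<delta>>0. \<forall>s. \<bar>s - a\<bar> < \<delta> \<longrightarrow> (\<exists>t. \<bar>t - b\<bar> < e \<and> f s t = 0)"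
proof -
  have main: "\<exists>\<delta>>0. \<forall>s. \<bar>s - a\<bar> < \<delta> \<longrightarrow> (\<exists>t. \<bar>t - b\<bar> < e \<and> g s t = 0)"
    if c: "\<And>t. isCont (\<lambda>s. g s t) a" "\<And>s t. isCont (g s) t"
      and g: "g a b = 0" "(g a has_real_derivative d) (at b)" "d > 0" for g :: "real \<Rightarrow> real \<Rightarrow> real" and d
  proof -
    obtain r where r: "r > 0" "\<And>h. 0 < h \<Longrightarrow> h < r \<Longrightarrow> g a b < g a (b + h)"
      using DERIV_pos_inc_right[OF g(2,3)] by blast
    obtain l where l: "l > 0" "\<And>h. 0 < h \<Longrightarrow> h < l \<Longrightarrow> g a (b - h) < g a b"
      using DERIV_pos_inc_left[OF g(2,3)] by blast
    define h where "h = min (min r l) e / 2"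
    have h: "0 < h" "h < r" "h < l" "h < e" using r l e by (auto simp: h_def)
    have cn: "((\<lambda>s. g s t) \<longlongrightarrow> g a t) (nhds a)" for t
      using c(1)[of t] tendsto_at_iff_tendsto_nhds[of "\<lambda>s. g s t" a] by (simp add: isCont_def)
    have "\<forall>\<^sub>F s in nhds a. g s (b + h) > 0" "\<forall>\<^sub>F s in nhds a. g s (b - h) < 0"
      using r(2)[OF h(1,2)] l(2)[OF h(1,3)] g(1)
      by (auto intro: order_tendstoD(1)[OF cn] order_tendstoD(2)[OF cn])
    then have "\<forall>\<^sub>F s in nhds a. g s (b + h) > 0 \<and> g s (b - h) < 0" by (rule eventually_conj)
    then obtain \<delta> where \<delta>: "\<delta> > 0" "\<And>s. dist s a < \<delta> \<Longrightarrow> g s (b + h) > 0 \<and> g s (b - h) < 0"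
      unfolding eventually_nhds_metric by blast
    have "\<exists>t. \<bar>t - b\<bar> < e \<and> g s t = 0" if "\<bar>s - a\<bar> < \<delta>" for s
    proof -
      have "\<exists>t\<ge>b - h. t \<le> b + h \<and> g s t = 0"
        using \<delta>(2)[of s] that h c(2) by (intro IVT) (auto simp: dist_real_def)
      then obtain t where "b - h \<le> t" "t \<le> b + h" "g s t = 0" by blast
      then show ?thesis using h by (intro exI[of _ t]) auto
    qed
    then show ?thesis using \<delta>(1) by blast
  qed
  show ?thesis
  proof (cases "d > 0")
    case True
    then show ?thesis using main[OF c1 c2 assms(3) d(1)] by blast
  next
    case False
    have "\<exists>\<delta>>0. \<forall>s. \<bar>s - a\<bar> < \<delta> \<longrightarrow> (\<exists>t. \<bar>t - b\<bar> < e \<and> - f s t = 0)"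
      by (rule main[where d = "- d"])
        (use False d assms(3) c1 c2 in \<open>auto intro: DERIV_minus continuous_minus\<close>)
    then show ?thesis by simp
  qed
qed

context generalized_sine
begin

text \<open>The primitive of \<open>(1 + \<alpha>) * \<bar>S t\<bar> powr (2 * \<alpha>)\<close>
  that vanishes at 0. This closed form is what makes the y-component explicit.\<close>

definition Q :: "real \<Rightarrow> real" where "Q t = t - S t * C t"

lemma C_squared: "C t * C t = 1 - \<bar>S t\<bar> powr (2 * \<alpha>)"
  using energy[of t] by (simp add: power2_eq_square)

lemma S_force: "S t * oscillator_force \<alpha> (S t) = \<bar>S t\<bar> powr (2 * \<alpha>)"
proof (cases "S t = 0")
  case False
  have "\<bar>S t\<bar> powr (2 * \<alpha>) = \<bar>S t\<bar> powr (2 * (\<alpha> - 1) + 2)" by (simp add: algebra_simps)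
  also have "\<dots> = \<bar>S t\<bar> powr (2 * (\<alpha> - 1)) * \<bar>S t\<bar> powr 2" by (rule powr_add)
  finally show ?thesis by (simp add: oscillator_force_def power2_eq_square)
qed (simp add: oscillator_force_def)

lemma Q_derivative: "(Q has_real_derivative (1 + \<alpha>) * \<bar>S t\<bar> powr (2 * \<alpha>)) (at t)"
proof -
  have "(Q has_real_derivative 1 - (C t * C t - \<alpha> * (S t * oscillator_force \<alpha> (S t)))) (at t)"
    unfolding Q_def[abs_def] by (rule derivative_eq_intros S_derivative C_derivative refl)+ (simp add: algebra_simps)
  then show ?thesis unfolding C_squared S_force by (simp add: algebra_simps)
qed

text \<open>Inserting \<open>A * S (\<omega> * t + \<phi>)\<close> into the equation requires
  \<open>\<omega>\<^sup>2 = v\<^sup>2 * \<bar>A\<bar> powr (2 * \<alpha> - 2)\<close>, whence the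
  formula for \<open>v\<close> with a free sign \<open>\<sigma>\<close>. In y the exponents
  \<open>1 - \<alpha>\<close> of \<open>v\<close> and \<open>2 * \<alpha>\<close> of the power of x
  add up to \<open>1 + \<alpha>\<close>.\<close>

lemma extremal_amplitude_phase:
  assumes A: "A \<noteq> 0" and \<sigma>: "\<sigma> * \<sigma> = 1"
  shows "grushin_extremal \<alpha> (A * S \<phi>, y0) (A * \<omega> * C \<phi>, \<sigma> * \<omega> * \<bar>A\<bar> powr (1 - \<alpha>))
    (\<lambda>t. A * \<omega> * C (\<omega> * t + \<phi>)) (\<lambda>_. \<sigma> * \<omega> * \<bar>A\<bar> powr (1 - \<alpha>)) (\<lambda>t. A * S (\<omega> * t + \<phi>))
    (\<lambda>t. y0 + \<sigma> * \<bar>A\<bar> powr (1 + \<alpha>) / (1 + \<alpha>) * (Q (\<omega> * t + \<phi>) - Q \<phi>))"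
proof -
  let ?s = "\<lambda>t. \<omega> * t + \<phi>" and ?v = "\<sigma> * \<omega> * \<bar>A\<bar> powr (1 - \<alpha>)"
  have ds: "(?s has_real_derivative \<omega>) (at t)" for t by (auto intro!: derivative_eq_intros)
  have "(?v)\<^sup>2 = \<omega> * \<omega> * \<bar>A\<bar> powr (2 * (1 - \<alpha>))"
    using \<sigma> by (simp add: power2_eq_square powr_add[symmetric] mult_ac)
  moreover have "\<bar>A\<bar> powr (2 * (1 - \<alpha>)) * \<bar>A\<bar> powr (2 * (\<alpha> - 1)) = 1"
    using A by (simp add: powr_add[symmetric])
  ultimately have v2: "(?v)\<^sup>2 * \<bar>A\<bar> powr (2 * (\<alpha> - 1)) = \<omega> * \<omega>" by simp
  have u: "A * \<omega> * (- \<alpha> * oscillator_force \<alpha> (S (?s t)) * \<omega>)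
      = - \<alpha> * (?v)\<^sup>2 * \<bar>A * S (?s t)\<bar> powr (2 * (\<alpha> - 1)) * (A * S (?s t))" for t
  proof -
    have "- \<alpha> * (?v)\<^sup>2 * \<bar>A * S (?s t)\<bar> powr (2 * (\<alpha> - 1)) * (A * S (?s t))
        = - \<alpha> * ((?v)\<^sup>2 * \<bar>A\<bar> powr (2 * (\<alpha> - 1))) * A * oscillator_force \<alpha> (S (?s t))"
      by (simp add: abs_mult powr_mult oscillator_force_def mult_ac)
    also have "\<dots> = A * \<omega> * (- \<alpha> * oscillator_force \<alpha> (S (?s t)) * \<omega>)"
      unfolding v2 by (simp add: mult_ac)
    finally show ?thesis by (rule sym)
  qed
  have p: "\<bar>A\<bar> powr (1 + \<alpha>) = \<bar>A\<bar> powr (1 - \<alpha>) * \<bar>A\<bar> powr (2 * \<alpha>)"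
    by (simp add: powr_add[symmetric] add.commute)
  have y: "\<sigma> * \<bar>A\<bar> powr (1 + \<alpha>) / (1 + \<alpha>) * ((1 + \<alpha>) * \<bar>S (?s t)\<bar> powr (2 * \<alpha>) * \<omega>)
      = ?v * \<bar>A * S (?s t)\<bar> powr (2 * \<alpha>)" for t
    using \<alpha> by (simp add: abs_mult powr_mult p)
  have dx: "((\<lambda>t. A * S (?s t)) has_real_derivative A * \<omega> * C (?s t)) (at t)" for t
    by (rule DERIV_cong[OF DERIV_cmult[OF DERIV_chain2[OF S_derivative ds]]]) simp
  have du: "((\<lambda>t. A * \<omega> * C (?s t)) has_real_derivative
      - \<alpha> * (?v)\<^sup>2 * \<bar>A * S (?s t)\<bar> powr (2 * (\<alpha> - 1)) * (A * S (?s t))) (at t)" for t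
    by (rule DERIV_cong[OF DERIV_cmult[OF DERIV_chain2[OF C_derivative ds]] u])
  have dy: "((\<lambda>t. y0 + \<sigma> * \<bar>A\<bar> powr (1 + \<alpha>) / (1 + \<alpha>) * (Q (?s t) - Q \<phi>)) has_real_derivative
      ?v * \<bar>A * S (?s t)\<bar> powr (2 * \<alpha>)) (at t)" for t
    by (rule DERIV_cong[OF DERIV_add[OF DERIV_const DERIV_cmult[OF DERIV_diff[OF DERIV_chain2[OF Q_derivative ds] DERIV_const]]]])
      (use y in simp)
  show ?thesis
    unfolding grushin_extremal_def using dx du dy by simp
qed

lemma grushin_exp_param:
  assumes "A \<noteq> 0" "\<sigma> * \<sigma> = 1"
  shows "grushin_exp \<alpha> (A * S \<phi>, y0) (A * \<omega> * C \<phi>, \<sigma> * \<omega> * \<bar>A\<bar> powr (1 - \<alpha>))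
    = (A * S (\<omega> + \<phi>), y0 + \<sigma> * \<bar>A\<bar> powr (1 + \<alpha>) / (1 + \<alpha>) * (Q (\<omega> + \<phi>) - Q \<phi>))"
  using grushin_exp_eq[OF \<alpha> extremal_amplitude_phase[OF assms]] by simp

lemma covector_param:
  assumes v: "v \<noteq> 0" and H: "grushin_hamiltonian \<alpha> (x0, y0) (u, v) \<noteq> 0"
  obtains A \<omega> \<phi> where "A > 0" "\<omega> > 0" "x0 = A * S \<phi>" "u = A * \<omega> * C \<phi>" "v = sgn v * \<omega> * \<bar>A\<bar> powr (1 - \<alpha>)"
proof -
  define E where "E = u\<^sup>2 + v\<^sup>2 * \<bar>x0\<bar> powr (2 * \<alpha>)"
  have "E \<noteq> 0" using H by (simp add: E_def grushin_hamiltonian_def)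
  moreover have "E \<ge> 0" by (simp add: E_def)
  ultimately have E: "E > 0" by simp
  \<comment> \<open>\<open>A\<close> is the turning point of x: there u vanishes and the energy
    reads \<open>v\<^sup>2 * A powr (2 * \<alpha>) = E\<close>. The frequency is then fixed by
    \<open>A * \<omega> = sqrt E\<close>, the speed at x = 0.\<close>
  define A where "A = (sqrt E / \<bar>v\<bar>) powr (1 / \<alpha>)"
  have A: "A > 0" using E v by (simp add: A_def)
  have A\<alpha>: "A powr \<alpha> = sqrt E / \<bar>v\<bar>" using \<alpha> E v by (simp add: A_def powr_powr)
  have A2\<alpha>: "A powr (2 * \<alpha>) = E / v\<^sup>2"
  proof -
    have "A powr (2 * \<alpha>) = A powr \<alpha> * A powr \<alpha>" by (simp add: powr_add[symmetric])
    also have "\<dots> = E / v\<^sup>2" unfolding A\<alpha> using E by (simp add: power2_eq_square)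
    finally show ?thesis .
  qed
  define \<omega> where "\<omega> = sqrt E / A"
  have \<omega>: "\<omega> > 0" using A E by (simp add: \<omega>_def)
  have "(u / sqrt E)\<^sup>2 + \<bar>x0 / A\<bar> powr (2 * \<alpha>) = 1"
  proof -
    have "\<bar>x0 / A\<bar> = \<bar>x0\<bar> / A" using A by simp
    then have "\<bar>x0 / A\<bar> powr (2 * \<alpha>) = \<bar>x0\<bar> powr (2 * \<alpha>) / A powr (2 * \<alpha>)"
      using A powr_divide[of "\<bar>x0\<bar>" A "2 * \<alpha>"] by presburger
    also have "\<dots> = v\<^sup>2 * \<bar>x0\<bar> powr (2 * \<alpha>) / E" unfolding A2\<alpha> by simp
    finally show ?thesis
      using E by (simp add: power_divide add_divide_distrib[symmetric] E_def[symmetric])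
  qed
  then obtain \<phi> where \<phi>: "S \<phi> = x0 / A" "C \<phi> = u / sqrt E" using S_C_onto by blast
  show ?thesis
  proof
    show "x0 = A * S \<phi>" using \<phi> A by simp
    show "u = A * \<omega> * C \<phi>" using \<phi> A E by (simp add: \<omega>_def)
    have "A powr (1 - \<alpha>) = A / A powr \<alpha>" using A by (simp add: powr_diff)
    then have "\<omega> * A powr (1 - \<alpha>) = \<bar>v\<bar>" unfolding A\<alpha> \<omega>_def using A E by simp
    then show "v = sgn v * \<omega> * \<bar>A\<bar> powr (1 - \<alpha>)" using A by (simp add: mult.assoc mult_sgn_abs)
  qed (use A \<omega> in auto)
qed

end

section \<open>Base points off the singular line\<close>

context generalized_sine
begin

text \<open>Where both values of \<open>C\<close> are nonzero, \<open>K = 0\<close> says that the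
  function \<open>S t / C t - t\<close> agrees at the two phases.\<close>

definition K :: "real \<times> real \<Rightarrow> real" where
  "K z = S (fst z) * C (snd z) - S (snd z) * C (fst z) + (snd z - fst z) * C (fst z) * C (snd z)"

text \<open>The terms \<open>C (fst z) * C (snd z)\<close> cancel, so each partial derivative is a
  multiple of the force at its own phase. \<open>good_zero_near\<close> reads off from this which
  partial derivative is nonzero.\<close>

lemma has_derivative_K:
  "(K has_derivative (\<lambda>h.
      - \<alpha> * oscillator_force \<alpha> (S (fst z)) * ((snd z - fst z) * C (snd z) - S (snd z)) * fst h
      + - \<alpha> * oscillator_force \<alpha> (S (snd z)) * ((snd z - fst z) * C (fst z) + S (fst z)) * snd h)) (at z)"
proof -
  have fs: "(fst has_derivative fst) (at z)" "(snd has_derivative snd) (at z)"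
    by (auto intro: has_derivative_fst has_derivative_snd)
  note d = DERIV_compose_FDERIV[OF S_derivative fs(1)] DERIV_compose_FDERIV[OF S_derivative fs(2)]
    DERIV_compose_FDERIV[OF C_derivative fs(1)] DERIV_compose_FDERIV[OF C_derivative fs(2)]
  have "((\<lambda>z. S (fst z) * C (snd z) - S (snd z) * C (fst z) + (snd z - fst z) * C (fst z) * C (snd z)) has_derivative
      (\<lambda>h. - \<alpha> * oscillator_force \<alpha> (S (fst z)) * ((snd z - fst z) * C (snd z) - S (snd z)) * fst h
      + - \<alpha> * oscillator_force \<alpha> (S (snd z)) * ((snd z - fst z) * C (fst z) + S (fst z)) * snd h)) (at z)"
    by (rule has_derivative_eq_rhs[OF has_derivative_add[OF has_derivative_diff[OF has_derivative_mult[OF d(1,4)]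
              has_derivative_mult[OF d(2,3)]] has_derivative_mult[OF has_derivative_mult[OF has_derivative_diff[OF fs(2,1)] d(3)] d(4)]]])
      (simp add: fun_eq_iff algebra_simps)
  then show ?thesis unfolding K_def[abs_def] .
qed

lemmas pd_K = pd_eqI[OF has_derivative_K]

text \<open>On \<open>K = 0\<close> the degenerate case of the fold condition reads
  \<open>S \<phi> \<bar>S \<phi>\<bar>\<^sup>2\<^sup>\<alpha> / C \<phi>^3 = S \<psi> \<bar>S \<psi>\<bar>\<^sup>2\<^sup>\<alpha> / C \<psi>^3\<close>, and each side determines \<open>S / C\<close>.\<close>

lemma fold_nondegenerate:
  assumes "\<phi> \<noteq> \<psi>" "S \<phi> \<noteq> 0" "S \<psi> \<noteq> 0" "C \<phi> \<noteq> 0" "C \<psi> \<noteq> 0" and K: "K (\<phi>, \<psi>) = 0"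
  shows "pd1 K (\<phi>, \<psi>) * S \<phi> * C \<psi> + pd2 K (\<phi>, \<psi>) * S \<psi> * C \<phi> \<noteq> 0"
proof
  assume z: "pd1 K (\<phi>, \<psi>) * S \<phi> * C \<psi> + pd2 K (\<phi>, \<psi>) * S \<psi> * C \<phi> = 0"
  let ?w = "\<psi> - \<phi>"
  let ?a = "\<bar>S \<phi>\<bar> powr (2 * \<alpha>)" and ?b = "\<bar>S \<psi>\<bar> powr (2 * \<alpha>)"
  have K0: "?w * C \<phi> * C \<psi> = S \<psi> * C \<phi> - S \<phi> * C \<psi>" using K by (simp add: K_def)
  have 1: "pd1 K (\<phi>, \<psi>) * C \<phi> * S \<phi> = \<alpha> * ?a * (S \<phi> * C \<psi>)"
  proof -
    have "pd1 K (\<phi>, \<psi>) * C \<phi> * S \<phi>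
        = - \<alpha> * (S \<phi> * oscillator_force \<alpha> (S \<phi>)) * (?w * C \<phi> * C \<psi> - S \<psi> * C \<phi>)"
      by (simp add: pd_K algebra_simps)
    then show ?thesis unfolding K0 S_force by simp
  qed
  have 2: "pd2 K (\<phi>, \<psi>) * C \<psi> * S \<psi> = - \<alpha> * ?b * (S \<psi> * C \<phi>)"
  proof -
    have "pd2 K (\<phi>, \<psi>) * C \<psi> * S \<psi>
        = - \<alpha> * (S \<psi> * oscillator_force \<alpha> (S \<psi>)) * (?w * C \<phi> * C \<psi> + S \<phi> * C \<psi>)"
      by (simp add: pd_K algebra_simps)
    then show ?thesis unfolding K0 S_force by simp
  qed
  have "(pd1 K (\<phi>, \<psi>) * C \<phi> * S \<phi>) * (C \<psi> * C \<psi>) + (pd2 K (\<phi>, \<psi>) * C \<psi> * S \<psi>) * (C \<phi> * C \<phi>)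
      = (pd1 K (\<phi>, \<psi>) * S \<phi> * C \<psi> + pd2 K (\<phi>, \<psi>) * S \<psi> * C \<phi>) * (C \<phi> * C \<psi>)"
    by (simp add: algebra_simps)
  then have "\<alpha> * (?a * (S \<phi> * C \<psi>) * (C \<psi> * C \<psi>)) = \<alpha> * (?b * (S \<psi> * C \<phi>) * (C \<phi> * C \<phi>))"
    unfolding z 1 2 by (simp add: algebra_simps)
  then have eq: "?a * (S \<phi> * C \<psi>) * (C \<psi> * C \<psi>) = ?b * (S \<psi> * C \<phi>) * (C \<phi> * C \<phi>)"
    using \<alpha> by simp
  have "?a * \<bar>S \<phi>\<bar> * (\<bar>C \<psi>\<bar> * (\<bar>C \<psi>\<bar> * \<bar>C \<psi>\<bar>)) = ?b * \<bar>S \<psi>\<bar> * (\<bar>C \<phi>\<bar> * (\<bar>C \<phi>\<bar> * \<bar>C \<phi>\<bar>))"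
    using arg_cong[OF eq, of abs] by (simp only: abs_mult abs_of_nonneg[OF powr_ge_zero] mult_ac)
  then have abs_eq: "?a * \<bar>S \<phi>\<bar> * (\<bar>C \<psi>\<bar> * (C \<psi> * C \<psi>)) = ?b * \<bar>S \<psi>\<bar> * (\<bar>C \<phi>\<bar> * (C \<phi> * C \<phi>))"
    by (simp only: abs_mult_self_eq)
  \<comment> \<open>A larger \<open>\<bar>S\<bar>\<close> means a smaller
    \<open>\<bar>C\<bar>\<close> by \<open>energy\<close>, so the quotient of
    \<open>\<bar>S\<bar> powr (2 * \<alpha>) * \<bar>S\<bar>\<close> by the cube of
    \<open>\<bar>C\<bar>\<close> is strictly increasing in \<open>\<bar>S\<bar>\<close>; here it is
    cleared of denominators.\<close>
  have strict: "\<bar>S s\<bar> powr (2 * \<alpha>) * \<bar>S s\<bar> * (\<bar>C t\<bar> * (C t * C t)) < \<bar>S t\<bar> powr (2 * \<alpha>) * \<bar>S t\<bar> * (\<bar>C s\<bar> * (C s * C s))"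
    if st: "\<bar>S s\<bar> < \<bar>S t\<bar>" "C t \<noteq> 0" for s t
  proof -
    have p: "\<bar>S s\<bar> powr (2 * \<alpha>) < \<bar>S t\<bar> powr (2 * \<alpha>)" using st \<alpha> by (intro powr_less_mono2) auto
    then have "C t * C t < C s * C s" unfolding C_squared by simp
    then have le: "\<bar>C t\<bar> \<le> \<bar>C s\<bar>" using abs_le_square_iff[of "C t" "C s"] by (simp add: power2_eq_square)
    have c: "\<bar>C t\<bar> * (C t * C t) \<le> \<bar>C s\<bar> * (C s * C s)"
      by (rule mult_mono[OF le less_imp_le[OF \<open>C t * C t < C s * C s\<close>] abs_ge_zero zero_le_square])
    have "\<bar>S s\<bar> powr (2 * \<alpha>) * \<bar>S s\<bar> < \<bar>S t\<bar> powr (2 * \<alpha>) * \<bar>S t\<bar>"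
      using p st by (intro mult_strict_mono) auto
    then have "\<bar>S s\<bar> powr (2 * \<alpha>) * \<bar>S s\<bar> * (\<bar>C t\<bar> * (C t * C t)) < \<bar>S t\<bar> powr (2 * \<alpha>) * \<bar>S t\<bar> * (\<bar>C t\<bar> * (C t * C t))"
      using st(2) by (intro mult_strict_right_mono) (auto simp: zero_less_mult_iff linorder_neq_iff)
    also have "\<dots> \<le> \<bar>S t\<bar> powr (2 * \<alpha>) * \<bar>S t\<bar> * (\<bar>C s\<bar> * (C s * C s))"
      using c by (intro mult_left_mono) auto
    finally show ?thesis .
  qed
  have "\<bar>S \<phi>\<bar> = \<bar>S \<psi>\<bar>"
    using strict[of \<phi> \<psi>] strict[of \<psi> \<phi>] abs_eq assms(4,5) by (cases "\<bar>S \<phi>\<bar>" "\<bar>S \<psi>\<bar>" rule: linorder_cases) auto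
  then have ab: "?a = ?b" by simp
  then have "C \<psi> * C \<psi> = C \<phi> * C \<phi>" unfolding C_squared by simp
  moreover have "?a \<noteq> 0" using assms(2) by simp
  ultimately have "S \<phi> * C \<psi> = S \<psi> * C \<phi>" using eq assms(4) unfolding ab by simp
  then show False using K0 assms by simp
qed

lemma open_S_nonzero:
  fixes l :: "real \<times> real \<Rightarrow> real"
  assumes "continuous_on UNIV l"
  shows "open {z. S (l z) \<noteq> 0}"
  using continuous_open_preimage[OF continuous_on_compose2[OF continuous_on_S[of UNIV] assms] open_UNIV open_nonzero]
  by (simp add: vimage_def)

context
  fixes x0 y0 \<sigma> :: real
begin

text \<open>\<open>fst z\<close> and \<open>snd z\<close> are the phases at the times 0 and 1, and \<open>\<sigma>\<close> is the sign of \<open>v\<close>. The sums below,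
  including \<open>+ 0\<close>, have the shape of \<open>has_derivative_separable\<close> and \<open>has_derivative_increment\<close>.\<close>

definition "covector_u z = x0 * (C (fst z) / S (fst z)) * snd z + (0 - x0 * (C (fst z) / S (fst z)) * fst z)"
definition "covector_v z = \<sigma> * \<bar>x0 / S (fst z)\<bar> powr (1 - \<alpha>) * snd z + (0 - \<sigma> * \<bar>x0 / S (fst z)\<bar> powr (1 - \<alpha>) * fst z)"
definition "endpoint_x z = x0 / S (fst z) * S (snd z) + 0"
definition "endpoint_y z = \<sigma> * \<bar>x0 / S (fst z)\<bar> powr (1 + \<alpha>) / (1 + \<alpha>) * Q (snd z)
  + (y0 - \<sigma> * \<bar>x0 / S (fst z)\<bar> powr (1 + \<alpha>) / (1 + \<alpha>) * Q (fst z))"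
definition "jac_factor z = \<sigma> * \<bar>x0 / S (fst z)\<bar> powr (1 + \<alpha>) * x0 / (S (fst z) * S (fst z))"

context
  assumes x0: "x0 \<noteq> 0" and \<sigma>: "\<sigma> * \<sigma> = 1"
begin

lemma sign_nonzero: "\<sigma> \<noteq> 0" using \<sigma> by auto

lemma amplitude_derivative: "S t \<noteq> 0 \<Longrightarrow> ((\<lambda>t. x0 / S t) has_real_derivative - (C t / S t) * (x0 / S t)) (at t)"
  by (rule derivative_eq_intros S_derivative refl | simp)+

lemma amplitude_powr_derivative:
  assumes "S t \<noteq> 0"
  shows "((\<lambda>t. \<bar>x0 / S t\<bar> powr c) has_real_derivative - c * (C t / S t) * \<bar>x0 / S t\<bar> powr c) (at t)"
proof -
  have "x0 / S t \<noteq> 0" using assms x0 by simp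
  from DERIV_chain2[OF has_real_derivative_abs_powr[OF this, of c] amplitude_derivative[OF assms]] this
  show ?thesis by (simp add: mult_ac)
qed

lemma scaled_cot_derivative:
  assumes "S t \<noteq> 0"
  shows "((\<lambda>t. x0 * (C t / S t)) has_real_derivative - x0 * (\<alpha> * \<bar>S t\<bar> powr (2 * \<alpha>) + C t * C t) / (S t * S t)) (at t)"
proof -
  have "((\<lambda>t. x0 * (C t / S t)) has_real_derivative
      x0 * ((- \<alpha> * oscillator_force \<alpha> (S t) * S t - C t * C t) / (S t * S t))) (at t)"
    by (intro DERIV_cmult DERIV_divide S_derivative C_derivative assms)
  moreover have f: "- \<alpha> * oscillator_force \<alpha> (S t) * S t = - \<alpha> * \<bar>S t\<bar> powr (2 * \<alpha>)"
    unfolding S_force[symmetric] by simp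
  have "x0 * ((- \<alpha> * oscillator_force \<alpha> (S t) * S t - C t * C t) / (S t * S t))
      = - x0 * (\<alpha> * \<bar>S t\<bar> powr (2 * \<alpha>) + C t * C t) / (S t * S t)"
    unfolding f using assms by (simp add: field_simps)
  ultimately show ?thesis by (rule DERIV_cong)
qed

lemma offaxis_derivatives:
  assumes s: "S (fst z) \<noteq> 0"
  shows "(covector_u has_derivative (\<lambda>h.
      ((snd z - fst z) * (- x0 * (\<alpha> * \<bar>S (fst z)\<bar> powr (2 * \<alpha>) + C (fst z) * C (fst z)) / (S (fst z) * S (fst z)))
        - x0 * (C (fst z) / S (fst z))) * fst h + x0 * (C (fst z) / S (fst z)) * snd h)) (at z)"
    and "(covector_v has_derivative (\<lambda>h.
      (\<sigma> * \<bar>x0 / S (fst z)\<bar> powr (1 - \<alpha>) * (- (1 - \<alpha>) * (C (fst z) / S (fst z)) * (snd z - fst z) - 1)) * fst h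
      + \<sigma> * \<bar>x0 / S (fst z)\<bar> powr (1 - \<alpha>) * snd h)) (at z)"
    and "(endpoint_x has_derivative (\<lambda>h.
      - (C (fst z) / S (fst z)) * (x0 / S (fst z)) * S (snd z) * fst h + x0 / S (fst z) * C (snd z) * snd h)) (at z)"
    and "(endpoint_y has_derivative (\<lambda>h.
      \<sigma> * \<bar>x0 / S (fst z)\<bar> powr (1 + \<alpha>) * (- (C (fst z) / S (fst z)) * (Q (snd z) - Q (fst z)) - \<bar>S (fst z)\<bar> powr (2 * \<alpha>)) * fst h
      + \<sigma> * \<bar>x0 / S (fst z)\<bar> powr (1 + \<alpha>) * \<bar>S (snd z)\<bar> powr (2 * \<alpha>) * snd h)) (at z)"
proof -
  show "(covector_u has_derivative (\<lambda>h.
      ((snd z - fst z) * (- x0 * (\<alpha> * \<bar>S (fst z)\<bar> powr (2 * \<alpha>) + C (fst z) * C (fst z)) / (S (fst z) * S (fst z)))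
        - x0 * (C (fst z) / S (fst z))) * fst h + x0 * (C (fst z) / S (fst z)) * snd h)) (at z)"
    unfolding covector_u_def[abs_def]
    by (rule has_derivative_eq_rhs[OF has_derivative_increment[OF scaled_cot_derivative[OF s] DERIV_ident DERIV_ident]])
      (simp add: mult.commute)
  show "(covector_v has_derivative (\<lambda>h.
      (\<sigma> * \<bar>x0 / S (fst z)\<bar> powr (1 - \<alpha>) * (- (1 - \<alpha>) * (C (fst z) / S (fst z)) * (snd z - fst z) - 1)) * fst h
      + \<sigma> * \<bar>x0 / S (fst z)\<bar> powr (1 - \<alpha>) * snd h)) (at z)"
    unfolding covector_v_def[abs_def]
    by (rule has_derivative_eq_rhs[OF has_derivative_increment[OF DERIV_cmult[OF amplitude_powr_derivative[OF s]] DERIV_ident DERIV_ident]])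
      (simp add: fun_eq_iff algebra_simps)
  show "(endpoint_x has_derivative (\<lambda>h.
      - (C (fst z) / S (fst z)) * (x0 / S (fst z)) * S (snd z) * fst h + x0 / S (fst z) * C (snd z) * snd h)) (at z)"
    unfolding endpoint_x_def[abs_def]
    by (rule has_derivative_eq_rhs[OF has_derivative_separable[OF amplitude_derivative[OF s] S_derivative DERIV_const]]) simp
  have 1: "1 + \<alpha> \<noteq> 0" using \<alpha> by simp
  show "(endpoint_y has_derivative (\<lambda>h.
      \<sigma> * \<bar>x0 / S (fst z)\<bar> powr (1 + \<alpha>) * (- (C (fst z) / S (fst z)) * (Q (snd z) - Q (fst z)) - \<bar>S (fst z)\<bar> powr (2 * \<alpha>)) * fst h
      + \<sigma> * \<bar>x0 / S (fst z)\<bar> powr (1 + \<alpha>) * \<bar>S (snd z)\<bar> powr (2 * \<alpha>) * snd h)) (at z)"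
    unfolding endpoint_y_def[abs_def]
  proof (rule has_derivative_eq_rhs[OF has_derivative_increment[OF DERIV_cdivide[OF DERIV_cmult[OF amplitude_powr_derivative[OF s]]] Q_derivative Q_derivative]])
    let ?B = "\<sigma> * \<bar>x0 / S (fst z)\<bar> powr (1 + \<alpha>)" and ?c = "C (fst z) / S (fst z)"
    have 2: "\<sigma> * (- (1 + \<alpha>) * ?c * \<bar>x0 / S (fst z)\<bar> powr (1 + \<alpha>)) / (1 + \<alpha>) = - ?c * ?B"
      "?B / (1 + \<alpha>) * ((1 + \<alpha>) * p) = ?B * p" for p
    proof -
      have "s * (- k * c * P) / k = - c * (s * P)" "s / k * (k * p) = s * p" if "k \<noteq> 0" for s k c P :: real
        using that by simp_all
      from this[OF 1] show "\<sigma> * (- (1 + \<alpha>) * ?c * \<bar>x0 / S (fst z)\<bar> powr (1 + \<alpha>)) / (1 + \<alpha>) = - ?c * ?B"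
        "?B / (1 + \<alpha>) * ((1 + \<alpha>) * p) = ?B * p" by blast+
    qed
    show "(\<lambda>h. (\<sigma> * (- (1 + \<alpha>) * ?c * \<bar>x0 / S (fst z)\<bar> powr (1 + \<alpha>)) / (1 + \<alpha>) * (Q (snd z) - Q (fst z))
          - ?B / (1 + \<alpha>) * ((1 + \<alpha>) * \<bar>S (fst z)\<bar> powr (2 * \<alpha>))) * fst h
          + ?B / (1 + \<alpha>) * ((1 + \<alpha>) * \<bar>S (snd z)\<bar> powr (2 * \<alpha>)) * snd h)
        = (\<lambda>h. ?B * (- ?c * (Q (snd z) - Q (fst z)) - \<bar>S (fst z)\<bar> powr (2 * \<alpha>)) * fst h
          + ?B * \<bar>S (snd z)\<bar> powr (2 * \<alpha>) * snd h)"
    proof -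
      have "- c * B * q - B * p = B * (- c * q - p)" for c B q p :: real by (simp add: algebra_simps)
      then show ?thesis unfolding 2 by (simp only:)
    qed
  qed
qed

text \<open>\<open>energy\<close> collapses the determinant to a single product in which
  \<open>snd z - fst z\<close> is the only factor that can vanish. The phases are thus coordinates
  wherever they differ.\<close>

lemma jac_covector_nonzero:
  assumes s: "S (fst z) \<noteq> 0" and w: "snd z \<noteq> fst z"
  shows "jac covector_u covector_v z \<noteq> 0"
proof -
  let ?c = "C (fst z)" and ?s = "S (fst z)" and ?w = "snd z - fst z"
  let ?A = "\<sigma> * \<bar>x0 / ?s\<bar> powr (1 - \<alpha>)" and ?p = "\<bar>?s\<bar> powr (2 * \<alpha>)"
  have "jac covector_u covector_v z = ?A * ((?w * (- x0 * (\<alpha> * ?p + ?c * ?c) / (?s * ?s)) - x0 * (?c / ?s))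
      - x0 * (?c / ?s) * (- (1 - \<alpha>) * (?c / ?s) * ?w - 1))"
    unfolding jac_def pd_eqI[OF offaxis_derivatives(1)[OF s]] pd_eqI[OF offaxis_derivatives(2)[OF s]] by (simp only: algebra_simps)
  also have "\<dots> = ?A * (?w * (- x0 * (\<alpha> * (?p + ?c * ?c)) / (?s * ?s)))"
    using s by (simp add: field_simps)
  also have "\<dots> = - \<alpha> * ?A * ?w * x0 / (?s * ?s)" unfolding C_squared by simp
  also have "\<dots> \<noteq> 0" using s w x0 \<alpha> sign_nonzero by simp
  finally show ?thesis .
qed

text \<open>With \<open>\<bar>S t\<bar> powr (2 * \<alpha>)\<close> replaced by
  \<open>1 - C t * C t\<close> and \<open>Q\<close> by its closed form, the determinant becomes a
  polynomial in phases, \<open>S\<close> and \<open>C\<close>; this is the origin of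
  \<open>K\<close>.\<close>

lemma jac_endpoint:
  assumes s: "S (fst z) \<noteq> 0"
  shows "jac endpoint_x endpoint_y z = K z * jac_factor z"
proof -
  let ?c = "C (fst z)" and ?s = "S (fst z)" and ?d = "C (snd z)" and ?t = "S (snd z)" and ?w = "snd z - fst z"
  let ?A = "\<sigma> * \<bar>x0 / ?s\<bar> powr (1 + \<alpha>)"
  have p: "\<bar>S t\<bar> powr (2 * \<alpha>) = 1 - C t * C t" for t by (simp add: C_squared)
  have "jac endpoint_x endpoint_y z = ?A * x0 / (?s * ?s) * (- ?c * ?t * (1 - ?d * ?d) + ?d * (?c * (Q (snd z) - Q (fst z)) + ?s * (1 - ?c * ?c)))"
    unfolding jac_def pd_eqI[OF offaxis_derivatives(3)[OF s]] pd_eqI[OF offaxis_derivatives(4)[OF s]] p using s by (simp add: field_simps)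
  also have "- ?c * ?t * (1 - ?d * ?d) + ?d * (?c * (Q (snd z) - Q (fst z)) + ?s * (1 - ?c * ?c)) = K z"
    unfolding Q_def K_def by (simp add: algebra_simps)
  finally show ?thesis by (simp add: jac_factor_def mult_ac)
qed

lemma grushin_exp_offaxis:
  assumes s: "S (fst z) \<noteq> 0"
  shows "grushin_exp \<alpha> (x0, y0) (covector_u z, covector_v z) = (endpoint_x z, endpoint_y z)"
proof -
  have A: "x0 / S (fst z) \<noteq> 0" using s x0 by simp
  have "x0 / S (fst z) * (snd z - fst z) * C (fst z) = covector_u z"
    "\<sigma> * (snd z - fst z) * \<bar>x0 / S (fst z)\<bar> powr (1 - \<alpha>) = covector_v z"
    "x0 / S (fst z) * S (snd z - fst z + fst z) = endpoint_x z"
    "y0 + \<sigma> * \<bar>x0 / S (fst z)\<bar> powr (1 + \<alpha>) / (1 + \<alpha>) * (Q (snd z - fst z + fst z) - Q (fst z)) = endpoint_y z"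
    "x0 / S (fst z) * S (fst z) = x0"
    using s by (simp_all add: covector_u_def covector_v_def endpoint_x_def endpoint_y_def left_diff_distrib right_diff_distrib diff_divide_distrib mult_ac)
  with grushin_exp_param[OF A \<sigma>, of "fst z" y0 "snd z - fst z"] show ?thesis by simp
qed

text \<open>The endpoint may lie on the singular line: the formulas for the first derivatives hold
  there too, and the derivative \<open>D\<close> comes from the definition of conjugacy.\<close>

lemma offaxis_kernel_iff:
  assumes s: "S (fst z) \<noteq> 0" "snd z \<noteq> fst z"
    and D: "(grushin_exp \<alpha> (x0, y0) has_derivative D) (at (covector_u z, covector_v z))"
  shows "{w. D w = 0} \<noteq> {0} \<longleftrightarrow> K z = 0"
proof -
  have o: "open {z :: real \<times> real. S (fst z) \<noteq> 0}" by (rule open_S_nonzero[of fst]) (intro continuous_intros)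
  have d: "covector_u differentiable at z" "covector_v differentiable at z" "endpoint_x differentiable at z" "endpoint_y differentiable at z"
    using offaxis_derivatives[OF s(1)] differentiableI by blast+
  have "{w. D w = 0} \<noteq> {0} \<longleftrightarrow> jac endpoint_x endpoint_y z = 0"
    by (rule has_derivative_2d_kernel[OF o _ d(1,2) jac_covector_nonzero[OF s] d(3,4) _ D]) (use s grushin_exp_offaxis in auto)
  also have "\<dots> \<longleftrightarrow> K z = 0" using jac_endpoint[OF s(1)] s x0 sign_nonzero by (simp add: jac_factor_def)
  finally show ?thesis .
qed

lemma offaxis_regular:
  assumes s: "S (fst z) \<noteq> 0" "snd z \<noteq> fst z" "S (snd z) \<noteq> 0"
  shows "grushin_exp \<alpha> (x0, y0) differentiable (at (covector_u z, covector_v z))"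
    and "K z = 0 \<Longrightarrow> C (fst z) \<noteq> 0 \<Longrightarrow> C (snd z) \<noteq> 0 \<Longrightarrow>
      equivalent_near (grushin_exp \<alpha> (x0, y0)) (covector_u z, covector_v z) (\<lambda>(x::real, y::real). (x\<^sup>2, y))"
proof -
  define P where "P = {z :: real \<times> real. S (fst z) \<noteq> 0} \<inter> {z. S (snd z) \<noteq> 0}"
  have P: "open P" "z \<in> P" unfolding P_def using s
    by (auto intro!: open_Int open_S_nonzero[of fst] open_S_nonzero[of snd] continuous_on_fst continuous_on_snd continuous_on_id)
  note S_comp = smooth_on_S_comp[OF P(1) smooth_on_fst[OF P(1)]] smooth_on_S_comp[OF P(1) smooth_on_snd[OF P(1)]]
  have sm0: "smooth_on P (\<lambda>z. S (fst z))" "smooth_on P (\<lambda>z. C (fst z))"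
    "smooth_on P (\<lambda>z. S (snd z))" "smooth_on P (\<lambda>z. C (snd z))"
    by (intro S_comp; simp add: P_def)+
  have nz: "S (fst z) \<noteq> 0" "x0 / S (fst z) \<noteq> 0" "S (fst z) * S (fst z) \<noteq> 0" if "z \<in> P" for z
    using that x0 by (simp_all add: P_def)
  note smi = smooth_on_add smooth_on_minus smooth_on_diff smooth_on_mult smooth_on_divide smooth_on_abs_powr
    smooth_on_const smooth_on_fst smooth_on_snd sm0 P(1)
  have sm: "smooth_on P covector_u" "smooth_on P covector_v" "smooth_on P endpoint_x" "smooth_on P endpoint_y" "smooth_on P K" "smooth_on P jac_factor"
    unfolding covector_u_def[abs_def] covector_v_def[abs_def] endpoint_x_def[abs_def] endpoint_y_def[abs_def] K_def[abs_def] jac_factor_def[abs_def] Q_def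
    using \<alpha> by (intro smi nz; simp)+
  have E: "grushin_exp \<alpha> (x0, y0) (covector_u z, covector_v z) = (endpoint_x z, endpoint_y z)" if "z \<in> P" for z
    using grushin_exp_offaxis that by (simp add: P_def)
  note via = differentiable_via_diffeo[OF P sm(1-4) jac_covector_nonzero[OF s(1,2)] E]
  show "grushin_exp \<alpha> (x0, y0) differentiable (at (covector_u z, covector_v z))" by (rule via(1))
  assume K: "K z = 0" "C (fst z) \<noteq> 0" "C (snd z) \<noteq> 0"
  \<comment> \<open>\<open>jac K endpoint_x\<close> is the derivative of \<open>K\<close> along a
    vector spanning the kernel of the differential of \<open>endpoint_x\<close>, which at this zero
    of \<open>K\<close> is the kernel of the whole differential.\<close>
  have "jac K endpoint_x z = x0 / (S (fst z) * S (fst z))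
      * (pd1 K z * S (fst z) * C (snd z) + pd2 K z * S (snd z) * C (fst z))"
    unfolding jac_def pd_eqI[OF offaxis_derivatives(3)[OF s(1)]] using s by (simp add: field_simps)
  also have "\<dots> \<noteq> 0" using fold_nondegenerate[of "fst z" "snd z"] s K x0 by simp
  finally have "jac K endpoint_x z \<noteq> 0" .
  then have "equivalent_near (\<lambda>z. (endpoint_x z, endpoint_y z)) z (\<lambda>(x::real, y::real). (x\<^sup>2, y))"
    by (intro fold_normal_form[OF P sm(3-6) _ K(1)])
      (use s x0 sign_nonzero jac_endpoint in \<open>auto simp: jac_factor_def P_def\<close>)
  then show "equivalent_near (grushin_exp \<alpha> (x0, y0)) (covector_u z, covector_v z) (\<lambda>(x::real, y::real). (x\<^sup>2, y))"
    by (rule via(2)[rotated])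
qed

end

end

end

section \<open>Fold points near the exceptional zeros\<close>

lemma slice_derivatives:
  fixes f :: "real \<times> real \<Rightarrow> real"
  assumes "(f has_derivative (\<lambda>h. a * fst h + b * snd h)) (at (s, t))"
  shows "((\<lambda>s. f (s, t)) has_real_derivative a) (at s)" "((\<lambda>t. f (s, t)) has_real_derivative b) (at t)"
proof -
  have "((\<lambda>s. (s, t)) has_derivative (\<lambda>h. (h, 0))) (at s)" by (intro derivative_intros)
  from has_derivative_compose[OF this assms]
  show "((\<lambda>s. f (s, t)) has_real_derivative a) (at s)" by (simp add: has_field_derivative_def)
  have "((\<lambda>t. (s, t)) has_derivative (\<lambda>h. (0, h))) (at t)" by (intro derivative_intros)
  from has_derivative_compose[OF this assms]
  show "((\<lambda>t. f (s, t)) has_real_derivative b) (at t)" by (simp add: has_field_derivative_def)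
qed

lemma nonzero_near:
  fixes f :: "real \<Rightarrow> real"
  assumes "isCont f a" "f a \<noteq> 0"
  shows "\<exists>d>0. \<forall>t. \<bar>t - a\<bar> < d \<longrightarrow> f t \<noteq> 0"
proof -
  from continuous_at_avoid[OF assms] obtain d where "d > 0" "\<forall>t. dist a t < d \<longrightarrow> f t \<noteq> 0" by blast
  then show ?thesis by (intro exI[of _ d]) (simp add: dist_real_def abs_minus_commute)
qed

lemma nonzero_right:
  fixes f :: "real \<Rightarrow> real"
  assumes "(f has_real_derivative d) (at a)" "d \<noteq> 0" "f a = 0"
  shows "\<exists>e>0. \<forall>h. 0 < h \<and> h < e \<longrightarrow> f (a + h) \<noteq> 0"
proof (cases "d > 0")
  case True
  then show ?thesis using DERIV_pos_inc_right[OF assms(1)] assms(3) by force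
next
  case False
  then show ?thesis using DERIV_neg_dec_right[OF assms(1)] assms(2,3) by force
qed

context generalized_sine
begin

lemma force_nonzero: "S t \<noteq> 0 \<Longrightarrow> oscillator_force \<alpha> (S t) \<noteq> 0"
  using S_force[of t] by auto

lemma S_C_not_both_zero: "S t \<noteq> 0 \<or> C t \<noteq> 0"
  using energy[of t] by auto

text \<open>If \<open>C \<phi> = 0\<close>, then \<open>K = 0\<close> forces
  \<open>C \<psi> = 0\<close>, so \<open>K\<close> has nonzero slope in \<open>\<psi>\<close>:
  \<open>\<phi>\<close> is moved off the zero of \<open>C\<close> and \<open>\<psi>\<close> follows
  along the zero set. If \<open>C \<phi> \<noteq> 0\<close> and \<open>S \<psi> = 0\<close>, the
  slope in \<open>\<phi>\<close> is nonzero and the roles are exchanged.\<close>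

lemma good_zero_near:
  assumes s: "S \<phi> \<noteq> 0" "\<psi> \<noteq> \<phi>" and K0: "K (\<phi>, \<psi>) = 0" and r: "r > 0"
  shows "\<exists>\<phi>' \<psi>'. \<bar>\<phi>' - \<phi>\<bar> < r \<and> \<bar>\<psi>' - \<psi>\<bar> < r \<and> S \<phi>' \<noteq> 0 \<and> \<psi>' \<noteq> \<phi>' \<and> S \<psi>' \<noteq> 0 \<and> C \<phi>' \<noteq> 0 \<and> K (\<phi>', \<psi>') = 0"
proof -
  obtain d1 where d1: "d1 > 0" "\<And>t. \<bar>t - \<phi>\<bar> < d1 \<Longrightarrow> S t \<noteq> 0"
    using nonzero_near[OF isCont_S s(1)] by blast
  \<comment> \<open>Half the distance of the phases keeps the perturbed phases distinct.\<close>
  define r0 where "r0 = min (min r d1) (\<bar>\<psi> - \<phi>\<bar> / 2)"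
  have r0: "r0 > 0" "r0 \<le> r" "r0 \<le> d1" using r d1 s by (auto simp: r0_def)
  have ne: "t \<noteq> s'" if "\<bar>s' - \<phi>\<bar> < r0" "\<bar>t - \<psi>\<bar> < r0" for s' t
    using that unfolding r0_def by (auto simp: abs_if split: if_splits)
  have cK: "isCont (\<lambda>s. K (s, t)) a" "isCont (\<lambda>s. K (t, s)) a" for t a
    using slice_derivatives[OF has_derivative_K] DERIV_isCont by blast+
  have dK1: "((\<lambda>s. K (s, \<psi>)) has_real_derivative - \<alpha> * oscillator_force \<alpha> (S \<phi>) * ((\<psi> - \<phi>) * C \<psi> - S \<psi>)) (at \<phi>)"
    and dK2: "((\<lambda>t. K (\<phi>, t)) has_real_derivative - \<alpha> * oscillator_force \<alpha> (S \<psi>) * ((\<psi> - \<phi>) * C \<phi> + S \<phi>)) (at \<psi>)"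
    using slice_derivatives[OF has_derivative_K[of "(\<phi>, \<psi>)"]] by simp_all
  consider "S \<psi> \<noteq> 0" "C \<phi> \<noteq> 0" | "C \<phi> = 0" | "C \<phi> \<noteq> 0" "S \<psi> = 0" by blast
  then show ?thesis
  proof cases
    case 1
    then show ?thesis using s K0 r by (intro exI[of _ \<phi>] exI[of _ \<psi>]) simp
  next
    case 2
    then have "C \<psi> = 0" using K0 s by (simp add: K_def)
    then have S\<psi>: "S \<psi> \<noteq> 0" using S_C_not_both_zero by blast
    obtain d2 where d2: "d2 > 0" "\<And>t. \<bar>t - \<psi>\<bar> < d2 \<Longrightarrow> S t \<noteq> 0"
      using nonzero_near[OF isCont_S S\<psi>] by blast
    have "- \<alpha> * oscillator_force \<alpha> (S \<psi>) * ((\<psi> - \<phi>) * C \<phi> + S \<phi>) \<noteq> 0"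
      using 2 \<alpha> s force_nonzero[OF S\<psi>] by simp
    from implicit_zero[where f = "\<lambda>s t. K (s, t)", OF cK K0 dK2 this, of "min r0 d2"] r0 d2
    obtain \<delta> where \<delta>: "\<delta> > 0" "\<And>s. \<bar>s - \<phi>\<bar> < \<delta> \<Longrightarrow> \<exists>t. \<bar>t - \<psi>\<bar> < min r0 d2 \<and> K (s, t) = 0" by auto
    obtain \<epsilon> where \<epsilon>: "\<epsilon> > 0" "\<And>h. 0 < h \<Longrightarrow> h < \<epsilon> \<Longrightarrow> C (\<phi> + h) \<noteq> 0"
      using nonzero_right[OF C_derivative _ 2] force_nonzero[OF s(1)] \<alpha> by auto
    define h where "h = min (min \<delta> \<epsilon>) r0 / 2"
    have h: "0 < h" "h < \<delta>" "h < \<epsilon>" "h < r0" using \<delta> \<epsilon> r0 by (auto simp: h_def)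
    obtain t where t: "\<bar>t - \<psi>\<bar> < min r0 d2" "K (\<phi> + h, t) = 0" using \<delta>(2)[of "\<phi> + h"] h by auto
    then show ?thesis
      using h r0 \<epsilon>(2)[of h] d2(2)[of t] d1(2)[of "\<phi> + h"] ne[of "\<phi> + h" t]
      by (intro exI[of _ "\<phi> + h"] exI[of _ t]) auto
  next
    case 3
    then have C\<psi>: "C \<psi> \<noteq> 0" using S_C_not_both_zero by blast
    obtain d2 where d2: "d2 > 0" "\<And>t. \<bar>t - \<phi>\<bar> < d2 \<Longrightarrow> C t \<noteq> 0"
      using nonzero_near[OF isCont_C 3(1)] by blast
    have "- \<alpha> * oscillator_force \<alpha> (S \<phi>) * ((\<psi> - \<phi>) * C \<psi> - S \<psi>) \<noteq> 0"
      using 3 \<alpha> s C\<psi> force_nonzero[OF s(1)] by simp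
    from implicit_zero[where f = "\<lambda>s t. K (t, s)", OF cK(2,1) K0 dK1 this, of "min r0 d2"] r0 d2
    obtain \<delta> where \<delta>: "\<delta> > 0" "\<And>s. \<bar>s - \<psi>\<bar> < \<delta> \<Longrightarrow> \<exists>t. \<bar>t - \<phi>\<bar> < min r0 d2 \<and> K (t, s) = 0" by auto
    obtain \<epsilon> where \<epsilon>: "\<epsilon> > 0" "\<And>h. 0 < h \<Longrightarrow> h < \<epsilon> \<Longrightarrow> S (\<psi> + h) \<noteq> 0"
      using nonzero_right[OF S_derivative C\<psi> 3(2)] by auto
    define h where "h = min (min \<delta> \<epsilon>) r0 / 2"
    have h: "0 < h" "h < \<delta>" "h < \<epsilon>" "h < r0" using \<delta> \<epsilon> r0 by (auto simp: h_def)
    obtain t where t: "\<bar>t - \<phi>\<bar> < min r0 d2" "K (t, \<psi> + h) = 0" using \<delta>(2)[of "\<psi> + h"] h by auto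
    then show ?thesis
      using h r0 \<epsilon>(2)[of h] d2(2)[of t] d1(2)[of t] ne[of t "\<psi> + h"]
      by (intro exI[of _ t] exI[of _ "\<psi> + h"]) auto
  qed
qed

section \<open>Base points on the singular line\<close>

context
  fixes y0 \<sigma> :: real
begin

text \<open>Here \<open>fst z\<close> is the amplitude, which may be negative, and \<open>snd z\<close> is the frequency; the phase at time 0 is 0.\<close>

definition "axis_u z = fst z * snd z + (0::real)"
definition "axis_v z = \<sigma> * \<bar>fst z\<bar> powr (1 - \<alpha>) * snd z + 0"
definition "axis_x z = fst z * S (snd z) + 0"
definition "axis_y z = \<sigma> * \<bar>fst z\<bar> powr (1 + \<alpha>) / (1 + \<alpha>) * Q (snd z) + y0"
text \<open>Minus \<open>K\<close> at the phases 0 and \<open>snd z\<close>, since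
  \<open>S 0 = 0\<close> and \<open>C 0 = 1\<close>.\<close>

definition "axis_K z = 1 * (S (snd z) - snd z * C (snd z)) + (0::real)" for z :: "real \<times> real"
definition "axis_factor z = \<sigma> * \<bar>fst z\<bar> powr (1 + \<alpha>)" for z :: "real \<times> real"

context
  assumes \<sigma>: "\<sigma> * \<sigma> = 1"
begin

lemma axis_derivatives:
  assumes a: "fst z \<noteq> 0"
  shows "(axis_u has_derivative (\<lambda>h. snd z * fst h + fst z * snd h)) (at z)"
    and "(axis_v has_derivative (\<lambda>h. (1 - \<alpha>) * (\<sigma> * \<bar>fst z\<bar> powr (1 - \<alpha>)) / fst z * snd z * fst h
      + \<sigma> * \<bar>fst z\<bar> powr (1 - \<alpha>) * snd h)) (at z)"
    and "(axis_x has_derivative (\<lambda>h. S (snd z) * fst h + fst z * C (snd z) * snd h)) (at z)"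
    and "(axis_y has_derivative (\<lambda>h. \<sigma> * \<bar>fst z\<bar> powr (1 + \<alpha>) / fst z * Q (snd z) * fst h
      + \<sigma> * \<bar>fst z\<bar> powr (1 + \<alpha>) * \<bar>S (snd z)\<bar> powr (2 * \<alpha>) * snd h)) (at z)"
    and "(axis_K has_derivative (\<lambda>h. 0 * fst h + \<alpha> * snd z * oscillator_force \<alpha> (S (snd z)) * snd h)) (at z)"
proof -
  note p = has_real_derivative_abs_powr[OF a]
  show "(axis_u has_derivative (\<lambda>h. snd z * fst h + fst z * snd h)) (at z)"
    unfolding axis_u_def[abs_def]
    by (rule has_derivative_eq_rhs[OF has_derivative_separable[OF DERIV_ident DERIV_ident DERIV_const]]) simp
  show "(axis_v has_derivative (\<lambda>h. (1 - \<alpha>) * (\<sigma> * \<bar>fst z\<bar> powr (1 - \<alpha>)) / fst z * snd z * fst h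
      + \<sigma> * \<bar>fst z\<bar> powr (1 - \<alpha>) * snd h)) (at z)"
    unfolding axis_v_def[abs_def]
    by (rule has_derivative_eq_rhs[OF has_derivative_separable[OF DERIV_cmult[OF p] DERIV_ident DERIV_const]])
      (simp add: divide_inverse mult_ac)
  show "(axis_x has_derivative (\<lambda>h. S (snd z) * fst h + fst z * C (snd z) * snd h)) (at z)"
    unfolding axis_x_def[abs_def]
    by (rule has_derivative_eq_rhs[OF has_derivative_separable[OF DERIV_ident S_derivative DERIV_const]]) simp
  have 1: "1 + \<alpha> \<noteq> 0" using \<alpha> by simp
  have 2: "s * (k * (P * i)) / k * q + 0 = s * P * i * q" "s * P / k * (k * w) = s * P * w" if "k \<noteq> 0" for s k P i q w :: real
    using that by simp_all
  show "(axis_y has_derivative (\<lambda>h. \<sigma> * \<bar>fst z\<bar> powr (1 + \<alpha>) / fst z * Q (snd z) * fst h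
      + \<sigma> * \<bar>fst z\<bar> powr (1 + \<alpha>) * \<bar>S (snd z)\<bar> powr (2 * \<alpha>) * snd h)) (at z)"
    unfolding axis_y_def[abs_def]
    by (rule has_derivative_eq_rhs[OF has_derivative_separable[OF DERIV_cdivide[OF DERIV_cmult[OF p]] Q_derivative DERIV_const]])
      (simp only: 2[OF 1], simp only: divide_inverse)
  have "((\<lambda>t. S t - t * C t) has_real_derivative \<alpha> * t * oscillator_force \<alpha> (S t)) (at t)" for t
    by (rule derivative_eq_intros S_derivative C_derivative refl | simp)+
  from has_derivative_eq_rhs[OF has_derivative_separable[OF DERIV_const[of 1] this DERIV_const[of 0], of z]]
  show "(axis_K has_derivative (\<lambda>h. 0 * fst h + \<alpha> * snd z * oscillator_force \<alpha> (S (snd z)) * snd h)) (at z)"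
    unfolding axis_K_def[abs_def] by simp
qed

text \<open>\<open>axis_K\<close> depends on the frequency alone, so the fold determinant is one
  product, nonzero as soon as \<open>S\<close> is nonzero at the final phase. This is why no
  exceptional zeros occur here.\<close>

lemma axis_jacobians:
  assumes a: "fst z \<noteq> 0"
  shows "jac axis_u axis_v z = \<alpha> * snd z * (\<sigma> * \<bar>fst z\<bar> powr (1 - \<alpha>))"
    and "jac axis_x axis_y z = axis_K z * axis_factor z"
    and "jac axis_K axis_x z = - \<alpha> * snd z * \<bar>S (snd z)\<bar> powr (2 * \<alpha>)"
proof -
  note pd = axis_derivatives[OF a, THEN pd_eqI(1)] axis_derivatives[OF a, THEN pd_eqI(2)]
  show "jac axis_u axis_v z = \<alpha> * snd z * (\<sigma> * \<bar>fst z\<bar> powr (1 - \<alpha>))"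
    unfolding jac_def pd using a by (simp add: field_simps)
  have p: "\<bar>S t\<bar> powr (2 * \<alpha>) = 1 - C t * C t" for t by (simp add: C_squared)
  have "jac axis_x axis_y z = axis_factor z * (S (snd z) * (1 - C (snd z) * C (snd z)) - C (snd z) * Q (snd z))"
    unfolding jac_def pd p axis_factor_def using a by (simp add: field_simps)
  also have "S (snd z) * (1 - C (snd z) * C (snd z)) - C (snd z) * Q (snd z) = axis_K z"
    by (simp add: axis_K_def Q_def algebra_simps)
  finally show "jac axis_x axis_y z = axis_K z * axis_factor z" by simp
  show "jac axis_K axis_x z = - \<alpha> * snd z * \<bar>S (snd z)\<bar> powr (2 * \<alpha>)"
    unfolding jac_def pd S_force[symmetric] by simp
qed

lemma grushin_exp_axis: "fst z \<noteq> 0 \<Longrightarrow> grushin_exp \<alpha> (0, y0) (axis_u z, axis_v z) = (axis_x z, axis_y z)"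
  using grushin_exp_param[OF _ \<sigma>, of "fst z" 0 y0 "snd z"]
  by (simp add: axis_u_def axis_v_def axis_x_def axis_y_def S0 C0 Q_def mult_ac)

lemma axis_sign_nonzero: "\<sigma> \<noteq> 0" using \<sigma> by auto

lemma open_fst_nonzero: "open {z :: real \<times> real. fst z \<noteq> 0}"
  using continuous_open_preimage[OF continuous_on_fst[OF continuous_on_id] open_UNIV open_nonzero]
  by (simp add: vimage_def)

lemma axis_kernel_iff:
  assumes z: "fst z \<noteq> 0" "snd z \<noteq> 0"
    and D: "(grushin_exp \<alpha> (0, y0) has_derivative D) (at (axis_u z, axis_v z))"
  shows "{w. D w = 0} \<noteq> {0} \<longleftrightarrow> axis_K z = 0"
proof -
  have d: "axis_u differentiable at z" "axis_v differentiable at z" "axis_x differentiable at z" "axis_y differentiable at z"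
    using axis_derivatives[OF z(1)] differentiableI by blast+
  have "{w. D w = 0} \<noteq> {0} \<longleftrightarrow> jac axis_x axis_y z = 0"
    by (rule has_derivative_2d_kernel[OF open_fst_nonzero _ d(1,2) _ d(3,4) _ D])
      (use z grushin_exp_axis \<alpha> axis_sign_nonzero axis_jacobians in auto)
  also have "\<dots> \<longleftrightarrow> axis_K z = 0" using axis_jacobians(2)[OF z(1)] z axis_sign_nonzero by (simp add: axis_factor_def)
  finally show ?thesis .
qed

text \<open>At a zero of \<open>axis_K\<close> with \<open>S (snd z) = 0\<close> the value
  \<open>C (snd z)\<close> would vanish too, against \<open>energy\<close>. So a conjugate endpoint
  is automatically off the singular line, where everything is smooth.\<close>

lemma axis_regular:
  assumes z: "fst z \<noteq> 0" "snd z \<noteq> 0" and K: "axis_K z = 0"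
  shows "S (snd z) \<noteq> 0"
    and "grushin_exp \<alpha> (0, y0) differentiable (at (axis_u z, axis_v z))"
    and "equivalent_near (grushin_exp \<alpha> (0, y0)) (axis_u z, axis_v z) (\<lambda>(x::real, y::real). (x\<^sup>2, y))"
proof -
  show S: "S (snd z) \<noteq> 0" using K z S_C_not_both_zero[of "snd z"] by (auto simp: axis_K_def)
  define P where "P = {z :: real \<times> real. fst z \<noteq> 0} \<inter> {z. S (snd z) \<noteq> 0}"
  have P: "open P" "z \<in> P" unfolding P_def using z S
    by (auto intro!: open_Int open_fst_nonzero open_S_nonzero[of snd] continuous_on_snd continuous_on_id)
  note S_comp = smooth_on_S_comp[OF P(1) smooth_on_snd[OF P(1)]]
  have sm0: "smooth_on P (\<lambda>z. S (snd z))" "smooth_on P (\<lambda>z. C (snd z))"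
    by (intro S_comp; simp add: P_def)+
  have nz: "fst z \<noteq> 0" if "z \<in> P" for z using that by (simp add: P_def)
  note smi = smooth_on_add smooth_on_minus smooth_on_diff smooth_on_mult smooth_on_divide smooth_on_abs_powr
    smooth_on_const smooth_on_fst smooth_on_snd sm0 P(1)
  have sm: "smooth_on P axis_u" "smooth_on P axis_v" "smooth_on P axis_x" "smooth_on P axis_y" "smooth_on P axis_K" "smooth_on P axis_factor"
    unfolding axis_u_def[abs_def] axis_v_def[abs_def] axis_x_def[abs_def] axis_y_def[abs_def] axis_K_def[abs_def] axis_factor_def[abs_def] Q_def
    using \<alpha> by (intro smi nz; simp)+
  have E: "grushin_exp \<alpha> (0, y0) (axis_u z, axis_v z) = (axis_x z, axis_y z)" if "z \<in> P" for z
    using grushin_exp_axis that by (simp add: P_def)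
  have jM: "jac axis_u axis_v z \<noteq> 0" using axis_jacobians(1) z \<alpha> axis_sign_nonzero by simp
  note via = differentiable_via_diffeo[OF P sm(1-4) jM E]
  show "grushin_exp \<alpha> (0, y0) differentiable (at (axis_u z, axis_v z))" by (rule via(1))
  have "equivalent_near (\<lambda>z. (axis_x z, axis_y z)) z (\<lambda>(x::real, y::real). (x\<^sup>2, y))"
    by (intro fold_normal_form[OF P sm(3-6) _ K])
      (use z S \<alpha> axis_sign_nonzero axis_jacobians in \<open>auto simp: axis_factor_def P_def\<close>)
  then show "equivalent_near (grushin_exp \<alpha> (0, y0)) (axis_u z, axis_v z) (\<lambda>(x::real, y::real). (x\<^sup>2, y))"
    by (rule via(2)[rotated])
qed

end

end

section \<open>Conjugate covectors\<close>

lemma extremal_exists: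
  assumes "v \<noteq> 0" "grushin_hamiltonian \<alpha> (x0, y0) (u, v) \<noteq> 0"
  obtains u' v' x y where "grushin_extremal \<alpha> (x0, y0) (u, v) u' v' x y"
proof -
  obtain A \<omega> \<phi> where *: "A > 0" "x0 = A * S \<phi>" "u = A * \<omega> * C \<phi>" "v = sgn v * \<omega> * \<bar>A\<bar> powr (1 - \<alpha>)"
    using covector_param[OF assms] by metis
  have "sgn v * sgn v = 1" using assms by (simp add: sgn_if)
  with extremal_amplitude_phase[of A "sgn v" \<phi> y0 \<omega>] * that show thesis by force
qed

text \<open>As \<open>v0\<close> tends to 0 the endpoint \<open>x 1\<close> stays away from \<open>x0\<close>, so \<open>y 1 - y0\<close> is at least linear in \<open>v0\<close>:
  covectors with \<open>v = 0\<close> are not conjugate.\<close>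

lemma displacement_bound:
  assumes e: "grushin_extremal \<alpha> (x0, y0) (u0, v0) u v x y" and v0: "v0 > 0"
    and B: "B \<ge> 0" "u0\<^sup>2 + v0\<^sup>2 * \<bar>x0\<bar> powr (2 * \<alpha>) \<le> B\<^sup>2"
  shows "\<bar>\<bar>x 1\<bar> powr (2 * \<alpha>) * x 1 - \<bar>x0\<bar> powr (2 * \<alpha>) * x0\<bar> \<le> (2 * \<alpha> + 1) * B * ((y 1 - y0) / v0)"
proof -
  have init: "u 0 = u0" "v 0 = v0" "x 0 = x0" "y 0 = y0" using e by (auto simp: grushin_extremal_def)
  have v: "v t = v0" for t
    using DERIV_isconst_all[of v t 0] e by (auto simp: grushin_extremal_def)
  have dx: "(x has_real_derivative u t) (at t)"
    and du: "(u has_real_derivative - \<alpha> * v0\<^sup>2 * \<bar>x t\<bar> powr (2 * (\<alpha> - 1)) * x t) (at t)"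
    and dy: "(y has_real_derivative v0 * \<bar>x t\<bar> powr (2 * \<alpha>)) (at t)" for t
    using e by (auto simp: grushin_extremal_def v)
  have dp: "((\<lambda>t. \<bar>x t\<bar> powr (2 * \<alpha>)) has_real_derivative 2 * \<alpha> * (\<bar>x t\<bar> powr (2 * \<alpha> - 2) * x t) * u t) (at t)" for t
    using \<alpha> by (intro DERIV_chain2[OF has_real_derivative_abs_powr_gt1 dx]) auto
  have "(u t)\<^sup>2 + v0\<^sup>2 * \<bar>x t\<bar> powr (2 * \<alpha>) = (u 0)\<^sup>2 + v0\<^sup>2 * \<bar>x 0\<bar> powr (2 * \<alpha>)" for t
  proof (rule DERIV_isconst_all[rule_format, where f = "\<lambda>t. (u t)\<^sup>2 + v0\<^sup>2 * \<bar>x t\<bar> powr (2 * \<alpha>)"])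
    fix t
    from DERIV_add[OF DERIV_power[OF du, of 2] DERIV_cmult[OF dp, of "v0\<^sup>2"]]
    show "((\<lambda>t. (u t)\<^sup>2 + v0\<^sup>2 * \<bar>x t\<bar> powr (2 * \<alpha>)) has_real_derivative 0) (at t)"
      by (simp add: algebra_simps)
  qed
  then have "(u t)\<^sup>2 + v0\<^sup>2 * \<bar>x t\<bar> powr (2 * \<alpha>) \<le> B\<^sup>2" for t using B init by simp
  moreover have "0 \<le> v0\<^sup>2 * \<bar>x t\<bar> powr (2 * \<alpha>)" for t by simp
  ultimately have "(u t)\<^sup>2 \<le> B\<^sup>2" for t by (meson add_le_cancel_left le_add_same_cancel1 order_trans)
  then have uB: "\<bar>u t\<bar> \<le> B" for t using B(1) by (simp add: abs_le_square_iff[symmetric])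
  \<comment> \<open>The derivative of \<open>Z\<close> is \<open>(2 * \<alpha> + 1) * \<bar>x
    t\<bar> powr (2 * \<alpha>) * u t\<close> and that of \<open>y\<close> is
    \<open>v0 * \<bar>x t\<bar> powr (2 * \<alpha>)\<close>. As
    \<open>\<bar>u t\<bar> \<le> B\<close>, the multiple \<open>k\<close> of the latter dominates
    the former with either sign.\<close>
  define Z where "Z t = \<bar>x t\<bar> powr (2 * \<alpha>) * x t" for t
  define k where "k = (2 * \<alpha> + 1) * B / v0"
  have kv: "k * (v0 * p) = (2 * \<alpha> + 1) * B * p" for p using v0 by (simp add: k_def)
  have dZ: "(Z has_real_derivative (2 * \<alpha> + 1) * (\<bar>x t\<bar> powr (2 * \<alpha>) * u t)) (at t)" for t
  proof -
    have "\<bar>x t\<bar> powr (2 * \<alpha> - 2) * x t * x t = \<bar>x t\<bar> powr (2 * \<alpha>)"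
    proof (cases "x t = 0")
      case False
      then show ?thesis by (simp add: powr_diff power2_eq_square)
    qed simp
    then have "2 * \<alpha> * (\<bar>x t\<bar> powr (2 * \<alpha> - 2) * x t) * u t * x t + u t * \<bar>x t\<bar> powr (2 * \<alpha>)
        = (2 * \<alpha> + 1) * (\<bar>x t\<bar> powr (2 * \<alpha>) * u t)"
      by (simp add: algebra_simps)
    from DERIV_cong[OF DERIV_mult[OF dp dx] this] show ?thesis unfolding Z_def[abs_def] .
  qed
  have "k * y 0 - s * Z 0 \<le> k * y 1 - s * Z 1" if s: "\<bar>s\<bar> = 1" for s
  proof (rule DERIV_nonneg_imp_nondecreasing[where f = "\<lambda>t. k * y t - s * Z t"])
    fix t :: real
    have d: "((\<lambda>t. k * y t - s * Z t) has_real_derivative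
        k * (v0 * \<bar>x t\<bar> powr (2 * \<alpha>)) - s * ((2 * \<alpha> + 1) * (\<bar>x t\<bar> powr (2 * \<alpha>) * u t))) (at t)"
      by (intro DERIV_diff DERIV_cmult dy dZ)
    have "s * u t \<le> B" using uB[of t] s abs_ge_self[of "s * u t"] by (simp add: abs_mult)
    then have "0 \<le> (2 * \<alpha> + 1) * (\<bar>x t\<bar> powr (2 * \<alpha>) * (B - s * u t))" using \<alpha> by simp
    also have "\<dots> = k * (v0 * \<bar>x t\<bar> powr (2 * \<alpha>)) - s * ((2 * \<alpha> + 1) * (\<bar>x t\<bar> powr (2 * \<alpha>) * u t))"
      unfolding kv by (simp add: algebra_simps)
    finally show "\<exists>y'. ((\<lambda>t. k * y t - s * Z t) has_real_derivative y') (at t) \<and> 0 \<le> y'" using d by blast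
  qed simp
  from this[of 1] this[of "-1"] have "\<bar>Z 1 - Z 0\<bar> \<le> k * (y 1 - y 0)" by (simp add: algebra_simps abs_le_iff)
  then show ?thesis by (simp add: Z_def k_def init)
qed

lemma Conj_snd_nonzero:
  assumes "(u0, v0) \<in> Conj \<alpha> (x0, y0)"
  shows "v0 \<noteq> 0"
proof
  assume v0: "v0 = 0"
  let ?E = "grushin_exp \<alpha> (x0, y0)"
  obtain D where D: "(?E has_derivative D) (at (u0, 0))" and ker: "{w. D w = 0} \<noteq> {0}"
    and H: "grushin_hamiltonian \<alpha> (x0, y0) (u0, 0) \<noteq> 0"
    using assms v0 by (auto simp: Conj_def grushin_conjugate_def)
  have u0: "u0 \<noteq> 0" using H by (simp add: grushin_hamiltonian_def)
  have E0: "?E (s, 0) = (x0 + s, y0)" for s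
  proof -
    have "grushin_extremal \<alpha> (x0, y0) (s, 0) (\<lambda>_. s) (\<lambda>_. 0) (\<lambda>t. x0 + s * t) (\<lambda>_. y0)"
      unfolding grushin_extremal_def by (auto intro!: derivative_eq_intros)
    from grushin_exp_eq[OF \<alpha> this] show ?thesis by simp
  qed
  have lin: "linear D" using D by (rule has_derivative_linear)
  have "((\<lambda>s. ?E (s, 0)) has_derivative (\<lambda>h. D (h, 0))) (at u0)"
    by (rule has_derivative_compose[of "\<lambda>s. (s, 0)" "\<lambda>h. (h, 0)", OF _ D]) (intro derivative_intros)
  moreover have "((\<lambda>s. ?E (s, 0)) has_derivative (\<lambda>h. (h, 0))) (at u0)"
    unfolding E0 by (auto intro!: derivative_eq_intros)
  ultimately have "(\<lambda>h. D (h, 0)) = (\<lambda>h. (h, 0))" by (rule has_derivative_unique)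
  then have D1: "D (h, 0) = (h, 0)" for h by (rule fun_cong)
  have "0 \<in> {w. D w = 0}" using linear_0[OF lin] by simp
  then obtain w where w: "D w = 0" "w \<noteq> 0" using ker by blast
  \<comment> \<open>On the line v = 0 the exponential map is a translation, so
    \<open>D (h, 0) = (h, 0)\<close>. A kernel vector must then have a nonzero second component, and
    the y-component of \<open>D (0, 1)\<close> vanishes.\<close>
  have "D w = D (fst w, 0) + snd w *\<^sub>R D (0, 1)"
    unfolding linear_scale[OF lin, symmetric] linear_add[OF lin, symmetric] by simp
  then have Dw: "fst w + snd w * fst (D (0, 1)) = 0" "snd w * snd (D (0, 1)) = 0"
    using w(1) by (auto simp: D1 prod_eq_iff)
  then have "snd w \<noteq> 0" using w(2) by (auto simp: prod_eq_iff)
  then have D2: "snd (D (0, 1)) = 0" using Dw by simp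
  define g where "g v = snd (?E (u0, v))" for v
  have Ev: "((\<lambda>v. ?E (u0, v)) has_derivative (\<lambda>h. D (0, h))) (at 0)"
    by (rule has_derivative_compose[of "\<lambda>v. (u0, v)" "\<lambda>h. (0, h)", OF _ D]) (intro derivative_intros)
  have "snd (D (0, h)) = 0" for h
    using linear_scale[OF lin, of h "(0, 1)"] D2 by simp
  then have "(g has_real_derivative 0) (at 0)"
    using has_derivative_snd[OF Ev] unfolding g_def[abs_def] has_field_derivative_def
    by (auto elim!: has_derivative_eq_rhs)
  \<comment> \<open>Only the limit from the right is taken, since \<open>displacement_bound\<close>
    concerns positive \<open>v0\<close>.\<close>
  then have lim_g: "((\<lambda>v. (g v - y0) / v) \<longlongrightarrow> 0) (at_right 0)"
    unfolding DERIV_def by (auto simp: g_def E0 intro: tendsto_mono[OF at_le])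
  have "isCont (\<lambda>v. fst (?E (u0, v))) 0"
    using has_derivative_continuous[OF has_derivative_fst[OF Ev]] .
  then have lim_x: "((\<lambda>v. fst (?E (u0, v))) \<longlongrightarrow> x0 + u0) (at_right 0)"
    unfolding isCont_def by (auto simp: E0 intro: tendsto_mono[OF at_le])
  define Z where "Z s = \<bar>s\<bar> powr (2 * \<alpha>) * s" for s
  have contZ: "isCont Z s" for s
    using DERIV_isCont[OF DERIV_mult[OF has_real_derivative_abs_powr_gt1[of "2 * \<alpha>"] DERIV_ident]] \<alpha>
    unfolding Z_def[abs_def] by simp
  have lim_Z: "((\<lambda>v. \<bar>Z (fst (?E (u0, v))) - Z x0\<bar>) \<longlongrightarrow> \<bar>Z (x0 + u0) - Z x0\<bar>) (at_right 0)"
    by (intro tendsto_rabs tendsto_diff tendsto_const isCont_tendsto_compose[OF contZ lim_x])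
  define B where "B = sqrt (u0\<^sup>2 + \<bar>x0\<bar> powr (2 * \<alpha>))"
  have bound: "\<bar>Z (fst (?E (u0, v))) - Z x0\<bar> \<le> (2 * \<alpha> + 1) * B * ((g v - y0) / v)" if v: "0 < v" "v < 1" for v
  proof -
    have Hv: "grushin_hamiltonian \<alpha> (x0, y0) (u0, v) \<noteq> 0"
    proof -
      have "0 < u0\<^sup>2" "0 \<le> v\<^sup>2 * \<bar>x0\<bar> powr (2 * \<alpha>)" using u0 by auto
      then have "0 < u0\<^sup>2 + v\<^sup>2 * \<bar>x0\<bar> powr (2 * \<alpha>)" by (rule add_pos_nonneg)
      then show ?thesis by (simp add: grushin_hamiltonian_def)
    qed
    have "v \<noteq> 0" using v by simp
    obtain u' v' x y where e: "grushin_extremal \<alpha> (x0, y0) (u0, v) u' v' x y"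
      by (rule extremal_exists[OF \<open>v \<noteq> 0\<close> Hv]) (rule that)
    have "v\<^sup>2 * \<bar>x0\<bar> powr (2 * \<alpha>) \<le> 1 * \<bar>x0\<bar> powr (2 * \<alpha>)"
      using v by (intro mult_right_mono) (auto simp: power_le_one)
    then have "u0\<^sup>2 + v\<^sup>2 * \<bar>x0\<bar> powr (2 * \<alpha>) \<le> B\<^sup>2" by (simp add: B_def)
    from displacement_bound[OF e v(1) _ this] grushin_exp_eq[OF \<alpha> e]
    show ?thesis by (simp add: Z_def g_def B_def)
  qed
  have "\<bar>Z (x0 + u0) - Z x0\<bar> \<le> (2 * \<alpha> + 1) * B * 0"
  proof (rule tendsto_le[OF _ tendsto_mult_left[OF lim_g] lim_Z])
    show "\<forall>\<^sub>F v in at_right 0. \<bar>Z (fst (?E (u0, v))) - Z x0\<bar> \<le> (2 * \<alpha> + 1) * B * ((g v - y0) / v)"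
      using eventually_at_right_less[of 0] bound by (auto simp: eventually_at_right_field intro: exI[of _ 1])
  qed simp
  then have Zeq: "Z (x0 + u0) = Z x0" by simp
  \<comment> \<open>Equal values of \<open>Z\<close> force equal absolute values of the arguments.
    As \<open>u0 \<noteq> 0\<close>, only \<open>x0 + u0 = - x0\<close> with
    \<open>x0 \<noteq> 0\<close> would remain, and the oddness of \<open>Z\<close> rules it
    out.\<close>
  have Zless: "\<bar>Z a\<bar> < \<bar>Z b\<bar>" if "\<bar>a\<bar> < \<bar>b\<bar>" for a b
  proof -
    have "\<bar>a\<bar> powr (2 * \<alpha>) * \<bar>a\<bar> < \<bar>b\<bar> powr (2 * \<alpha>) * \<bar>b\<bar>"
      using that \<alpha> by (intro mult_strict_mono powr_less_mono2) auto
    then show ?thesis by (simp add: Z_def abs_mult)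
  qed
  then have "\<bar>x0 + u0\<bar> = \<bar>x0\<bar>" using Zeq by (metis less_irrefl linorder_neqE)
  with u0 have neg: "x0 + u0 = - x0" and "x0 \<noteq> 0" by (auto simp: abs_if split: if_splits)
  have "Z (x0 + u0) = - Z x0" unfolding Z_def neg by simp
  then show False using Zeq \<open>x0 \<noteq> 0\<close> by (simp add: Z_def)
qed

end

section \<open>Parametrization, folds, density and existence of conjugate covectors\<close>

context generalized_sine
begin

text \<open>\<open>Conj_snd_nonzero\<close> makes \<open>covector_param\<close> applicable; its
  positive frequency separates the two phases, and the derivative contained in conjugacy turns into
  \<open>K z = 0\<close>.\<close>

lemma Conj_param_offaxis:
  assumes x0: "x0 \<noteq> 0" and \<xi>: "\<xi> \<in> Conj \<alpha> (x0, y0)"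
  obtains \<sigma> z where "\<sigma> * \<sigma> = 1" "S (fst z) \<noteq> 0" "snd z \<noteq> fst z" "\<xi> = (covector_u x0 z, covector_v x0 \<sigma> z)" "K z = 0"
proof -
  obtain u v where uv: "\<xi> = (u, v)" by (cases \<xi>)
  have v: "v \<noteq> 0" using Conj_snd_nonzero \<xi> unfolding uv by blast
  have H: "grushin_hamiltonian \<alpha> (x0, y0) (u, v) \<noteq> 0" using \<xi> unfolding uv by (simp add: Conj_def)
  obtain A \<omega> \<phi> where p: "A > 0" "\<omega> > 0" "x0 = A * S \<phi>" "u = A * \<omega> * C \<phi>" "v = sgn v * \<omega> * \<bar>A\<bar> powr (1 - \<alpha>)"
    by (rule covector_param[OF v H]) (rule that)
  have \<sigma>: "sgn v * sgn v = 1" using v by (simp add: sgn_if)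
  have S: "S \<phi> \<noteq> 0" using p(3) x0 by auto
  have A: "x0 / S \<phi> = A" using p(3) S by simp
  let ?z = "(\<phi>, \<phi> + \<omega>)"
  have "covector_u x0 ?z = u"
  proof -
    have "covector_u x0 ?z = x0 / S \<phi> * \<omega> * C \<phi>"
      by (simp only: covector_u_def fst_conv snd_conv distrib_left) (simp add: mult_ac)
    then show ?thesis unfolding A using p(4) by simp
  qed
  moreover have "covector_v x0 (sgn v) ?z = v"
  proof -
    have "covector_v x0 (sgn v) ?z = sgn v * \<omega> * \<bar>x0 / S \<phi>\<bar> powr (1 - \<alpha>)"
      by (simp only: covector_v_def fst_conv snd_conv distrib_left) (simp add: mult_ac)
    then show ?thesis unfolding A using p(5) by simp
  qed
  ultimately have \<xi>z: "\<xi> = (covector_u x0 ?z, covector_v x0 (sgn v) ?z)" using uv by simp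
  obtain D where D: "(grushin_exp \<alpha> (x0, y0) has_derivative D) (at \<xi>)" "{w. D w = 0} \<noteq> {0}"
    using \<xi> by (auto simp: Conj_def grushin_conjugate_def)
  have "K ?z = 0"
    using offaxis_kernel_iff[OF x0 \<sigma>, of ?z y0 D] D S p(2) unfolding \<xi>z by simp
  then show thesis using that[OF \<sigma>, of ?z] S p(2) \<xi>z by simp
qed

text \<open>Conjugacy includes differentiability of the exponential map, which
  \<open>offaxis_regular\<close> supplies where \<open>S\<close> is nonzero at the final phase. The
  points found by \<open>good_zero_near\<close> are of this kind.\<close>

lemma param_in_Conj_offaxis:
  assumes x0: "x0 \<noteq> 0" and \<sigma>: "\<sigma> * \<sigma> = 1"
    and z: "S (fst z) \<noteq> 0" "snd z \<noteq> fst z" "S (snd z) \<noteq> 0" "K z = 0"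
  shows "(covector_u x0 z, covector_v x0 \<sigma> z) \<in> Conj \<alpha> (x0, y0)"
proof -
  obtain D where D: "(grushin_exp \<alpha> (x0, y0) has_derivative D) (at (covector_u x0 z, covector_v x0 \<sigma> z))"
    using offaxis_regular(1)[OF x0 \<sigma> z(1-3)] unfolding differentiable_def by blast
  have "covector_v x0 \<sigma> z = \<sigma> * \<bar>x0 / S (fst z)\<bar> powr (1 - \<alpha>) * (snd z - fst z)"
    by (simp add: covector_v_def algebra_simps)
  then have "covector_v x0 \<sigma> z \<noteq> 0" using x0 \<sigma> z by auto
  then have "0 < (covector_v x0 \<sigma> z)\<^sup>2 * \<bar>x0\<bar> powr (2 * \<alpha>)" using x0 by simp
  then have "(covector_u x0 z)\<^sup>2 + (covector_v x0 \<sigma> z)\<^sup>2 * \<bar>x0\<bar> powr (2 * \<alpha>) > 0"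
    by (intro add_nonneg_pos) auto
  then show ?thesis
    using D offaxis_kernel_iff[OF x0 \<sigma> z(1,2) D] z(4) by (auto simp: Conj_def grushin_conjugate_def grushin_hamiltonian_def)
qed

text \<open>The two conditions in \<open>nz\<close> express \<open>C (fst z) \<noteq> 0\<close> and
  \<open>S (snd z) \<noteq> 0\<close> without reference to phases; \<open>K z = 0\<close> then
  yields \<open>C (snd z) \<noteq> 0\<close>.\<close>

lemma fold_offaxis:
  assumes x0: "x0 \<noteq> 0" and \<xi>: "\<xi> \<in> Conj \<alpha> (x0, y0)"
    and nz: "fst \<xi> \<noteq> 0" "fst (grushin_exp \<alpha> (x0, y0) \<xi>) \<noteq> 0"
  shows "equivalent_near (grushin_exp \<alpha> (x0, y0)) \<xi> (\<lambda>(x::real, y::real). (x\<^sup>2, y))"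
proof -
  obtain \<sigma> z where z: "\<sigma> * \<sigma> = 1" "S (fst z) \<noteq> 0" "snd z \<noteq> fst z" "\<xi> = (covector_u x0 z, covector_v x0 \<sigma> z)" "K z = 0"
    by (rule Conj_param_offaxis[OF x0 \<xi>]) (rule that)
  have "C (fst z) \<noteq> 0" using nz(1) z(4) by (auto simp: covector_u_def)
  moreover have "S (snd z) \<noteq> 0"
    using nz(2) grushin_exp_offaxis[OF x0 z(1,2), of y0] z(4) by (auto simp: endpoint_x_def)
  moreover from calculation have "C (snd z) \<noteq> 0" using z(5) by (auto simp: K_def)
  ultimately show ?thesis unfolding z(4) using offaxis_regular(2)[OF x0 z(1-3)] z(5) by blast
qed

text \<open>Continuity of the parametrization pulls \<open>N\<close> back to a neighbourhood of the
  phases, in which \<open>good_zero_near\<close> finds a regular zero of \<open>K\<close>.\<close>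

lemma fold_dense_offaxis:
  assumes x0: "x0 \<noteq> 0" and \<xi>: "\<xi> \<in> Conj \<alpha> (x0, y0)" and N: "open N" "\<xi> \<in> N"
  shows "\<exists>\<xi>'\<in>N. \<xi>' \<in> Conj \<alpha> (x0, y0) \<and> fst \<xi>' \<noteq> 0 \<and> fst (grushin_exp \<alpha> (x0, y0) \<xi>') \<noteq> 0"
proof -
  obtain \<sigma> z where z: "\<sigma> * \<sigma> = 1" "S (fst z) \<noteq> 0" "snd z \<noteq> fst z" "\<xi> = (covector_u x0 z, covector_v x0 \<sigma> z)" "K z = 0"
    by (rule Conj_param_offaxis[OF x0 \<xi>]) (rule that)
  have "isCont (\<lambda>z. (covector_u x0 z, covector_v x0 \<sigma> z)) z"
    using has_derivative_continuous[OF has_derivative_Pair[OF offaxis_derivatives(1)[OF x0 z(1,2)] offaxis_derivatives(2)[OF x0 z(1,2)]]] .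
  then have "\<forall>\<^sub>F z' in nhds z. (covector_u x0 z', covector_v x0 \<sigma> z') \<in> N"
    using N z(4) tendsto_at_iff_tendsto_nhds[of "\<lambda>z. (covector_u x0 z, covector_v x0 \<sigma> z)" z]
    by (auto simp: isCont_def intro: topological_tendstoD)
  then obtain r where r: "r > 0" "\<And>z'. dist z' z < r \<Longrightarrow> (covector_u x0 z', covector_v x0 \<sigma> z') \<in> N"
    unfolding eventually_nhds_metric by blast
  have "K (fst z, snd z) = 0" "r / 2 > 0" using z(5) r by auto
  from good_zero_near[OF z(2,3) this] obtain a b where ab: "\<bar>a - fst z\<bar> < r / 2" "\<bar>b - snd z\<bar> < r / 2"
    "S a \<noteq> 0" "b \<noteq> a" "S b \<noteq> 0" "C a \<noteq> 0" "K (a, b) = 0" by blast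
  have "dist (a, b) z \<le> \<bar>a - fst z\<bar> + \<bar>b - snd z\<bar>"
    using norm_Pair_le[of "a - fst z" "b - snd z"] by (simp add: dist_norm minus_prod_def)
  then have "(covector_u x0 (a, b), covector_v x0 \<sigma> (a, b)) \<in> N" using r(2)[of "(a, b)"] ab by simp
  moreover have "(covector_u x0 (a, b), covector_v x0 \<sigma> (a, b)) \<in> Conj \<alpha> (x0, y0)"
    using ab by (intro param_in_Conj_offaxis[OF x0 z(1)]) auto
  moreover have "covector_u x0 (a, b) = x0 * (C a / S a) * (b - a)"
    by (simp only: covector_u_def fst_conv snd_conv right_diff_distrib diff_0 add_uminus_conv_diff)
  then have "covector_u x0 (a, b) \<noteq> 0" using ab x0 by simp
  moreover have "fst (grushin_exp \<alpha> (x0, y0) (covector_u x0 (a, b), covector_v x0 \<sigma> (a, b))) \<noteq> 0"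
    using grushin_exp_offaxis[OF x0 z(1), of "(a, b)" y0] ab x0 by (simp add: endpoint_x_def)
  ultimately show ?thesis by (metis fst_conv)
qed

text \<open>\<open>C\<close> vanishes at \<open>quarter_period\<close> and half a period later, and
  each term of \<open>K\<close> contains a factor \<open>C\<close>.\<close>

lemma Conj_nonempty_offaxis:
  assumes x0: "x0 \<noteq> 0" shows "Conj \<alpha> (x0, y0) \<noteq> {}"
proof -
  have "C (quarter_period + 2 * quarter_period) = 0" unfolding C_half_period C_quarter_period by simp
  moreover have "S quarter_period \<noteq> 0" "S (quarter_period + 2 * quarter_period) \<noteq> 0"
    using S_C_not_both_zero[of quarter_period] C_quarter_period unfolding S_half_period by auto
  ultimately have "(covector_u x0 (quarter_period, quarter_period + 2 * quarter_period), covector_v x0 1 (quarter_period, quarter_period + 2 * quarter_period)) \<in> Conj \<alpha> (x0, y0)"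
    using quarter_period_pos C_quarter_period by (intro param_in_Conj_offaxis[OF x0]) (auto simp: K_def)
  then show ?thesis by blast
qed

lemma Conj_param_axis:
  assumes \<xi>: "\<xi> \<in> Conj \<alpha> (0, y0)"
  obtains \<sigma> z where "\<sigma> * \<sigma> = 1" "fst z \<noteq> 0" "snd z \<noteq> 0" "\<xi> = (axis_u z, axis_v \<sigma> z)" "axis_K z = 0"
proof -
  obtain u v where uv: "\<xi> = (u, v)" by (cases \<xi>)
  have v: "v \<noteq> 0" using Conj_snd_nonzero \<xi> unfolding uv by blast
  have H: "grushin_hamiltonian \<alpha> (0, y0) (u, v) \<noteq> 0" using \<xi> unfolding uv by (simp add: Conj_def)
  obtain A \<omega> \<phi> where p: "A > 0" "\<omega> > 0" "0 = A * S \<phi>" "u = A * \<omega> * C \<phi>" "v = sgn v * \<omega> * \<bar>A\<bar> powr (1 - \<alpha>)"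
    by (rule covector_param[OF v H]) (rule that)
  have \<sigma>: "sgn v * sgn v = 1" using v by (simp add: sgn_if)
  have "S \<phi> = 0" using p by simp
  then have "(C \<phi>)\<^sup>2 = 1" using energy[of \<phi>] by simp
  then have C: "\<bar>C \<phi>\<bar> = 1" by (auto simp: power2_eq_1_iff)
  \<comment> \<open>\<open>x0 = 0\<close> forces \<open>S \<phi> = 0\<close> and
    \<open>C \<phi>\<close> to be 1 or -1; this sign is moved into the amplitude, which normalizes
    the initial phase to 0.\<close>
  let ?z = "(A * C \<phi>, \<omega>)"
  have z: "fst ?z \<noteq> 0" "snd ?z \<noteq> 0" using p C by auto
  have "axis_u ?z = u" "axis_v (sgn v) ?z = v"
    using p(4,5) C by (simp_all add: axis_u_def axis_v_def abs_mult mult_ac)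
  then have \<xi>z: "\<xi> = (axis_u ?z, axis_v (sgn v) ?z)" using uv by simp
  obtain D where D: "(grushin_exp \<alpha> (0, y0) has_derivative D) (at \<xi>)" "{w. D w = 0} \<noteq> {0}"
    using \<xi> by (auto simp: Conj_def grushin_conjugate_def)
  have "axis_K ?z = 0" using axis_kernel_iff[OF \<sigma> z, of y0 D] D unfolding \<xi>z by simp
  then show thesis using that[OF \<sigma> z \<xi>z] by blast
qed

lemma fold_axis:
  assumes \<xi>: "\<xi> \<in> Conj \<alpha> (0, y0)"
  shows "fst \<xi> \<noteq> 0" "fst (grushin_exp \<alpha> (0, y0) \<xi>) \<noteq> 0"
    and "equivalent_near (grushin_exp \<alpha> (0, y0)) \<xi> (\<lambda>(x::real, y::real). (x\<^sup>2, y))"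
proof -
  obtain \<sigma> z where z: "\<sigma> * \<sigma> = 1" "fst z \<noteq> 0" "snd z \<noteq> 0" "\<xi> = (axis_u z, axis_v \<sigma> z)" "axis_K z = 0"
    by (rule Conj_param_axis[OF \<xi>]) (rule that)
  note g = axis_regular[OF z(1,2,3,5)]
  show "fst \<xi> \<noteq> 0" using z by (simp add: axis_u_def)
  show "fst (grushin_exp \<alpha> (0, y0) \<xi>) \<noteq> 0"
    unfolding z(4) grushin_exp_axis[OF z(1,2)] using g(1) z(2) by (simp add: axis_x_def)
  show "equivalent_near (grushin_exp \<alpha> (0, y0)) \<xi> (\<lambda>(x::real, y::real). (x\<^sup>2, y))"
    unfolding z(4) by (rule g(3))
qed

text \<open>At \<open>2 * quarter_period\<close> the function \<open>S t - t * C t\<close> has the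
  value \<open>2 * quarter_period\<close>, and half a period later
  \<open>- 4 * quarter_period\<close>; it vanishes in between, at a positive frequency.\<close>

lemma Conj_nonempty_axis: "Conj \<alpha> (0, y0) \<noteq> {}"
proof -
  have v: "S (2 * quarter_period) = 0" "C (2 * quarter_period) = -1" "S (2 * quarter_period + 2 * quarter_period) = 0" "C (2 * quarter_period + 2 * quarter_period) = 1"
    using S_half_period[of 0] C_half_period[of 0] S_half_period[of "2 * quarter_period"] C_half_period[of "2 * quarter_period"]
    by (simp_all add: S0 C0)
  have "\<exists>\<omega>\<ge>2 * quarter_period. \<omega> \<le> 2 * quarter_period + 2 * quarter_period \<and> S \<omega> - \<omega> * C \<omega> = 0"
    by (rule IVT2) (use v quarter_period_pos in \<open>auto intro!: continuous_intros isCont_S isCont_C\<close>)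
  then obtain \<omega> where \<omega>: "\<omega> \<ge> 2 * quarter_period" "S \<omega> - \<omega> * C \<omega> = 0" by blast
  let ?z = "(1, \<omega>) :: real \<times> real"
  have z: "fst ?z \<noteq> 0" "snd ?z \<noteq> 0" and K: "axis_K ?z = 0" using \<omega> quarter_period_pos by (auto simp: axis_K_def)
  have 1: "1 * 1 = (1::real)" by simp
  obtain D where D: "(grushin_exp \<alpha> (0, y0) has_derivative D) (at (axis_u ?z, axis_v 1 ?z))"
    using axis_regular(2)[OF 1 z K] unfolding differentiable_def by blast
  have "axis_u ?z \<noteq> 0" using z by (simp add: axis_u_def)
  then have "(axis_u ?z, axis_v 1 ?z) \<in> Conj \<alpha> (0, y0)"
    using D axis_kernel_iff[OF 1 z D] K by (auto simp: Conj_def grushin_conjugate_def grushin_hamiltonian_def)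
  then show ?thesis by blast
qed

end

theorem theorem12:
  fixes \<alpha> :: real and q :: "real \<times> real"
  assumes "\<alpha> \<ge> 1"
  shows "\<exists>C0. C0 \<noteq> {} \<and>
    openin (top_of_set (Conj \<alpha> q)) C0 \<and>
    (top_of_set (Conj \<alpha> q)) closure_of C0 = Conj \<alpha> q \<and>
    (\<forall>\<xi>\<in>C0. equivalent_near (grushin_exp \<alpha> q) \<xi>
      (\<lambda>(x::real, y::real). (x\<^sup>2, y)))"
proof -
  obtain S C where "generalized_sine \<alpha> S C"
    using generalized_sine_exists[OF assms] assms unfolding generalized_sine_def by blast
  then interpret generalized_sine \<alpha> S C .
  obtain x0 y0 where q: "q = (x0, y0)" by (cases q)
  let ?E = "grushin_exp \<alpha> q"
  define F where "F = {\<xi> \<in> Conj \<alpha> q. fst \<xi> \<noteq> 0 \<and> fst (?E \<xi>) \<noteq> 0}"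
  have fold: "equivalent_near ?E \<xi> (\<lambda>(x::real, y::real). (x\<^sup>2, y))" if "\<xi> \<in> F" for \<xi>
    using that fold_offaxis[of x0 \<xi> y0] fold_axis(3)[of \<xi> y0] unfolding F_def q by (cases "x0 = 0") auto
  have dense: "\<exists>\<xi>'\<in>N. \<xi>' \<in> F" if "\<xi> \<in> Conj \<alpha> q" "open N" "\<xi> \<in> N" for \<xi> N
  proof (cases "x0 = 0")
    case True
    then show ?thesis using that fold_axis(1,2)[of \<xi> y0] unfolding F_def q by blast
  next
    case False
    then show ?thesis using fold_dense_offaxis[OF False _ that(2,3)] that(1) unfolding F_def q by blast
  qed
  have "Conj \<alpha> q \<noteq> {}"
    using Conj_nonempty_axis Conj_nonempty_offaxis unfolding q by (cases "x0 = 0") auto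
  then have "F \<noteq> {}" using dense[OF _ open_UNIV UNIV_I] by blast
  moreover have "openin (top_of_set (Conj \<alpha> q)) F"
  proof (subst openin_subopen, intro ballI)
    fix \<xi> assume \<xi>: "\<xi> \<in> F"
    then obtain D where "(?E has_derivative D) (at \<xi>)"
      by (auto simp: F_def Conj_def grushin_conjugate_def)
    \<comment> \<open>The derivative contained in conjugacy makes the exponential map continuous at
      each point of \<open>F\<close>, which is all that relative openness requires.\<close>
    then have c: "isCont (\<lambda>\<xi>. fst (?E \<xi>)) \<xi>"
      by (intro continuous_fst has_derivative_continuous)
    have "isCont fst \<xi>" by (intro continuous_intros)
    then obtain d1 where d1: "d1 > 0" "\<And>\<xi>'. dist \<xi> \<xi>' < d1 \<Longrightarrow> fst \<xi>' \<noteq> 0"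
      using continuous_at_avoid[OF \<open>isCont fst \<xi>\<close>, of 0] \<xi> unfolding F_def by blast
    obtain d2 where d2: "d2 > 0" "\<And>\<xi>'. dist \<xi> \<xi>' < d2 \<Longrightarrow> fst (?E \<xi>') \<noteq> 0"
      using continuous_at_avoid[OF c, of 0] \<xi> unfolding F_def by auto
    show "\<exists>T. openin (top_of_set (Conj \<alpha> q)) T \<and> \<xi> \<in> T \<and> T \<subseteq> F"
    proof (intro exI conjI)
      show "openin (top_of_set (Conj \<alpha> q)) (Conj \<alpha> q \<inter> ball \<xi> (min d1 d2))"
        by (intro openin_open_Int open_ball)
      show "\<xi> \<in> Conj \<alpha> q \<inter> ball \<xi> (min d1 d2)" using \<xi> d1 d2 by (simp add: F_def)
      show "Conj \<alpha> q \<inter> ball \<xi> (min d1 d2) \<subseteq> F" using d1(2) d2(2) by (force simp: F_def)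
    qed
  qed
  moreover have "top_of_set (Conj \<alpha> q) closure_of F = Conj \<alpha> q"
  proof -
    have "Conj \<alpha> q \<subseteq> closure F"
    proof
      fix \<xi> assume \<xi>: "\<xi> \<in> Conj \<alpha> q"
      have "\<exists>\<xi>'\<in>F. dist \<xi>' \<xi> < e" if "e > 0" for e
        using dense[OF \<xi> open_ball, of \<xi> e] that by (auto simp: dist_commute)
      then show "\<xi> \<in> closure F" by (simp add: closure_approachable)
    qed
    moreover have "F \<subseteq> Conj \<alpha> q" by (auto simp: F_def)
    ultimately show ?thesis by (auto simp: closure_of_subtopology Int_absorb1)
  qed
  ultimately show ?thesis using fold by blast
qed

end
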